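(* Let $n \in \mathbb{N}$, $n\ge 1$, let $\mathbb{Q}^{(n)}$ be the compositum in $\overline{\mathbb{Q}}$ of all number fields of degree at most $n$ over $\mathbb{Q}$, let $O_{\mathbb{Q}^{(n)}}$ be the ring of integers of $\mathbb{Q}^{(n)}$, and let $S \subseteq O_{\mathbb{Q}^{(n)}}$. Then $\mathrm{Int}_{\mathbb{Q}}(S,\overline{\mathbb{Z}})$ is a Prüfer domain.
   Context: $\overline{\mathbb{Q}}$ is a fixed algebraic closure of $\mathbb{Q}$ and $\overline{\mathbb{Z}}$ is the integral closure of $\mathbb{Z}$ in $\overline{\mathbb{Q}}$. $O_{\mathbb{Q}^{(n)}}=\overline{\mathbb{Z}}\cap\mathbb{Q}^{(n)}$. $\mathrm{Int}_{\mathbb{Q}}(S,\overline{\mathbb{Z}})=\{f\in\mathbb{Q}[X]\mid f(S)\subseteq\overline{\mathbb{Z}}\}$. *)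

theory Defs
  imports
    "HOL-Algebra.Algebraic_Closure_Type"
    "HOL-Algebra.Ideal_Product"
    "HOL-Algebra.Generated_Fields"
    "HOL-Algebra.Embedded_Algebras"
    "HOL-Computational_Algebra.Polynomial_Factorial"
begin

section \<open>Pruefer domains\<close>

text \<open>
  An integral domain is represented as a subring \<open>D\<close> of a field \<open>F\<close>; its quotient field is
  formed inside \<open>F\<close>, and \<open>F\<close> may be larger than that. An ideal \<open>I\<close> of \<open>D\<close> is invertible if
  \<open>I I\<^sup>-\<^sup>1 = D\<close>, where \<open>I\<^sup>-\<^sup>1 = {x. x I \<subseteq> D}\<close> with \<open>x\<close> ranging over the quotient field.
\<close>

definition quotient_field :: "('a, 'b) ring_scheme \<Rightarrow> 'a set \<Rightarrow> 'a set" where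
  "quotient_field F D = {a \<otimes>\<^bsub>F\<^esub> inv\<^bsub>F\<^esub> b | a b. a \<in> D \<and> b \<in> D \<and> b \<noteq> \<zero>\<^bsub>F\<^esub>}"

definition inverse_ideal :: "('a, 'b) ring_scheme \<Rightarrow> 'a set \<Rightarrow> 'a set \<Rightarrow> 'a set" where
  "inverse_ideal F D I = {x \<in> quotient_field F D. \<forall>y\<in>I. x \<otimes>\<^bsub>F\<^esub> y \<in> D}"

text \<open>
  The product below is taken in \<open>F\<close>, since the second factor is only a fractional ideal of \<open>D\<close>;
  \<^const>\<open>ideal_prod\<close> forms the set of finite sums of products.
\<close>

definition invertible_ideal :: "('a, 'b) ring_scheme \<Rightarrow> 'a set \<Rightarrow> 'a set \<Rightarrow> bool" where
  "invertible_ideal F D I \<longleftrightarrow> ideal_prod F I (inverse_ideal F D I) = D"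

text \<open>
  A Pruefer domain is a domain all of whose nonzero finitely generated ideals are invertible.
\<close>

definition prufer_domain :: "('a, 'b) ring_scheme \<Rightarrow> 'a set \<Rightarrow> bool" where
  "prufer_domain F D \<longleftrightarrow>
     field F \<and> subring D F \<and>
     (\<forall>A. finite A \<longrightarrow> A \<subseteq> D \<longrightarrow> genideal (F\<lparr>carrier := D\<rparr>) A \<noteq> {\<zero>\<^bsub>F\<^esub>} \<longrightarrow>
        invertible_ideal F D (genideal (F\<lparr>carrier := D\<rparr>) A))"


section \<open>Algebraic integers of bounded degree and integer-valued polynomials\<close>

text \<open>
  An algebraic closure of \<open>\<rat>\<close> is any type \<open>'a\<close> of class \<^class>\<open>alg_closed_field\<close> and
  \<^class>\<open>field_char_0\<close> all of whose elements are algebraic, such as \<^typ>\<open>rat alg_closure\<close>.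
  Its ring of algebraic integers is \<open>{x. algebraic_int x}\<close>.

  The degree \<open>[K : \<rat>]\<close> is given by the relation \<^const>\<open>ring.dimension\<close>, which holds for no \<open>d\<close>
  if \<open>K\<close> has infinite degree.
\<close>

definition compositum_upto :: "nat \<Rightarrow> 'a :: field_char_0 set" where
  "compositum_upto n =
     generate_field ring_of_type_algebra
       (\<Union>{K. subfield K ring_of_type_algebra \<and>
            (\<exists>d\<le>n. ring.dimension ring_of_type_algebra d \<rat> K)})"

definition integers_upto :: "nat \<Rightarrow> 'a :: field_char_0 set" where
  "integers_upto n = {x. algebraic_int x} \<inter> compositum_upto n"

text \<open>
  As a subring of a field, this ring is the image under \<^const>\<open>to_fract\<close> in \<open>\<rat>(X)\<close>.
\<close>

definition int_valued_polys :: "'a :: field_char_0 set \<Rightarrow> rat poly set" where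
  "int_valued_polys S = {f. \<forall>s\<in>S. algebraic_int (poly (map_poly of_rat f) s)}"

end

theory Submission
  imports Defs
begin

text \<open>
  Let \<open>D\<close> be the ring of rational polynomials that take integral values on \<open>S\<close>, and \<open>Q\<^sup>n\<close> the
  compositum of the number fields of degree at most \<open>n\<close>.

  A domain is a Pruefer domain if any two elements \<open>a\<close>, \<open>b\<close> are locally comparable: it contains
  some \<open>e\<close> with \<open>e b \<in> a D\<close> and \<open>(1 - e) a \<in> b D\<close> (\<^const>\<open>prufer_domain\<close> is derived from this in
  \<open>prufer_domain_if_comparable\<close>). Such elements \<open>e\<close> combine to a partition of unity \<open>e\<^sub>i\<close> for the
  generators \<open>a\<^sub>i\<close> of an ideal, and the quotients \<open>e\<^sub>i / a\<^sub>i\<close> show that the ideal is invertible.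

  For \<open>a\<close>, \<open>b\<close> in \<open>D\<close> one may cancel the common divisor in \<open>\<rat>[X]\<close> and clear denominators. Then some
  combination \<open>r a + s b\<close> with \<open>r\<close>, \<open>s\<close> in \<open>D\<close> is a positive integer, and it is enough to compare the
  elements of \<open>D\<close> with positive integers (\<open>comparable_of_combination\<close>). These in turn reduce to
  prime numbers (\<open>comparable_mult\<close>).

  The comparison of \<open>f \<in> D\<close> with a prime \<open>p\<close> rests on one arithmetic fact
  (\<open>compositum_power_congruence\<close>): there are positive exponents \<open>E\<close>, \<open>r\<close>, depending on \<open>n\<close> and \<open>p\<close> only,
  such that \<open>p\<close> divides \<open>b (b\<^sup>r - 1)\<close> among the algebraic integers whenever \<open>b = a\<^sup>E / p\<^sup>j\<close> is an
  algebraic integer with \<open>a \<in> Q\<^sup>n\<close>. In terms of valuations: at every place over \<open>p\<close> the value of an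
  \<open>E\<close>-th power is a multiple of the value of \<open>p\<close>, and the units have bounded order modulo \<open>p\<close>.
  So if \<open>v = g\<^sup>E / p\<^sup>j\<close> is in \<open>D\<close> and \<open>x = 1 - v\<^sup>r\<close>, then \<open>p\<close> divides \<open>v x\<^sup>E\<close>, the factor \<open>x\<^sup>E\<close> is \<open>1\<close>
  modulo \<open>v\<close>, and \<open>v x\<^sup>E / p = (g x)\<^sup>E / p\<^sup>j\<^sup>+\<^sup>1\<close> has the same form as \<open>v\<close>. Iteration compares \<open>f\<^sup>E\<close> with all
  powers of \<open>p\<close> (\<open>comparable_prime_power\<close>), in particular with \<open>p\<^sup>E\<close>, and as \<open>D\<close> is closed under
  roots this compares \<open>f\<close> with \<open>p\<close> (\<open>comparable_of_powers\<close>).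

  The arithmetic fact is a disguise of the finiteness of the set of extensions of the \<open>p\<close>-adic numbers
  of degree at most \<open>n\<close>. An algebraic number is integral if and only if it lies in all
  valuation rings, so one may fix a valuation ring \<open>V\<close> in which \<open>p\<close> is not a unit. The claim is
  that \<open>Q\<^sup>n\<close> lies in the \<open>V\<close>-adic closure of a number field \<open>F\<close> whose degree is bounded in terms of \<open>n\<close>
  and \<open>p\<close> (\<open>compositum_approx\<close>). Consider a root \<open>\<alpha> \<in> V\<close> of a polynomial \<open>h\<close> of degree at most \<open>n\<close> with
  coefficients in a field \<open>F\<close>, normalised such that \<open>h\<close> has exactly \<open>w\<close> roots in \<open>V\<close>. If these
  roots are clustered around \<open>\<alpha>\<close>, then their approximate mean \<open>- h\<^sub>w\<^sub>-\<^sub>1 / (w h\<^sub>w) \<in> F\<close> is congruent to \<open>\<alpha>\<close>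
  modulo \<open>p\<close>; subtracting it and dividing by \<open>p\<close> gives a root of the same kind
  (\<open>clustered_roots_step\<close>), and an infinite number of such steps approximates \<open>\<alpha>\<close> by elements
  of \<open>F\<close>. If they are not clustered, one zooms in at an approximation \<open>\<beta>\<close> of \<open>\<alpha>\<close>, and fewer than \<open>w\<close> roots
  remain (\<open>separated_roots_step\<close>). Up to a fixed precision there are only finitely many \<open>h\<close>, so a
  finite set of elements \<open>\<beta>\<close> suffices; it is adjoined to \<open>F\<close> before the induction on \<open>w\<close> goes on
  (\<open>weierstrass_root_approx\<close>). Finally, in a field of degree at most \<open>C\<close> every value has a multiple
  by some \<open>i \<le> C\<close> which is a multiple of the value of \<open>p\<close>, there are at most \<open>p\<^sup>C\<close> residues modulo \<open>p\<close>,
  and both properties carry over to the closure of the field.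
\<close>

section \<open>Subrings and polynomials over them\<close>

definition ring_set :: "'a::comm_ring_1 set \<Rightarrow> bool" where
  "ring_set A \<longleftrightarrow> 1 \<in> A \<and> (\<forall>x\<in>A. \<forall>y\<in>A. x - y \<in> A \<and> x * y \<in> A)"

definition poly_over :: "'a::zero set \<Rightarrow> 'a poly \<Rightarrow> bool" where
  "poly_over A h \<longleftrightarrow> (\<forall>i. coeff h i \<in> A)"

lemma ring_set_1: "ring_set A \<Longrightarrow> 1 \<in> A"
  and ring_set_diff: "ring_set A \<Longrightarrow> x \<in> A \<Longrightarrow> y \<in> A \<Longrightarrow> x - y \<in> A"
  and ring_set_mult: "ring_set A \<Longrightarrow> x \<in> A \<Longrightarrow> y \<in> A \<Longrightarrow> x * y \<in> A"
  by (auto simp: ring_set_def)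

lemma ring_set_0: "ring_set A \<Longrightarrow> 0 \<in> A"
  using ring_set_diff[of A 1 1] ring_set_1[of A] by simp

lemma ring_set_uminus: "ring_set A \<Longrightarrow> x \<in> A \<Longrightarrow> - x \<in> A"
  using ring_set_diff[of A 0 x] ring_set_0[of A] by simp

lemma ring_set_add: "ring_set A \<Longrightarrow> x \<in> A \<Longrightarrow> y \<in> A \<Longrightarrow> x + y \<in> A"
  using ring_set_diff[of A x "- y"] ring_set_uminus[of A y] by simp

lemma ring_set_power: "ring_set A \<Longrightarrow> x \<in> A \<Longrightarrow> x ^ n \<in> A"
  by (induction n) (auto intro: ring_set_1 ring_set_mult)

lemma ring_set_sum: "ring_set A \<Longrightarrow> (\<And>i. i \<in> I \<Longrightarrow> f i \<in> A) \<Longrightarrow> sum f I \<in> A"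
  by (induction I rule: infinite_finite_induct) (auto intro: ring_set_0 ring_set_add)

lemma ring_set_of_nat: "ring_set A \<Longrightarrow> of_nat n \<in> A"
  by (induction n) (auto intro: ring_set_0 ring_set_1 ring_set_add)

lemma ring_set_of_int: "ring_set A \<Longrightarrow> of_int n \<in> A"
  by (cases n rule: int_cases) (auto intro!: ring_set_of_nat ring_set_uminus simp del: of_nat_Suc)

lemmas ring_set_intros = ring_set_0 ring_set_1 ring_set_diff ring_set_mult ring_set_uminus
  ring_set_add ring_set_power ring_set_sum ring_set_of_nat ring_set_of_int

lemma ring_set_Int: "ring_set A \<Longrightarrow> ring_set B \<Longrightarrow> ring_set (A \<inter> B)"
  by (auto simp: ring_set_def)

lemma poly_over_mono: "poly_over A h \<Longrightarrow> A \<subseteq> B \<Longrightarrow> poly_over B h"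
  by (auto simp: poly_over_def)

lemma poly_over_pCons: "poly_over A (pCons a h) \<longleftrightarrow> a \<in> A \<and> poly_over A h"
  by (auto simp: poly_over_def coeff_pCons split: nat.splits)

lemma poly_over_add: "ring_set A \<Longrightarrow> poly_over A g \<Longrightarrow> poly_over A h \<Longrightarrow> poly_over A (g + h)"
  and poly_over_diff: "ring_set A \<Longrightarrow> poly_over A g \<Longrightarrow> poly_over A h \<Longrightarrow> poly_over A (g - h)"
  and poly_over_0: "ring_set A \<Longrightarrow> poly_over A 0"
  and poly_over_smult: "ring_set A \<Longrightarrow> a \<in> A \<Longrightarrow> poly_over A h \<Longrightarrow> poly_over A (smult a h)"
  and poly_over_mult: "ring_set A \<Longrightarrow> poly_over A g \<Longrightarrow> poly_over A h \<Longrightarrow> poly_over A (g * h)"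
  by (auto simp: poly_over_def coeff_mult intro!: ring_set_intros)

lemma poly_over_monom: "ring_set A \<Longrightarrow> a \<in> A \<Longrightarrow> poly_over A (monom a k)"
  by (auto simp: poly_over_def intro: ring_set_intros)

lemma poly_over_pcompose:
  "ring_set A \<Longrightarrow> poly_over A g \<Longrightarrow> poly_over A h \<Longrightarrow> poly_over A (g \<circ>\<^sub>p h)"
  by (induction g)
     (auto simp: pcompose_pCons poly_over_pCons intro!: poly_over_add poly_over_mult poly_over_0)

lemma poly_over_poly: "ring_set A \<Longrightarrow> poly_over A h \<Longrightarrow> x \<in> A \<Longrightarrow> poly h x \<in> A"
  by (induction h) (auto simp: poly_over_pCons intro!: ring_set_intros)

definition adjoin :: "'a::comm_ring_1 set \<Rightarrow> 'a \<Rightarrow> 'a set" where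
  "adjoin A x = {poly h x | h. poly_over A h}"

lemma adjoinI: "poly_over A h \<Longrightarrow> poly h x \<in> adjoin A x"
  by (auto simp: adjoin_def)

lemma ring_set_adjoin: assumes "ring_set A" shows "ring_set (adjoin A x)"
  unfolding ring_set_def
proof (intro conjI ballI)
  show "1 \<in> adjoin A x"
    using adjoinI[of A 1 x] assms by (simp add: one_pCons poly_over_pCons poly_over_0 ring_set_1)
next
  fix u v assume "u \<in> adjoin A x" "v \<in> adjoin A x"
  then obtain g h where gh: "u = poly g x" "v = poly h x" "poly_over A g" "poly_over A h"
    by (auto simp: adjoin_def)
  show "u - v \<in> adjoin A x" "u * v \<in> adjoin A x"
    using adjoinI[of A "g - h" x] adjoinI[of A "g * h" x] assms gh
    by (auto intro: poly_over_diff poly_over_mult)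
qed

lemma adjoin_incl: assumes "ring_set A" shows "A \<subseteq> adjoin A x"
proof
  fix a assume "a \<in> A"
  thus "a \<in> adjoin A x"
    using adjoinI[of A "[:a:]" x] assms by (simp add: poly_over_pCons poly_over_0)
qed

lemma adjoin_self: assumes "ring_set A" shows "x \<in> adjoin A x"
  using adjoinI[of A "[:0, 1:]" x] assms
  by (simp add: poly_over_pCons poly_over_0 ring_set_0 ring_set_1)

section \<open>Valuation rings\<close>

definition valuation_ring :: "'a::field set \<Rightarrow> bool" where
  "valuation_ring V \<longleftrightarrow> ring_set V \<and> (\<forall>x. x \<in> V \<or> inverse x \<in> V)"

lemma poly_over_reflect:
  "ring_set A \<Longrightarrow> poly_over A h \<Longrightarrow> poly_over A (reflect_poly h)"
  by (auto simp: poly_over_def coeff_reflect_poly intro: ring_set_0)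

text \<open>
  With \<open>t = 1 - a / z\<close> one has \<open>t z = z - a\<close>. Hence \<open>t\<^sup>k z \<in> A\<close> would entail \<open>z \<in> A\<close> by descent on \<open>k\<close>,
  which means that \<open>z\<close> is not in \<open>A[1/t]\<close> either; by maximality \<open>1/t\<close> already lies in \<open>A\<close>.
\<close>

lemma maximal_subring_unit:
  fixes A :: "'a::field set"
  assumes A: "ring_set A" "inverse z \<in> A" "z \<notin> A"
    and max: "\<And>B. ring_set B \<Longrightarrow> A \<subseteq> B \<Longrightarrow> z \<notin> B \<Longrightarrow> B = A"
    and a: "a \<in> A"
  shows "1 - inverse z * a \<noteq> 0 \<and> inverse (1 - inverse z * a) \<in> A"
proof -
  define t where "t = 1 - inverse z * a"
  have z0: "z \<noteq> 0" using A ring_set_0 by auto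
  have tA: "t \<in> A" using A a by (auto simp: t_def intro!: ring_set_intros)
  have t0: "t \<noteq> 0"
  proof
    assume "t = 0"
    hence "inverse z * a = 1" by (simp add: t_def)
    hence "z = a" using z0 by (simp add: field_simps)
    thus False using a A by simp
  qed
  have down: "t ^ k * z \<notin> A" for k
  proof (induction k)
    case 0 thus ?case using A by simp
  next
    case (Suc k)
    have "t ^ Suc k * z = t ^ k * z - a * t ^ k" using z0 by (simp add: t_def field_simps)
    moreover have "a * t ^ k \<in> A" using A a tA by (intro ring_set_intros)
    ultimately have "t ^ Suc k * z \<in> A \<Longrightarrow> t ^ k * z \<in> A"
      using ring_set_add[of A "t ^ k * z - a * t ^ k" "a * t ^ k"] A by auto
    thus ?case using Suc by blast
  qed
  have "inverse t \<in> A"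
  proof (rule ccontr)
    assume n: "inverse t \<notin> A"
    have "z \<in> adjoin A (inverse t)"
    proof (rule ccontr)
      assume "z \<notin> adjoin A (inverse t)"
      from max[OF ring_set_adjoin adjoin_incl this] A
      have "adjoin A (inverse t) = A" by blast
      thus False using n adjoin_self[of A "inverse t"] A by auto
    qed
    then obtain h where h: "poly_over A h" "z = poly h (inverse t)" by (auto simp: adjoin_def)
    have "poly (reflect_poly h) t = t ^ degree h * z"
      using h t0 by (simp add: poly_reflect_poly_nz)
    moreover have "poly (reflect_poly h) t \<in> A"
      using A h tA by (intro poly_over_poly poly_over_reflect)
    ultimately show False using down by simp
  qed
  thus ?thesis using t0 by (simp add: t_def)
qed

text \<open>
  If \<open>x\<close> and \<open>1/x\<close> are both missing from \<open>A\<close>, adjoining either of them produces \<open>z\<close>, so that \<open>1\<close> is a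
  polynomial in \<open>x\<close> and also one in \<open>1/x\<close>, with coefficients in the ideal \<open>A / z\<close>. Of two such relations of least
  degree the longer one can be shortened by means of the other, because \<open>1\<close> minus the constant
  coefficient of the latter is a unit.
\<close>

lemma maximal_subring_valuation:
  fixes A :: "'a::field set"
  assumes A: "ring_set A" "inverse z \<in> A" "z \<notin> A"
    and max: "\<And>B. ring_set B \<Longrightarrow> A \<subseteq> B \<Longrightarrow> z \<notin> B \<Longrightarrow> B = A"
  shows "valuation_ring A"
proof (rule ccontr)
  assume "\<not> valuation_ring A"
  then obtain x where x: "x \<notin> A" "inverse x \<notin> A" using A by (auto simp: valuation_ring_def)
  define J where "J = (\<lambda>a. inverse z * a) ` A"
  have z0: "z \<noteq> 0" using A ring_set_0 by auto
  have JA: "J \<subseteq> A" using A by (auto simp: J_def intro: ring_set_mult)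
  have Jd: "u - v \<in> J" "c * u \<in> J" "0 \<in> J" if "u \<in> J" "v \<in> J" "c \<in> A" for u v c
  proof -
    from that obtain a b where "u = inverse z * a" "v = inverse z * b" "a \<in> A" "b \<in> A"
      by (auto simp: J_def)
    hence "u - v = inverse z * (a - b)" "c * u = inverse z * (c * a)" "a - b \<in> A" "c * a \<in> A"
      using A that by (auto simp: algebra_simps intro: ring_set_intros)
    thus "u - v \<in> J" "c * u \<in> J" by (auto simp: J_def)
    show "0 \<in> J" using ring_set_0[of A] A by (auto simp: J_def image_iff intro!: bexI[of _ 0])
  qed
  have J1: "1 \<notin> J"
  proof
    assume "1 \<in> J"
    then obtain a where "a \<in> A" "inverse z * a = 1" by (auto simp: J_def)
    hence "z = a" using z0 by (simp add: field_simps)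
    thus False using \<open>a \<in> A\<close> A by simp
  qed
  define Q where "Q = (\<lambda>y m. \<exists>h. poly_over J h \<and> poly h y = 1 \<and> degree h = m)"
  have ex: "\<exists>m. Q y m" if y: "y \<notin> A" for y
  proof -
    have "z \<in> adjoin A y"
    proof (rule ccontr)
      assume "z \<notin> adjoin A y"
      from max[OF ring_set_adjoin adjoin_incl this] A have "adjoin A y = A" by blast
      thus False using y adjoin_self[of A y] A by auto
    qed
    then obtain h where h: "poly_over A h" "z = poly h y" by (auto simp: adjoin_def)
    have "poly_over J (smult (inverse z) h)" using h by (auto simp: poly_over_def J_def)
    moreover have "poly (smult (inverse z) h) y = 1" using h z0 by simp
    ultimately show ?thesis unfolding Q_def by blast
  qed
  have key: False if y: "y \<noteq> 0" and m: "Q y m" "\<And>k. Q y k \<Longrightarrow> m \<le> k" and l: "Q (inverse y) l" "l \<le> m" for y m l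
  proof -
    obtain h where h: "poly_over J h" "poly h y = 1" "degree h = m" using m by (auto simp: Q_def)
    obtain g where g: "poly_over J g" "poly g (inverse y) = 1" "degree g = l" using l by (auto simp: Q_def)
    have l0: "l > 0"
    proof (rule ccontr)
      assume "\<not> l > 0"
      then obtain c where "g = [:c:]" using g by (auto elim: degree_eq_zeroE)
      thus False using g J1 by (auto simp: poly_over_pCons)
    qed
    obtain a where a: "a \<in> A" "coeff g 0 = inverse z * a" using g by (auto simp: poly_over_def J_def)
    define t where "t = 1 - coeff g 0"
    have t: "t \<noteq> 0" "inverse t \<in> A"
      using maximal_subring_unit[OF A max a(1)] a by (auto simp: t_def)
    \<comment> \<open>The relation in \<open>1/y\<close>, multiplied by \<open>y\<^sup>l\<close> and solved for \<open>y\<^sup>l\<close>.\<close>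
    define r where "r = smult (inverse t) (reflect_poly g - monom (coeff g 0) l)"
    have "poly (reflect_poly g) y = y ^ l"
      using g y poly_reflect_poly_nz[of y g] by simp
    hence ry: "poly r y = y ^ l" using t by (simp add: r_def poly_monom field_simps t_def)
    have rc: "coeff r i = (if i < l then inverse t * coeff g (l - i) else 0)" for i
      using g by (auto simp: r_def coeff_reflect_poly)
    define h' where "h' = h - monom (coeff h m) m + monom (coeff h m) (m - l) * r"
    have hm: "coeff h m \<in> J" using h by (auto simp: poly_over_def)
    have hc: "coeff h' i = coeff h i - (if i = m then coeff h m else 0) +
        (if i < m - l then 0 else coeff h m * coeff r (i - (m - l)))" for i
      unfolding h'_def by (auto simp: coeff_monom_mult)
    have add: "u + v \<in> J" if "u \<in> J" "v \<in> J" for u v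
      using Jd(1)[of u "0 - v" 1] Jd(1)[of 0 v 1] Jd(3)[of u v 1] that ring_set_1 A by auto
    have "0 \<in> J" using Jd(3)[OF hm hm, of 1] ring_set_1 A by auto
    have rA: "coeff r i \<in> A" for i
      using t g JA ring_set_0[of A] A by (auto simp: rc poly_over_def intro!: ring_set_mult)
    have "poly_over J h'"
      unfolding poly_over_def hc
      using h hm rA Jd(1,2) \<open>0 \<in> J\<close> add ring_set_1[of A] A
      by (intro allI add) (auto simp: poly_over_def mult.commute[of "coeff h m"])
    moreover have "poly h' y = 1"
      using h ry l by (simp add: h'_def poly_monom flip: power_add)
    moreover have "degree h' < m"
    proof -
      have "coeff h' i = 0" if "i \<ge> m" for i
        using that h l l0 by (auto simp: hc rc coeff_eq_0)
      hence "degree h' \<le> m - 1" using l l0 by (intro degree_le) auto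
      thus ?thesis using l l0 by linarith
    qed
    ultimately show False using m(2)[of "degree h'"] by (auto simp: Q_def)
  qed
  have x0: "x \<noteq> 0" "inverse x \<noteq> 0" using x A ring_set_0 by auto
  define m where "m = (LEAST m. Q x m)"
  define l where "l = (LEAST m. Q (inverse x) m)"
  have m: "Q x m" "\<And>k. Q x k \<Longrightarrow> m \<le> k"
    using ex[OF x(1)] unfolding m_def by (auto intro: LeastI_ex Least_le)
  have l: "Q (inverse x) l" "\<And>k. Q (inverse x) k \<Longrightarrow> l \<le> k"
    using ex[OF x(2)] unfolding l_def by (auto intro: LeastI_ex Least_le)
  show False
    using key[OF x0(1) m l(1)] key[OF x0(2) l, of m] m(1) by (cases "l \<le> m") auto
qed

text \<open>
  Zorn's lemma is applied to the subrings that contain \<open>1/z\<close> but not \<open>z\<close>. The ring \<open>\<int>[1/z]\<close> is one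
  of them, since an equation \<open>z = h (1/z)\<close> becomes monic when multiplied by a power of \<open>z\<close>.
\<close>

lemma ex_valuation_ring_excluding:
  fixes z :: "'a::field_char_0"
  assumes "\<not> algebraic_int z"
  obtains V where "valuation_ring V" "z \<notin> V"
proof -
  define \<A> where "\<A> = {A. ring_set A \<and> inverse z \<in> A \<and> z \<notin> A}"
  have z0: "z \<noteq> 0" using assms by auto
  have Z: "ring_set (\<int> :: 'a set)" by (auto simp: ring_set_def)
  have "adjoin \<int> (inverse z) \<in> \<A>"
  proof -
    have "z \<notin> adjoin \<int> (inverse z)"
    proof
      assume "z \<in> adjoin \<int> (inverse z)"
      then obtain h where h: "poly_over \<int> h" "z = poly h (inverse z)" by (auto simp: adjoin_def)
      define g where "g = monom 1 (Suc (degree h)) - reflect_poly h"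
      have "poly (reflect_poly h) z = z ^ degree h * z"
        using h z0 poly_reflect_poly_nz[of z h] by simp
      hence "poly g z = 0" by (simp add: g_def poly_monom)
      moreover have "degree g = Suc (degree h)"
        unfolding g_def diff_conv_add_uminus
        by (subst degree_add_eq_left)
           (auto simp: degree_monom_eq le_imp_less_Suc degree_reflect_poly_le)
      moreover have "coeff (reflect_poly h) (Suc (degree h)) = 0"
        by (simp add: coeff_reflect_poly)
      hence "coeff g (Suc (degree h)) = 1" by (simp add: g_def)
      moreover have "poly_over \<int> g"
        unfolding g_def using Z h by (intro poly_over_diff poly_over_reflect poly_over_monom) auto
      ultimately have "algebraic_int z"
        by (intro algebraic_int.intros[of g]) (auto simp: poly_over_def)
      thus False using assms by simp
    qed
    thus ?thesis using Z by (auto simp: \<A>_def intro: ring_set_adjoin adjoin_self)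
  qed
  moreover have "\<Union>C \<in> \<A>" if C: "C \<noteq> {}" "subset.chain \<A> C" for C
  proof -
    have CA: "A \<in> \<A>" if "A \<in> C" for A using C that by (auto simp: subset_chain_def)
    have "ring_set (\<Union>C)"
      unfolding ring_set_def
    proof (intro conjI ballI)
      show "1 \<in> \<Union>C" using C CA by (auto simp: \<A>_def intro: ring_set_1)
    next
      fix x y assume "x \<in> \<Union>C" "y \<in> \<Union>C"
      then obtain A B where "A \<in> C" "B \<in> C" "x \<in> A" "y \<in> B" by auto
      then obtain D where "D \<in> C" "x \<in> D" "y \<in> D"
        using C unfolding subset_chain_def by blast
      thus "x - y \<in> \<Union>C" "x * y \<in> \<Union>C"
        using CA[of D] by (auto simp: \<A>_def intro: ring_set_diff ring_set_mult)
    qed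
    thus ?thesis using C CA by (auto simp: \<A>_def)
  qed
  ultimately obtain M where M: "M \<in> \<A>" "\<And>B. B \<in> \<A> \<Longrightarrow> M \<subseteq> B \<Longrightarrow> B = M"
    using subset_Zorn_nonempty[of \<A>] by blast
  have "valuation_ring M"
    using M by (intro maximal_subring_valuation[of M z]) (auto simp: \<A>_def)
  thus ?thesis using that M by (auto simp: \<A>_def)
qed

text \<open>
  If \<open>x\<close> is not in \<open>V\<close>, then \<open>1/x\<close> is, and dividing a monic equation of degree \<open>d\<close> by \<open>x\<^sup>d\<^sup>-\<^sup>1\<close> expresses \<open>x\<close> as an
  integral polynomial in \<open>1/x\<close>.
\<close>

lemma algebraic_int_in_valuation_ring:
  assumes V: "valuation_ring V" and x: "algebraic_int x"
  shows "x \<in> V"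
proof (rule ccontr)
  assume n: "x \<notin> V"
  have R: "ring_set V" and inv: "inverse x \<in> V" using V n by (auto simp: valuation_ring_def)
  have x0: "x \<noteq> 0" using n R ring_set_0 by auto
  obtain p where p: "lead_coeff p = 1" "\<forall>i. coeff p i \<in> \<int>" "poly p x = 0"
    using x by (auto simp: algebraic_int.simps)
  have pV: "coeff p i \<in> V" for i
    using p R by (metis Ints_cases ring_set_of_int)
  have d: "degree p > 0"
  proof (rule ccontr)
    assume "\<not> degree p > 0"
    then obtain c where "p = [:c:]" by (auto elim: degree_eq_zeroE)
    thus False using p by auto
  qed
  then obtain m where m: "degree p = Suc m" using gr0_implies_Suc by blast
  have "x ^ Suc m = - (\<Sum>i\<le>m. coeff p i * x ^ i)"
    using p m by (simp add: poly_altdef add_eq_0_iff)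
  hence "x = - (\<Sum>i\<le>m. coeff p i * x ^ i) * inverse x ^ m"
    using x0 by (simp add: field_simps)
  also have "\<dots> = - (\<Sum>i\<le>m. coeff p i * inverse x ^ (m - i))"
  proof -
    have "x ^ i * inverse x ^ m = inverse x ^ (m - i)" if "i \<le> m" for i
      using that x0 by (simp add: power_diff field_simps)
    thus ?thesis by (simp add: sum_distrib_right mult.assoc)
  qed
  also have "\<dots> \<in> V" using R pV inv by (intro ring_set_intros) auto
  finally show False using n by simp
qed

lemma algebraic_int_iff_valuation_rings:
  fixes x :: "'a::field_char_0"
  shows "algebraic_int x \<longleftrightarrow> (\<forall>V. valuation_ring V \<longrightarrow> x \<in> V)"
  using algebraic_int_in_valuation_ring ex_valuation_ring_excluding by metis

text \<open>
  Closure of the algebraic integers under sums and products comes for free from their description as an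
  intersection of rings.
\<close>

lemma ring_set_algebraic_int: "ring_set {x :: 'a::field_char_0. algebraic_int x}"
  unfolding ring_set_def
  by (auto simp: algebraic_int_iff_valuation_rings valuation_ring_def intro: ring_set_intros)

section \<open>Rational linear dependence\<close>

interpretation rat_vs: vector_space "\<lambda>(q::rat) (x::'a::field_char_0). of_rat q * x"
  by standard (auto simp: algebra_simps of_rat_add of_rat_mult)

text \<open>
  An upper bound for the degree of \<open>F\<close> over \<open>\<rat>\<close>. A spanning set outside \<open>F\<close> is permitted, which makes the
  bound monotone in \<open>F\<close>.
\<close>

definition dim_le :: "'a::field_char_0 set \<Rightarrow> nat \<Rightarrow> bool" where
  "dim_le F C \<longleftrightarrow> (\<exists>B. finite B \<and> card B \<le> C \<and> F \<subseteq> rat_vs.span B)"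

lemma common_denominator:
  assumes "finite I"
  shows "\<exists>d::int. d > 0 \<and> (\<forall>i\<in>I. \<exists>k::int. of_int d * (u i :: rat) = of_int k)"
  using assms
proof (induction I)
  case empty
  show ?case by (intro exI[of _ 1]) auto
next
  case (insert j I)
  then obtain d where d: "d > 0" "\<forall>i\<in>I. \<exists>k::int. of_int d * u i = of_int k" by blast
  obtain a b where ab: "quotient_of (u j) = (a, b)" by (cases "quotient_of (u j)")
  note b = quotient_of_denom_pos[OF ab] quotient_of_div[OF ab]
  have "\<exists>k::int. of_int (d * b) * u i = of_int k" if "i \<in> insert j I" for i
  proof (cases "i = j")
    case True
    have "of_int (d * b) * u i = (of_int (d * a) :: rat)"
      unfolding True b(2) using b(1) by simp
    thus ?thesis ..
  next
    case False
    with d that obtain k where k: "of_int d * u i = of_int k" by blast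
    have "of_int (d * b) * u i = of_int b * (of_int d * u i)" by simp
    also have "\<dots> = of_int (b * k)" unfolding k by simp
    finally show ?thesis ..
  qed
  moreover have "d * b > 0" using d(1) b(1) by simp
  ultimately show ?case by blast
qed

lemma dim_le_dependent:
  fixes x :: "'b \<Rightarrow> 'a::field_char_0"
  assumes F: "dim_le F C" and I: "finite I" "card I > C" and x: "\<And>i. i \<in> I \<Longrightarrow> x i \<in> F"
  obtains c :: "'b \<Rightarrow> int" where "\<exists>i\<in>I. c i \<noteq> 0" "(\<Sum>i\<in>I. of_int (c i) * x i) = 0"
proof (cases "inj_on x I")
  case False
  then obtain i j where ij: "i \<in> I" "j \<in> I" "i \<noteq> j" "x i = x j" by (auto simp: inj_on_def)
  define c where "c = (\<lambda>k. if k = i then 1 else if k = j then -1 else 0 :: int)"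
  have "(\<Sum>k\<in>I. of_int (c k) * x k) = (\<Sum>k\<in>{i,j}. of_int (c k) * x k)"
    using ij I by (intro sum.mono_neutral_right) (auto simp: c_def)
  also have "\<dots> = 0" using ij by (simp add: c_def)
  finally have "(\<Sum>k\<in>I. of_int (c k) * x k) = 0" .
  moreover have "c i \<noteq> 0" by (simp add: c_def)
  ultimately show ?thesis using that[of c] ij by blast
next
  case True
  obtain B where B: "finite B" "card B \<le> C" "F \<subseteq> rat_vs.span B" using F by (auto simp: dim_le_def)
  have "rat_vs.dependent (x ` I)"
  proof (rule ccontr)
    assume "\<not> rat_vs.dependent (x ` I)"
    from rat_vs.independent_span_bound[OF B(1) this] B x have "card (x ` I) \<le> card B" by blast
    thus False using B I card_image[OF True] by simp
  qed
  then obtain u where u: "\<exists>v\<in>x ` I. u v \<noteq> 0" "(\<Sum>v\<in>x ` I. of_rat (u v) * v) = 0"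
    using I by (auto simp: rat_vs.dependent_finite)
  obtain d :: int where d: "d > 0" "\<forall>i\<in>I. \<exists>k::int. of_int d * u (x i) = of_int k"
    using common_denominator[OF I(1), of "\<lambda>i. u (x i)"] by blast
  from bchoice[OF this(2)] obtain c :: "'b \<Rightarrow> int"
    where c: "\<And>i. i \<in> I \<Longrightarrow> of_int d * u (x i) = of_int (c i)" by blast
  have "(\<Sum>i\<in>I. of_int (c i) * x i) = (\<Sum>i\<in>I. of_int d * (of_rat (u (x i)) * x i))"
  proof (intro sum.cong refl)
    fix i assume "i \<in> I"
    have "(of_int (c i) :: 'a) = of_rat (of_int (c i))" by simp
    also have "\<dots> = of_int d * of_rat (u (x i))"
      unfolding c[OF \<open>i \<in> I\<close>, symmetric] of_rat_mult by simp
    finally show "of_int (c i) * x i = of_int d * (of_rat (u (x i)) * x i)" by simp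
  qed
  also have "\<dots> = of_int d * (\<Sum>v\<in>x ` I. of_rat (u v) * v)"
    using True by (simp add: sum.reindex sum_distrib_left)
  also have "\<dots> = 0" using u by simp
  finally have "(\<Sum>i\<in>I. of_int (c i) * x i) = 0" .
  moreover obtain i where i: "i \<in> I" "u (x i) \<noteq> 0" using u by blast
  have "c i \<noteq> 0" using c[OF i(1)] d(1) i(2) by (metis mult_eq_0_iff of_int_0 of_int_eq_0_iff less_irrefl)
  ultimately show ?thesis using i by (intro that[of c] bexI[of _ i])
qed

text \<open>
  Dividing an integral relation by the greatest common divisor of its coefficients makes it nontrivial
  modulo \<open>p\<close>. This is how the degree over \<open>\<rat>\<close> controls residues modulo \<open>p\<close>.
\<close>

lemma dim_le_dependent_primitive:
  fixes x :: "'b \<Rightarrow> 'a::field_char_0"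
  assumes F: "dim_le F C" and I: "finite I" "card I > C" and x: "\<And>i. i \<in> I \<Longrightarrow> x i \<in> F"
    and p: "prime p"
  obtains c :: "'b \<Rightarrow> int" where "\<exists>i\<in>I. \<not> int p dvd c i" "(\<Sum>i\<in>I. of_int (c i) * x i) = 0"
proof -
  obtain c where c: "\<exists>i\<in>I. c i \<noteq> 0" "(\<Sum>i\<in>I. of_int (c i) * x i) = 0"
    using dim_le_dependent[of F C I x] F I x by blast
  define d where "d = Gcd (c ` I)"
  have d0: "d \<noteq> 0" using c by (auto simp: d_def Gcd_0_iff)
  define c' where "c' = (\<lambda>i. c i div d)"
  have c': "c i = d * c' i" if "i \<in> I" for i
    using that by (auto simp: c'_def d_def)
  have "\<exists>i\<in>I. \<not> int p dvd c' i"
  proof (rule ccontr)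
    assume "\<not> ?thesis"
    hence "d * int p dvd c i" if "i \<in> I" for i using that c' by auto
    hence "d * int p dvd d" unfolding d_def by (intro Gcd_greatest) auto
    hence "int p dvd 1" using d0 by (metis dvd_times_left_cancel_iff mult.right_neutral)
    thus False using p by (metis int_dvd_int_iff not_prime_unit of_nat_1)
  qed
  moreover have "(\<Sum>i\<in>I. of_int (c' i) * x i) = 0"
  proof -
    have "of_int d * (\<Sum>i\<in>I. of_int (c' i) * x i) = (\<Sum>i\<in>I. of_int (c i) * x i)"
      unfolding sum_distrib_left by (intro sum.cong) (auto simp: c')
    thus ?thesis using c d0 by simp
  qed
  ultimately show ?thesis by (rule that)
qed

text \<open>
  An integral equation of \<open>x\<close> with nonzero constant term expresses \<open>1/x\<close> as a polynomial in \<open>x\<close>, so that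
  rings of algebraic numbers containing \<open>\<rat>\<close> are fields.
\<close>

lemma rat_subring_inverse:
  fixes x :: "'a::field_char_0"
  assumes F: "ring_set F" "\<rat> \<subseteq> F" and x: "x \<in> F" "algebraic x"
  shows "inverse x \<in> F"
proof (cases "x = 0")
  case True thus ?thesis using x by simp
next
  case False
  then obtain h where h: "h \<noteq> 0" "coeff h 0 \<noteq> 0" "poly (map_poly of_int h) x = 0"
    using algebraicE'_nonzero[OF x(2)] by metis
  obtain c g where hc: "h = pCons c g" by (cases h)
  have c0: "c \<noteq> 0" using h hc by simp
  have "of_int c + x * poly (map_poly of_int g) x = 0"
    using h(3) hc h(1) by (simp add: map_poly_pCons)
  hence "x * (- poly (map_poly of_int g) x * inverse (of_int c)) = 1"
    using c0 by (simp add: field_simps add_eq_0_iff)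
  hence "inverse x = - poly (map_poly of_int g) x * inverse (of_int c)"
    by (rule inverse_unique)
  moreover have "inverse (of_int c) \<in> F" using F by auto
  moreover have "poly (map_poly of_int g) x \<in> F"
    using F x by (intro poly_over_poly) (auto simp: poly_over_def coeff_map_poly intro: ring_set_intros)
  ultimately show ?thesis using F by (auto intro!: ring_set_intros simp del: mult_minus_left)
qed

section \<open>Valuations over a prime number\<close>

locale p_valuation =
  fixes V :: "'a::field_char_0 set" and p :: nat
  assumes valuation: "valuation_ring V" and prime_p: "prime p"
    and p_nonunit: "inverse (of_nat p) \<notin> V" and algebraic: "\<And>x :: 'a. algebraic x"
begin

abbreviation P :: 'a where "P \<equiv> of_nat p"

text \<open>
  With \<open>v\<close> the additive valuation that belongs to \<open>V\<close>, the relation \<open>x \<preceq> y\<close> is \<open>v x \<le> v y\<close>. Values are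
  compared only through this divisibility relation, so no value group has to be formed; the
  precision of an approximation is measured by powers of \<open>p\<close>.
\<close>

definition vle :: "'a \<Rightarrow> 'a \<Rightarrow> bool" (infix "\<preceq>" 50) where
  "x \<preceq> y \<longleftrightarrow> (\<exists>z\<in>V. y = x * z)"

abbreviation vless :: "'a \<Rightarrow> 'a \<Rightarrow> bool" (infix "\<prec>" 50) where
  "x \<prec> y \<equiv> \<not> y \<preceq> x"

lemma ring_V: "ring_set V"
  using valuation by (simp add: valuation_ring_def)

lemmas V_intros = ring_set_intros[OF ring_V]

lemma p_pos [simp]: "p > 0"
  using prime_p by (rule prime_gt_0_nat)

lemma p_neq_0 [simp]: "p \<noteq> 0"
  using p_pos by simp

lemma P_nonzero [simp]: "P \<noteq> 0"
  using p_pos by simp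

lemma vle_refl [simp]: "x \<preceq> x"
  using ring_set_1[OF ring_V] by (auto simp: vle_def intro!: bexI[of _ 1])

lemma vle_trans: "x \<preceq> y \<Longrightarrow> y \<preceq> z \<Longrightarrow> x \<preceq> z"
  unfolding vle_def using ring_set_mult[OF ring_V] by (metis mult.assoc)

lemma vle_total: "x \<preceq> y \<or> y \<preceq> x"
proof (cases "x = 0 \<or> y = 0")
  case True
  thus ?thesis using ring_set_0[OF ring_V] by (auto simp: vle_def intro!: bexI[of _ 0])
next
  case False
  hence "y = x * (y * inverse x)" "x = y * inverse (y * inverse x)" by (auto simp: field_simps)
  thus ?thesis using valuation unfolding vle_def valuation_ring_def by metis
qed

lemma vless_imp_vle: "x \<prec> y \<Longrightarrow> x \<preceq> y"
  using vle_total by blast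

lemma vless_vle_trans: "x \<prec> y \<Longrightarrow> y \<preceq> z \<Longrightarrow> x \<prec> z"
  using vle_trans by blast

lemma vle_zero [simp]: "x \<preceq> 0"
  using ring_set_0[OF ring_V] by (auto simp: vle_def intro!: bexI[of _ 0])

lemma zero_vle_iff [simp]: "0 \<preceq> x \<longleftrightarrow> x = 0"
  using ring_set_0[OF ring_V] by (auto simp: vle_def)

lemma one_vle_iff: "1 \<preceq> x \<longleftrightarrow> x \<in> V"
  by (auto simp: vle_def)

lemma vle_add: "x \<preceq> y \<Longrightarrow> x \<preceq> z \<Longrightarrow> x \<preceq> y + z"
  unfolding vle_def using ring_set_add[OF ring_V] by (metis distrib_left)

lemma vle_uminus_iff [simp]: "x \<preceq> - y \<longleftrightarrow> x \<preceq> y"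
  unfolding vle_def using ring_set_uminus[OF ring_V] by (metis minus_minus mult_minus_right)

lemma uminus_vle_iff [simp]: "- x \<preceq> y \<longleftrightarrow> x \<preceq> y"
  unfolding vle_def using ring_set_uminus[OF ring_V] by (metis minus_minus mult_minus_left mult_minus_right)

lemma vle_diff: "x \<preceq> y \<Longrightarrow> x \<preceq> z \<Longrightarrow> x \<preceq> y - z"
  using vle_add[of x y "- z"] by simp

lemma vle_sum: "(\<And>i. i \<in> I \<Longrightarrow> x \<preceq> f i) \<Longrightarrow> x \<preceq> sum f I"
  by (induction I rule: infinite_finite_induct) (auto intro: vle_add)

text \<open>
  The ultrametric inequality for strict estimates: the sum is divisible by the summand of smaller value.
\<close>

lemma vless_add:
  assumes "x \<prec> y" "x \<prec> z" shows "x \<prec> y + z"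
proof -
  have "y \<preceq> y + z \<or> z \<preceq> y + z" using vle_total[of y z] by (auto intro: vle_add)
  thus ?thesis using assms vle_trans by blast
qed

lemma vless_sum: "x \<noteq> 0 \<Longrightarrow> (\<And>i. i \<in> I \<Longrightarrow> x \<prec> f i) \<Longrightarrow> x \<prec> sum f I"
proof (induction I rule: infinite_finite_induct)
  case (insert i I)
  hence "x \<prec> f i + sum f I" by (intro vless_add) auto
  thus ?case using insert by simp
qed auto

lemma vle_mult: "a \<preceq> b \<Longrightarrow> c \<preceq> d \<Longrightarrow> a * c \<preceq> b * d"
  unfolding vle_def using ring_set_mult[OF ring_V]
  by (metis mult.assoc mult.left_commute)

lemma vle_mult_right: "a \<preceq> b \<Longrightarrow> c \<in> V \<Longrightarrow> a \<preceq> b * c"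
  using vle_mult[of a b 1 c] by (simp add: one_vle_iff)

lemma vle_mult_left: "a \<preceq> b \<Longrightarrow> c \<in> V \<Longrightarrow> a \<preceq> c * b"
  using vle_mult_right[of a b c] by (simp add: mult.commute)

lemma vle_cancel [simp]: "c \<noteq> 0 \<Longrightarrow> c * a \<preceq> c * b \<longleftrightarrow> a \<preceq> b"
  by (auto simp: vle_def)

lemma vle_power: "a \<preceq> b \<Longrightarrow> a ^ n \<preceq> b ^ n"
  by (induction n) (auto intro: vle_mult)

lemma P_in_V: "P \<in> V" by (rule V_intros)

lemma P_vless: "1 \<prec> P"
proof
  assume "P \<preceq> 1"
  then obtain z where "z \<in> V" "P * z = 1" by (auto simp: vle_def)
  thus False using p_nonunit inverse_unique by metis
qed

lemma P_power_vle: "i \<le> j \<Longrightarrow> P ^ i \<preceq> P ^ j"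
  using vle_mult_right[of "P ^ i" "P ^ i" "P ^ (j - i)"] P_in_V
  by (auto simp flip: power_add intro: ring_set_power[OF ring_V])

lemma P_power_vle_iff: "P ^ i \<preceq> P ^ j \<longleftrightarrow> i \<le> j"
proof
  assume *: "P ^ i \<preceq> P ^ j"
  show "i \<le> j"
  proof (rule ccontr)
    assume "\<not> i \<le> j"
    hence "P ^ Suc j \<preceq> P ^ i" by (intro P_power_vle) simp
    hence "P ^ j * P \<preceq> P ^ j * 1" using * vle_trans by (metis mult.right_neutral power_Suc2)
    hence "P \<preceq> 1" by (subst (asm) vle_cancel) auto
    thus False using P_vless by simp
  qed
qed (rule P_power_vle)

lemma of_int_unit:
  assumes "\<not> int p dvd c" shows "of_int c \<preceq> 1"
proof (rule ccontr)
  assume n: "\<not> of_int c \<preceq> 1"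
  have "coprime (int p) c" using assms prime_p by (simp add: prime_imp_coprime)
  then obtain u v where uv: "u * int p + v * c = 1"
    using bezout_int[of "int p" c] coprime_imp_gcd_eq_1 by metis
  have "1 \<prec> of_int u * P" "1 \<prec> of_int v * of_int c"
    using P_vless n by (metis V_intros(10) vle_mult_left vle_refl vle_trans)+
  hence "1 \<prec> of_int u * P + of_int v * of_int c" by (rule vless_add)
  moreover have "of_int u * P + of_int v * of_int c = of_int 1"
    unfolding uv[symmetric] by simp
  ultimately show False by simp
qed

lemma of_int_valuation:
  assumes "c \<noteq> 0"
  obtains t where "of_int c \<preceq> P ^ t" "P ^ t \<preceq> of_int c" "int p ^ t dvd c"
proof -
  define t where "t = multiplicity (int p) c"
  have "\<not> is_unit (int p)" using prime_p by (metis int_dvd_int_iff not_prime_unit of_nat_1)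
  then obtain u where u: "c = int p ^ t * u" "\<not> int p dvd u"
    using assms multiplicity_decompose'[of c "int p"] unfolding t_def by metis
  have "P ^ t * of_int u \<preceq> P ^ t * 1" using of_int_unit[OF u(2)] by (subst vle_cancel) auto
  moreover have "P ^ t \<preceq> P ^ t * of_int u" by (intro vle_mult_right V_intros) simp
  ultimately show ?thesis using that[of t] u by simp
qed

text \<open>
  If \<open>p\<^sup>t\<close> divides \<open>w \<le> n\<close>, then \<open>t < 2\<^sup>t \<le> p\<^sup>t \<le> n\<close>. The lemma bounds the loss of precision in a division by
  \<open>w\<close>, the step that has no analogue in characteristic \<open>p\<close>.
\<close>

lemma of_nat_vle_P_power:
  assumes "0 < w" "w \<le> n" shows "of_nat w \<preceq> P ^ n"
proof -
  obtain t where t: "of_int (int w) \<preceq> P ^ t" "int p ^ t dvd int w"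
    using of_int_valuation[of "int w"] assms by (metis less_irrefl of_nat_0_less_iff)
  have "p ^ t dvd w" using t(2) by (metis of_nat_dvd_iff of_nat_power)
  hence "p ^ t \<le> w" using assms(1) by (rule dvd_imp_le)
  moreover have "t < 2 ^ t" by simp
  moreover have "(2::nat) ^ t \<le> p ^ t" using prime_ge_2_nat[OF prime_p] by (intro power_mono) auto
  ultimately have "t \<le> n" using assms by linarith
  thus ?thesis using t(1) vle_trans P_power_vle by (metis of_int_of_nat_eq)
qed

text \<open>
  A nonzero algebraic number in \<open>V\<close> divides the constant term of one of its integral equations, and this
  term has the value of a power of \<open>p\<close>.
\<close>

lemma bounded_by_P_power:
  assumes "x \<noteq> 0" obtains k where "x \<preceq> P ^ k"
proof (cases "x \<in> V")
  case False
  hence "x \<preceq> P ^ 0" using vle_total[of x 1] by (auto simp: one_vle_iff)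
  thus ?thesis using that by blast
next
  case True
  obtain h where h: "h \<noteq> 0" "coeff h 0 \<noteq> 0" "poly (map_poly of_int h) x = 0"
    using algebraicE'_nonzero[OF algebraic assms] by metis
  obtain c g where hc: "h = pCons c g" by (cases h)
  obtain t where t: "of_int c \<preceq> P ^ t" using of_int_valuation[of c] h hc by auto
  have "of_int c = x * - poly (map_poly of_int g) x"
    using h(3) hc h(1) by (simp add: map_poly_pCons add_eq_0_iff)
  moreover have "- poly (map_poly of_int g) x \<in> V"
    using True by (intro V_intros poly_over_poly[OF ring_V])
       (auto simp: poly_over_def coeff_map_poly intro: V_intros)
  ultimately have "x \<preceq> of_int c" unfolding vle_def by blast
  thus ?thesis using that t vle_trans by blast
qed

lemma ex_vle_min:
  "finite I \<Longrightarrow> I \<noteq> {} \<Longrightarrow> \<exists>k\<in>I. \<forall>l\<in>I. f k \<preceq> f l"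
proof (induction I rule: finite_ne_induct)
  case (insert i I)
  then obtain k where k: "k \<in> I" "\<forall>l\<in>I. f k \<preceq> f l" by blast
  show ?case
  proof (cases "f k \<preceq> f i")
    case True thus ?thesis using k by auto
  next
    case False
    hence "f i \<preceq> f k" using vle_total by blast
    thus ?thesis using k vle_trans by (intro bexI[of _ i]) auto
  qed
qed auto

lemma vanishing_sum_two_minimal_terms:
  assumes I: "finite I" and s: "sum f I = 0" and nz: "i \<in> I" "f i \<noteq> 0"
  obtains k l where "k \<in> I" "l \<in> I" "k \<noteq> l" "f k \<noteq> 0" "f l \<noteq> 0" "f k \<preceq> f l" "f l \<preceq> f k"
proof -
  obtain k where k: "k \<in> I" "\<forall>l\<in>I. f k \<preceq> f l" using ex_vle_min[of I f] I nz by blast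
  have fk: "f k \<noteq> 0" using k nz by (metis zero_vle_iff)
  have "\<exists>l\<in>I - {k}. f l \<preceq> f k"
  proof (rule ccontr)
    assume "\<not> ?thesis"
    hence "f k \<prec> sum f (I - {k})" using fk by (intro vless_sum) auto
    moreover have "sum f (I - {k}) = - f k"
      using s I k by (simp add: sum_diff1)
    ultimately show False by simp
  qed
  then obtain l where "l \<in> I" "l \<noteq> k" "f l \<preceq> f k" by blast
  thus ?thesis using that[of k l] k fk by (metis zero_vle_iff)
qed

section \<open>Finiteness of residues\<close>

text \<open>
  A subset of \<open>F \<inter> V\<close> that is linearly independent modulo \<open>p\<close> is linearly independent over \<open>\<rat>\<close>, because
  rational relations can be made primitive, and so has at most \<open>C\<close> elements. The combinations of a maximal one with
  coefficients from \<open>0\<close> to \<open>p - 1\<close> exhaust the residues.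
\<close>

lemma residue_cover:
  assumes F: "ring_set F" "dim_le F C"
  obtains R where "R \<subseteq> F \<inter> V" "finite R" "card R \<le> p ^ C" "\<And>x. x \<in> F \<inter> V \<Longrightarrow> \<exists>r\<in>R. P \<preceq> x - r"
proof -
  define indep where "indep = (\<lambda>T. T \<subseteq> F \<inter> V \<and> finite T \<and>
      (\<forall>c::'a \<Rightarrow> int. P \<preceq> (\<Sum>x\<in>T. of_int (c x) * x) \<longrightarrow> (\<forall>x\<in>T. int p dvd c x)))"
  have bound: "card T \<le> C" if T: "indep T" for T
  proof (rule ccontr)
    assume "\<not> card T \<le> C"
    hence "finite T" "C < card T" "\<And>x. x \<in> T \<Longrightarrow> x \<in> F" using T by (auto simp: indep_def)
    then obtain c where "\<exists>i\<in>T. \<not> int p dvd c i" "(\<Sum>i\<in>T. of_int (c i) * i) = 0"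
      using dim_le_dependent_primitive[of F C T "\<lambda>x. x" p] F(2) prime_p by metis
    thus False using T by (auto simp: indep_def)
  qed
  have "indep {}" by (auto simp: indep_def)
  moreover have "\<forall>T. indep T \<longrightarrow> card T < Suc C" using bound by (auto simp: less_Suc_eq_le)
  ultimately obtain T where T: "indep T" "\<And>Y. indep Y \<Longrightarrow> card Y \<le> card T"
    using ex_has_greatest_nat[of indep "{}" card "Suc C"] by blast
  have finX: "finite T" and XV: "T \<subseteq> F \<inter> V" using T by (auto simp: indep_def)
  define R where "R = (\<lambda>c. \<Sum>x\<in>T. of_int (c x) * x) ` (T \<rightarrow>\<^sub>E {0..<int p})"
  have reduce: "\<exists>r\<in>R. P \<preceq> y - r" if "P \<preceq> of_int e * y - (\<Sum>x\<in>T. of_int (c x) * x)" "\<not> int p dvd e" "y \<in> V"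
    for y e and c :: "'a \<Rightarrow> int"
  proof -
    have "coprime (int p) e" using that prime_p by (simp add: prime_imp_coprime)
    then obtain u v where uv: "u * int p + v * e = 1"
      using bezout_int[of "int p" e] coprime_imp_gcd_eq_1 by metis
    define c' where "c' = (\<lambda>x\<in>T. (v * c x) mod int p)"
    have "c' \<in> T \<rightarrow>\<^sub>E {0..<int p}" using prime_gt_0_nat[OF prime_p] by (auto simp: c'_def)
    hence "(\<Sum>x\<in>T. of_int (c' x) * x) \<in> R" by (auto simp: R_def)
    moreover have "P \<preceq> y - (\<Sum>x\<in>T. of_int (c' x) * x)"
    proof -
      have "(1::'a) = of_int (u * int p + v * e)" using uv by simp
      hence 1: "1 = of_int u * P + of_int v * of_int e" by simp
      have 2: "of_int (v * c x) = of_int (c' x) + P * of_int (v * c x div int p)" if "x \<in> T" for x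
      proof -
        have "v * c x = c' x + int p * (v * c x div int p)" using that by (simp add: c'_def)
        thus ?thesis by (metis of_int_add of_int_mult of_int_of_nat_eq)
      qed
      have "y = (of_int u * P + of_int v * of_int e) * y" using 1 by simp
      moreover have "(\<Sum>x\<in>T. of_int (c' x) * x) = of_int v * (\<Sum>x\<in>T. of_int (c x) * x)
          - P * (\<Sum>x\<in>T. of_int (v * c x div int p) * x)"
        unfolding sum_distrib_left sum_subtractf[symmetric]
        by (intro sum.cong refl) (use 2 in \<open>simp add: algebra_simps\<close>)
      ultimately have "y - (\<Sum>x\<in>T. of_int (c' x) * x) =
          P * (of_int u * y) + of_int v * (of_int e * y - (\<Sum>x\<in>T. of_int (c x) * x))
          + P * (\<Sum>x\<in>T. of_int (v * c x div int p) * x)"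
        by (simp add: algebra_simps)
      also have "P \<preceq> \<dots>"
        using that XV by (intro vle_add vle_mult_left[OF that(1)] vle_mult_right[OF vle_refl] V_intros) auto
      finally show ?thesis .
    qed
    ultimately show ?thesis by blast
  qed
  have "\<exists>r\<in>R. P \<preceq> y - r" if y: "y \<in> F \<inter> V" for y
  proof (cases "y \<in> T")
    case True
    define c :: "'a \<Rightarrow> int" where "c = (\<lambda>x. if x = y then 1 else 0)"
    have "(\<Sum>x\<in>T. of_int (c x) * x) = (\<Sum>x\<in>T. if x = y then y else 0)"
      by (intro sum.cong) (auto simp: c_def)
    also have "\<dots> = y" using True finX by simp
    finally have "P \<preceq> of_int 1 * y - (\<Sum>x\<in>T. of_int (c x) * x)" by simp
    moreover have "\<not> int p dvd 1" using prime_p by (metis int_dvd_int_iff not_prime_unit of_nat_1)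
    ultimately show ?thesis using y reduce[of 1 y c] by blast
  next
    case False
    have "\<not> indep (insert y T)" using T(2)[of "insert y T"] False finX by auto
    then obtain c x where c: "P \<preceq> (\<Sum>x\<in>insert y T. of_int (c x) * x)" "x \<in> insert y T" "\<not> int p dvd c x"
      using y XV finX by (auto simp: indep_def)
    have s: "(\<Sum>x\<in>insert y T. of_int (c x) * x) = of_int (c y) * y + (\<Sum>x\<in>T. of_int (c x) * x)"
      using False finX by simp
    have "\<not> int p dvd c y"
    proof
      assume d: "int p dvd c y"
      then obtain k where "c y = int p * k" by (auto elim: dvdE)
      hence e: "of_int (c y) * y = P * (of_int k * y)" by simp
      have "of_int k * y \<in> V" using y by (intro V_intros) auto
      hence "P \<preceq> of_int (c y) * y" unfolding e by (intro vle_mult_right vle_refl)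
      hence "P \<preceq> (\<Sum>x\<in>T. of_int (c x) * x)"
        using vle_diff[OF c(1), of "of_int (c y) * y"] s by simp
      hence "\<forall>x\<in>T. int p dvd c x" using T by (auto simp: indep_def)
      thus False using c d by auto
    qed
    moreover have "P \<preceq> of_int (c y) * y - (\<Sum>x\<in>T. of_int ((\<lambda>x. - c x) x) * x)"
      using c(1) s by (simp add: sum_negf)
    ultimately show ?thesis using y reduce[of "c y" y "\<lambda>x. - c x"] by blast
  qed
  moreover have "R \<subseteq> F \<inter> V"
    using XV F by (auto simp: R_def intro!: V_intros ring_set_intros)
  moreover have "finite R" unfolding R_def using finX by (intro finite_imageI finite_PiE) auto
  moreover have "card R \<le> p ^ C"
  proof -
    have "card R \<le> card (T \<rightarrow>\<^sub>E {0..<int p})"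
      unfolding R_def using finX by (intro card_image_le finite_PiE) auto
    also have "\<dots> = p ^ card T" using finX by (simp add: card_PiE)
    also have "\<dots> \<le> p ^ C" using bound[OF T(1)] prime_ge_1_nat[OF prime_p] by (intro power_increasing)
    finally show ?thesis .
  qed
  ultimately show ?thesis using that by blast
qed

text \<open>
  The representatives are the expansions \<open>q\<^sub>0 + p q\<^sub>1 + \<dots> + p\<^sup>N\<^sup>-\<^sup>1 q\<^sub>N\<^sub>-\<^sub>1\<close> with digits that represent the residues modulo \<open>p\<close>.
\<close>

lemma residue_cover_power:
  assumes F: "ring_set F" "\<rat> \<subseteq> F" "dim_le F C"
  obtains R where "R \<subseteq> F \<inter> V" "finite R" "card R \<le> p ^ (C * N)"
    "\<And>x. x \<in> F \<inter> V \<Longrightarrow> \<exists>r\<in>R. P ^ N \<preceq> x - r"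
proof -
  have "\<exists>R\<subseteq>F \<inter> V. finite R \<and> card R \<le> p ^ (C * N) \<and> (\<forall>x\<in>F \<inter> V. \<exists>r\<in>R. P ^ N \<preceq> x - r)"
  proof (induction N)
    case 0
    show ?case
      using ring_set_0[OF F(1)] ring_set_0[OF ring_V]
      by (intro exI[of _ "{0}"]) (auto simp: one_vle_iff)
  next
    case (Suc N)
    then obtain R where R: "R \<subseteq> F \<inter> V" "finite R" "card R \<le> p ^ (C * N)"
      "\<And>x. x \<in> F \<inter> V \<Longrightarrow> \<exists>r\<in>R. P ^ N \<preceq> x - r" by blast
    obtain Q where Q: "Q \<subseteq> F \<inter> V" "finite Q" "card Q \<le> p ^ C"
      "\<And>x. x \<in> F \<inter> V \<Longrightarrow> \<exists>r\<in>Q. P \<preceq> x - r" using residue_cover[OF F(1,3)] by metis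
    define T where "T = (\<lambda>(q, r). q + P * r) ` (Q \<times> R)"
    have "q + P * r \<in> F \<inter> V" if "q \<in> F \<inter> V" "r \<in> F \<inter> V" for q r
      using ring_set_Int[OF F(1) ring_V] that by (intro ring_set_intros) auto
    hence "T \<subseteq> F \<inter> V" unfolding T_def using Q(1) R(1) by (auto simp: subset_iff)
    moreover have "finite T" using Q R by (auto simp: T_def)
    moreover have "card T \<le> p ^ (C * Suc N)"
    proof -
      have "card T \<le> card Q * card R" unfolding T_def using Q R
        by (intro order.trans[OF card_image_le]) (auto simp: card_cartesian_product)
      also have "\<dots> \<le> p ^ C * p ^ (C * N)" using Q R by (intro mult_mono) auto
      finally show ?thesis by (simp add: power_add)
    qed
    moreover have "\<exists>r\<in>T. P ^ Suc N \<preceq> x - r" if x: "x \<in> F \<inter> V" for x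
    proof -
      obtain q where q: "q \<in> Q" "P \<preceq> x - q" using Q x by blast
      then obtain x' where x': "x' \<in> V" "x - q = P * x'" by (auto simp: vle_def)
      have iP: "inverse P \<in> F" using F(2) by auto
      have "x \<in> F" "q \<in> F" using x q Q by auto
      from ring_set_mult[OF F(1) ring_set_diff[OF F(1) this] iP]
      have "x' \<in> F" unfolding x'(2) by (simp add: mult.commute[of P] mult.assoc)
      then obtain r where r: "r \<in> R" "P ^ N \<preceq> x' - r" using R x' by blast
      have "x - (q + P * r) = P * (x' - r)" using x' by (simp add: algebra_simps)
      hence "P ^ Suc N \<preceq> x - (q + P * r)" using r by simp
      moreover have "q + P * r \<in> T"
        unfolding T_def using q(1) r(1) by (intro image_eqI[of _ _ "(q, r)"]) auto
      ultimately show ?thesis by blast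
    qed
    ultimately show ?case by blast
  qed
  thus ?thesis using that by blast
qed

section \<open>Approximation by a subfield\<close>

text \<open>
  The closure of \<open>F\<close> in the topology of \<open>V\<close>; it replaces the completion of \<open>F\<close>.
\<close>

definition approx :: "'a set \<Rightarrow> 'a set" where
  "approx F = {x. \<forall>m. \<exists>y\<in>F. P ^ m \<preceq> x - y}"

lemma approx_incl: "F \<subseteq> approx F"
proof
  fix x assume "x \<in> F"
  moreover have "P ^ m \<preceq> x - x" for m by simp
  ultimately show "x \<in> approx F" unfolding approx_def by blast
qed

lemma approxE:
  assumes "x \<in> approx F" obtains y where "y \<in> F" "P ^ m \<preceq> x - y"
  using assms by (auto simp: approx_def)

text \<open>
  For approximations \<open>u\<close> of \<open>x\<close> and \<open>v\<close> of \<open>y\<close>, the error of the product is \<open>x (y - v) + v (x - u)\<close>. The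
  denominators of \<open>x\<close> and \<open>v\<close> are bounded by powers of \<open>p\<close>, so \<open>v\<close> is chosen before the precision of \<open>u\<close>.
\<close>

lemma ring_set_approx:
  assumes F: "ring_set F" shows "ring_set (approx F)"
  unfolding ring_set_def
proof (intro conjI ballI)
  show "1 \<in> approx F" using approx_incl ring_set_1[OF F] by blast
next
  fix x y assume xy: "x \<in> approx F" "y \<in> approx F"
  show "x - y \<in> approx F"
    unfolding approx_def
  proof safe
    fix m
    obtain u v where uv: "u \<in> F" "P ^ m \<preceq> x - u" "v \<in> F" "P ^ m \<preceq> y - v"
      using xy approxE by metis
    have "P ^ m \<preceq> (x - u) - (y - v)" using vle_diff[OF uv(2,4)] .
    hence "P ^ m \<preceq> (x - y) - (u - v)" by (simp add: algebra_simps)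
    thus "\<exists>z\<in>F. P ^ m \<preceq> x - y - z" using uv ring_set_diff[OF F] by blast
  qed
  have bound: "\<exists>s. 1 \<preceq> P ^ s * z" for z
  proof (cases "z = 0")
    case False
    then obtain s where s: "inverse z \<preceq> P ^ s" using bounded_by_P_power[of "inverse z"] by auto
    have "z * inverse z \<preceq> z * P ^ s" using s False by (subst vle_cancel) auto
    thus ?thesis using False by (auto simp: mult.commute)
  qed auto
  show "x * y \<in> approx F"
    unfolding approx_def
  proof safe
    fix m
    obtain s t where st: "1 \<preceq> P ^ s * x" "1 \<preceq> P ^ t * y" using bound by blast
    obtain v where v: "v \<in> F" "P ^ (m + s) \<preceq> y - v" using xy approxE by metis
    obtain r where r: "1 \<preceq> P ^ r * v" using bound by blast
    obtain u where u: "u \<in> F" "P ^ (m + r) \<preceq> x - u" using xy approxE by metis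
    have 1: "P ^ s * P ^ m \<preceq> P ^ s * (x * (y - v))"
      using vle_mult[OF st(1) v(2)] by (simp add: power_add mult_ac)
    have 2: "P ^ r * P ^ m \<preceq> P ^ r * (v * (x - u))"
      using vle_mult[OF r u(2)] by (simp add: power_add mult_ac)
    have "P ^ m \<preceq> x * (y - v) + v * (x - u)"
      using 1 2 by (intro vle_add) (simp_all del: of_nat_power)
    hence "P ^ m \<preceq> x * y - u * v" by (simp add: algebra_simps)
    thus "\<exists>z\<in>F. P ^ m \<preceq> x * y - z" using u v ring_set_mult[OF F] by blast
  qed
qed

section \<open>Roots in the valuation ring and their Weierstrass degree\<close>

text \<open>
  Modulo \<open>p\<^sup>B\<close> the polynomial \<open>h\<close> over \<open>V\<close> has degree \<open>w\<close> and a unit as leading coefficient. For \<open>B > 0\<close>,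
  \<open>w\<close> is the number of its roots in \<open>V\<close>, as in the Weierstrass preparation theorem.
\<close>

definition weierstrass :: "nat \<Rightarrow> 'a poly \<Rightarrow> nat \<Rightarrow> bool" where
  "weierstrass B h w \<longleftrightarrow> poly_over V h \<and> coeff h w \<preceq> 1 \<and> (\<forall>j>w. P ^ B \<preceq> coeff h j)"

lemma coeff_shift_top:
  fixes h :: "'b::comm_ring_1 poly"
  assumes "degree h \<le> w"
  shows "coeff (h \<circ>\<^sub>p [:x, 1:]) w = coeff h w"
  using assms
proof (induction h arbitrary: w)
  case (pCons a g)
  show ?case
  proof (cases w)
    case 0
    hence "g = 0" using pCons by (auto split: if_splits)
    thus ?thesis using 0 by simp
  next
    case (Suc v)
    have dg: "degree g \<le> v" using pCons.prems Suc by (auto split: if_splits)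
    have "degree (g \<circ>\<^sub>p [:x, 1:]) \<le> v"
      using degree_pcompose_le[of g "[:x, 1:]"] dg by simp
    hence "coeff (g \<circ>\<^sub>p [:x, 1:]) (Suc v) = 0" by (intro coeff_eq_0) simp
    thus ?thesis using pCons.IH[OF dg] Suc by (simp add: pcompose_pCons)
  qed
qed simp

lemma coeff_shift_next_to_top:
  fixes h :: "'b::comm_ring_1 poly"
  assumes "degree h \<le> Suc w"
  shows "coeff (h \<circ>\<^sub>p [:x, 1:]) w = coeff h w + of_nat (Suc w) * coeff h (Suc w) * x"
  using assms
proof (induction h arbitrary: w)
  case (pCons a g)
  have dg: "degree g \<le> w" using pCons.prems by (auto split: if_splits)
  show ?case
  proof (cases w)
    case 0
    then obtain b where "g = [:b:]" using dg by (auto elim: degree_eq_zeroE)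
    thus ?thesis using 0 by (simp add: pcompose_pCons)
  next
    case (Suc v)
    have "coeff (g \<circ>\<^sub>p [:x, 1:]) w = coeff g w" by (rule coeff_shift_top[OF dg])
    thus ?thesis using pCons.IH[of v] dg Suc by (simp add: pcompose_pCons algebra_simps)
  qed
qed simp

lemma weierstrass_split:
  assumes "weierstrass B h w"
  obtains g r where "h = g + smult (P ^ B) r" "degree g = w" "coeff g w = coeff h w"
    "\<And>j. j \<le> w \<Longrightarrow> coeff g j = coeff h j" "poly_over V g" "poly_over V r"
proof -
  define g where "g = poly_cutoff (Suc w) h"
  define r where "r = smult (inverse (P ^ B)) (h - g)"
  have gc: "coeff g j = (if j \<le> w then coeff h j else 0)" for j
    by (simp add: g_def coeff_poly_cutoff less_Suc_eq_le)
  have nz: "coeff h w \<noteq> 0" using assms by (auto simp: weierstrass_def)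
  have "degree g = w"
    using nz gc by (intro antisym degree_le le_degree) auto
  moreover have "poly_over V g"
    using assms ring_set_0[OF ring_V] by (auto simp: poly_over_def gc weierstrass_def)
  moreover have "poly_over V r"
  proof -
    have "inverse (P ^ B) * coeff h j \<in> V" if "j > w" for j
    proof -
      have "P ^ B * (inverse (P ^ B) * coeff h j) = coeff h j" by (simp flip: mult.assoc)
      hence "P ^ B * 1 \<preceq> P ^ B * (inverse (P ^ B) * coeff h j)"
        using assms that by (simp only: weierstrass_def mult_1_right)
      hence "1 \<preceq> inverse (P ^ B) * coeff h j" by (subst (asm) vle_cancel) auto
      thus ?thesis by (simp add: one_vle_iff)
    qed
    thus ?thesis using ring_set_0[OF ring_V] by (auto simp: poly_over_def r_def gc)
  qed
  ultimately show ?thesis using that[of g r] gc by (auto simp: r_def)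
qed

text \<open>
  Writing \<open>h = g + p\<^sup>B s\<close> with \<open>g\<close> of degree \<open>w\<close>, a translation acts on the two top coefficients of \<open>g\<close> as usual and
  changes the second summand only within the multiples of \<open>p\<^sup>B\<close>.
\<close>

lemma weierstrass_shift_coeffs:
  assumes h: "weierstrass B h w" and x: "x \<in> V"
  obtains r where "poly_over V r"
    "\<And>j. j > w \<Longrightarrow> coeff (h \<circ>\<^sub>p [:x, 1:]) j = P ^ B * coeff r j"
    "coeff (h \<circ>\<^sub>p [:x, 1:]) w = coeff h w + P ^ B * coeff r w"
    "\<And>v. w = Suc v \<Longrightarrow> coeff (h \<circ>\<^sub>p [:x, 1:]) v =
        coeff h v + of_nat w * coeff h w * x + P ^ B * coeff r v"
proof -
  from h obtain g s where gs: "h = g + smult (P ^ B) s" "degree g = w" "coeff g w = coeff h w"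
    "\<And>j. j \<le> w \<Longrightarrow> coeff g j = coeff h j" "poly_over V g" "poly_over V s"
    by (rule weierstrass_split) (rule that)
  define r where "r = s \<circ>\<^sub>p [:x, 1:]"
  have "poly_over V r" unfolding r_def using x gs(6) ring_V
    by (intro poly_over_pcompose) (auto simp: poly_over_pCons poly_over_0 ring_set_1)
  moreover have e: "h \<circ>\<^sub>p [:x, 1:] = g \<circ>\<^sub>p [:x, 1:] + smult (P ^ B) r"
    unfolding r_def by (subst gs(1)) (simp add: pcompose_add pcompose_smult)
  moreover have "coeff (g \<circ>\<^sub>p [:x, 1:]) j = 0" if "j > w" for j
    using that gs(2) by (intro coeff_eq_0 le_less_trans[OF degree_pcompose_le]) simp
  moreover have "coeff (g \<circ>\<^sub>p [:x, 1:]) w = coeff h w"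
    using gs(2,3) coeff_shift_top[of g w x] by simp
  moreover have "coeff (g \<circ>\<^sub>p [:x, 1:]) v = coeff h v + of_nat w * coeff h w * x" if "w = Suc v" for v
    using gs(2,3) gs(4)[of v] coeff_shift_next_to_top[of g v x] that by simp
  ultimately show ?thesis by (intro that[of r]) simp_all
qed

lemma weierstrass_shift:
  assumes h: "weierstrass B h w" and x: "x \<in> V" and B: "B > 0"
  shows "weierstrass B (h \<circ>\<^sub>p [:x, 1:]) w"
proof -
  from h x obtain r where r: "poly_over V r"
    "\<And>j. j > w \<Longrightarrow> coeff (h \<circ>\<^sub>p [:x, 1:]) j = P ^ B * coeff r j"
    "coeff (h \<circ>\<^sub>p [:x, 1:]) w = coeff h w + P ^ B * coeff r w"
    "\<And>v. w = Suc v \<Longrightarrow> coeff (h \<circ>\<^sub>p [:x, 1:]) v =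
        coeff h v + of_nat w * coeff h w * x + P ^ B * coeff r v"
    by (rule weierstrass_shift_coeffs) (rule that)
  have rV: "coeff r j \<in> V" for j using r by (auto simp: poly_over_def)
  have "poly_over V (h \<circ>\<^sub>p [:x, 1:])"
    using x h ring_V by (intro poly_over_pcompose) (auto simp: weierstrass_def poly_over_pCons poly_over_0 ring_set_1)
  moreover have "coeff (h \<circ>\<^sub>p [:x, 1:]) w \<preceq> 1"
  proof (rule ccontr)
    assume "\<not> ?thesis"
    moreover have "1 \<prec> P ^ B * coeff r w"
    proof -
      have "1 \<prec> P ^ B" using P_power_vle_iff[of B 0] B by simp
      thus ?thesis using vle_mult_right[OF vle_refl rV] vle_trans by blast
    qed
    ultimately have "1 \<prec> coeff (h \<circ>\<^sub>p [:x, 1:]) w + - (P ^ B * coeff r w)"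
      by (intro vless_add) simp_all
    thus False using h r(3) by (simp add: weierstrass_def)
  qed
  ultimately show ?thesis using r(2) rV
    by (auto simp: weierstrass_def intro!: vle_mult_right)
qed

lemma weierstrass_coeff_neq_0: "weierstrass B h w \<Longrightarrow> coeff h w \<noteq> 0"
  by (auto simp: weierstrass_def)

definition weierstrass_root :: "nat \<Rightarrow> nat \<Rightarrow> 'a set \<Rightarrow> nat \<Rightarrow> 'a poly \<Rightarrow> 'a \<Rightarrow> bool" where
  "weierstrass_root n B F w h \<alpha> \<longleftrightarrow> poly_over F h \<and> degree h \<le> n \<and> weierstrass B h w \<and> w > 0 \<and> \<alpha> \<in> V \<and> poly h \<alpha> = 0"

lemma weierstrass_root_le: "weierstrass_root n B F w h \<alpha> \<Longrightarrow> w \<le> n"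
  using le_degree[of h w] weierstrass_coeff_neq_0[of B h w] by (auto simp: weierstrass_root_def)

text \<open>
  The number \<open>a\<^sub>j\<close> is the coefficient at \<open>y\<^sup>j\<close> of \<open>h (\<alpha> + d y)\<close>. When \<open>a\<^sub>i\<close> has the least value and all \<open>a\<^sub>j\<close> with \<open>j > i\<close>
  exceed it by at least \<open>p\<^sup>B\<close>, exactly \<open>i\<close> roots of \<open>h\<close> lie within distance \<open>d\<close> of \<open>\<alpha>\<close>. The polynomial \<open>h (c + d x)\<close> has
  coefficients in \<open>F\<close> and differs from \<open>h (\<alpha> + d y)\<close> by an integral translation, so, divided by its
  \<open>i\<close>-th coefficient, it has Weierstrass degree \<open>i\<close>.
\<close>

lemma weierstrass_root_rescale:
  fixes h :: "'a poly" and \<alpha> c d :: 'a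
  defines "a \<equiv> \<lambda>j. d ^ j * coeff (h \<circ>\<^sub>p [:\<alpha>, 1:]) j"
  assumes F: "ring_set F" "\<rat> \<subseteq> F" and h: "poly_over F h" "degree h \<le> n" "poly h \<alpha> = 0"
    and c: "c \<in> F" and d: "d \<in> F" "d \<noteq> 0" "d \<preceq> \<alpha> - c" and B: "B > 0"
    and i: "i > 0" "a i \<noteq> 0" "\<And>j. a i \<preceq> a j" "\<And>j. j > i \<Longrightarrow> P ^ B * a i \<preceq> a j"
  obtains h1 where "weierstrass_root n B F i h1 ((\<alpha> - c) / d)"
proof -
  define x where "x = (\<alpha> - c) / d"
  have x: "x \<in> V" "\<alpha> = c + d * x"
    using d vle_cancel[of d 1 x] by (auto simp: x_def one_vle_iff)
  define H where "H = h \<circ>\<^sub>p [:\<alpha>, 1:] \<circ>\<^sub>p [:0, d:]"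
  have H: "coeff H j = a j" for j unfolding H_def a_def by (rule coeff_pcompose_linear)
  define G where "G = h \<circ>\<^sub>p [:c, d:]"
  have "[:\<alpha>, 1:] \<circ>\<^sub>p [:0, d:] \<circ>\<^sub>p [:-x, 1:] = [:c, d:]"
    using x by (simp add: pcompose_pCons)
  hence GH: "G = H \<circ>\<^sub>p [:-x, 1:]" unfolding G_def H_def by (metis pcompose_assoc)
  have "weierstrass B (smult (inverse (a i)) H) i"
    unfolding weierstrass_def poly_over_def
  proof (intro conjI allI impI)
    fix j
    have e: "a i * (inverse (a i) * a j) = a j" using i by (simp flip: mult.assoc)
    have "a i * 1 \<preceq> a i * (inverse (a i) * a j)" using i(3)[of j] by (simp only: e mult_1_right)
    hence "1 \<preceq> inverse (a i) * a j" using i by (subst (asm) vle_cancel) auto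
    thus "coeff (smult (inverse (a i)) H) j \<in> V" by (simp add: H one_vle_iff)
  next
    fix j assume "i < j"
    have e: "a i * (inverse (a i) * a j) = a j" using i by (simp flip: mult.assoc)
    have "a i * P ^ B \<preceq> a i * (inverse (a i) * a j)"
      unfolding e using i(4)[OF \<open>i < j\<close>] by (simp only: mult.commute)
    hence "P ^ B \<preceq> inverse (a i) * a j" using i by (subst (asm) vle_cancel) auto
    thus "P ^ B \<preceq> coeff (smult (inverse (a i)) H) j" by (simp add: H)
  qed (use i in \<open>auto simp: H\<close>)
  from weierstrass_shift[OF this _ B, of "-x"] x ring_V
  have W: "weierstrass B (smult (inverse (a i)) G) i"
    by (simp add: GH pcompose_smult ring_set_uminus)
  define u where "u = coeff G i"
  have GF: "poly_over F G" unfolding G_def using F h c d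
    by (intro poly_over_pcompose) (auto simp: poly_over_pCons poly_over_0)
  have u: "u \<noteq> 0" "u \<in> F" using weierstrass_coeff_neq_0[OF W] GF by (auto simp: u_def poly_over_def)
  have iu: "inverse u \<in> F" using rat_subring_inverse[OF F u(2) algebraic] .
  have ui: "inverse (a i) * u \<preceq> 1" using W by (simp add: weierstrass_def u_def)
  have "weierstrass B (smult (inverse u) G) i"
    unfolding weierstrass_def poly_over_def
  proof (intro conjI allI impI)
    have eq: "coeff (smult (inverse u) G) j = inverse (inverse (a i) * u) * coeff (smult (inverse (a i)) G) j" for j
      using i u by simp
    define e where "e = inverse (a i) * u"
    have e: "e \<noteq> 0" "e \<preceq> 1" using ui u i by (auto simp: e_def)
    have "e * 1 \<preceq> e * inverse e" using e by simp
    hence "1 \<preceq> inverse e" using e(1) by (subst (asm) vle_cancel) auto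
    hence ui': "inverse (inverse (a i) * u) \<in> V" unfolding e_def by (simp add: one_vle_iff)
    show "coeff (smult (inverse u) G) j \<in> V" for j
      unfolding eq using W ui' by (intro ring_set_mult[OF ring_V]) (auto simp: weierstrass_def poly_over_def)
    show "P ^ B \<preceq> coeff (smult (inverse u) G) j" if "i < j" for j
      unfolding eq using W ui' that by (intro vle_mult_left) (auto simp: weierstrass_def)
    show "coeff (smult (inverse u) G) i \<preceq> 1" using u by (simp add: u_def)
  qed
  moreover have "poly (smult (inverse u) G) x = 0"
    using h x by (simp add: G_def poly_pcompose mult.commute)
  moreover have "poly_over F (smult (inverse u) G)"
    using F iu GF by (intro poly_over_smult)
  moreover have "degree (smult (inverse u) G) \<le> n"
    using h(2) degree_pcompose_le[of h "[:c, d:]"] u d by (auto simp: G_def)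
  ultimately have "weierstrass_root n B F i (smult (inverse u) G) x"
    using i x by (auto simp: weierstrass_root_def)
  thus ?thesis using that unfolding x_def by blast
qed

text \<open>
  The assumption \<open>cluster\<close> says, in terms of the Newton polygon of \<open>h\<close> at \<open>\<alpha>\<close>, that the \<open>w\<close> roots of \<open>h\<close> in
  \<open>V\<close> are congruent to \<open>\<alpha>\<close> modulo \<open>p\<^sup>B\<close>. The Taylor coefficient of degree \<open>w - 1\<close> at \<open>\<alpha>\<close> is \<open>h\<^sub>w\<^sub>-\<^sub>1 + w h\<^sub>w \<alpha>\<close> modulo \<open>p\<^sup>B\<close>, and it is
  divisible by \<open>p\<^sup>B\<close>; dividing by \<open>w h\<^sub>w\<close> costs at most \<open>p\<^sup>n\<close>. Thus \<open>B = n + 1\<close> is enough for the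
  approximate mean \<open>c\<close> of the roots to agree with \<open>\<alpha>\<close> modulo \<open>p\<close>.
\<close>

lemma clustered_roots_step:
  assumes F: "ring_set F" "\<rat> \<subseteq> F" and h: "weierstrass_root n B F w h \<alpha>" and B: "B = Suc n"
    and cluster: "\<And>i. i < w \<Longrightarrow> P ^ (B * (w - i)) \<preceq> coeff (h \<circ>\<^sub>p [:\<alpha>, 1:]) i"
  obtains c h1 where "c \<in> F" "P \<preceq> \<alpha> - c" "weierstrass_root n B F w h1 ((\<alpha> - c) / P)"
proof -
  define a where "a = (\<lambda>j. coeff (h \<circ>\<^sub>p [:\<alpha>, 1:]) j)"
  have W: "weierstrass B h w" and \<alpha>: "\<alpha> \<in> V" and hF: "poly_over F h" "degree h \<le> n" "poly h \<alpha> = 0"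
    and w0: "w > 0" using h by (auto simp: weierstrass_root_def)
  have W': "weierstrass B (h \<circ>\<^sub>p [:\<alpha>, 1:]) w" using weierstrass_shift[OF W \<alpha>] B by simp
  have wn: "w \<le> n" by (rule weierstrass_root_le[OF h])
  obtain v where v: "w = Suc v" using w0 gr0_implies_Suc by blast
  from W \<alpha> obtain r where r0: "poly_over V r"
    "\<And>j. j > w \<Longrightarrow> coeff (h \<circ>\<^sub>p [:\<alpha>, 1:]) j = P ^ B * coeff r j"
    "coeff (h \<circ>\<^sub>p [:\<alpha>, 1:]) w = coeff h w + P ^ B * coeff r w"
    "\<And>v. w = Suc v \<Longrightarrow> coeff (h \<circ>\<^sub>p [:\<alpha>, 1:]) v =
        coeff h v + of_nat w * coeff h w * \<alpha> + P ^ B * coeff r v"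
    by (rule weierstrass_shift_coeffs) (rule that)
  have r: "poly_over V r" "a v = coeff h v + of_nat w * coeff h w * \<alpha> + P ^ B * coeff r v"
    using r0(1) r0(4)[OF v] by (simp_all add: a_def)
  define u where "u = of_nat w * coeff h w"
  define c where "c = - coeff h v / u"
  have hw: "coeff h w \<noteq> 0" "coeff h w \<preceq> 1" using W weierstrass_coeff_neq_0 by (auto simp: weierstrass_def)
  have u: "u \<noteq> 0" using hw w0 by (simp add: u_def)
  have uP: "u \<preceq> P ^ n"
    using vle_mult[OF of_nat_vle_P_power[OF w0 wn] hw(2)] by (simp add: u_def)
  have hcF: "coeff h j \<in> F" for j using hF by (auto simp: poly_over_def)
  have uF: "u \<in> F" unfolding u_def using F hcF by (intro ring_set_intros)
  have "- coeff h v * inverse u \<in> F"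
    using F uF hcF rat_subring_inverse[OF F _ algebraic] by (intro ring_set_intros) auto
  hence cF: "c \<in> F" by (simp add: c_def divide_inverse)
  have c: "P \<preceq> \<alpha> - c"
  proof -
    have "P ^ B \<preceq> a v" using cluster[of v] v by (simp add: a_def)
    moreover have "P ^ B \<preceq> P ^ B * coeff r v" using r(1) by (intro vle_mult_right) (auto simp: poly_over_def)
    ultimately have "P ^ B \<preceq> a v - P ^ B * coeff r v" by (rule vle_diff)
    also have "a v - P ^ B * coeff r v = u * (\<alpha> - c)"
      using u by (simp add: r(2) c_def u_def[symmetric] field_simps)
    finally have "P ^ n * P \<preceq> u * (\<alpha> - c)" by (simp add: B mult.commute)
    moreover have "u * P \<preceq> P ^ n * P" using uP by (intro vle_mult) auto
    ultimately have "u * P \<preceq> u * (\<alpha> - c)" by (rule vle_trans[rotated])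
    thus ?thesis using u by simp
  qed
  \<comment> \<open>The scale \<open>p\<close> at \<open>\<alpha>\<close>: the coefficient of degree \<open>w\<close> still has the least value.\<close>
  have aw: "a w \<preceq> 1" "a w \<noteq> 0" using W' weierstrass_coeff_neq_0[OF W'] by (auto simp: weierstrass_def a_def)
  have main: "P ^ w * a w \<preceq> P ^ w" using vle_mult[OF vle_refl aw(1), of "P ^ w"] by simp
  have lower: "P ^ w * a w \<preceq> P ^ j * a j" if "j < w" for j
  proof -
    have "P ^ (w - j) \<preceq> P ^ (B * (w - j))" using B by (intro P_power_vle) simp
    hence "P ^ j * P ^ (w - j) \<preceq> P ^ j * a j"
      using cluster[OF that] vle_trans unfolding a_def by (intro vle_mult vle_refl) blast
    hence "P ^ w \<preceq> P ^ j * a j" using that by (simp flip: power_add)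
    thus ?thesis using main vle_trans by blast
  qed
  have upper: "P ^ B * (P ^ w * a w) \<preceq> P ^ j * a j" if "j > w" for j
  proof -
    have "P ^ B \<preceq> a j" using W' that by (simp add: weierstrass_def a_def)
    moreover have "P ^ w * a w \<preceq> P ^ j" using main P_power_vle[of w j] that vle_trans by auto
    ultimately show ?thesis using vle_mult[of "P ^ B" "a j" "P ^ w * a w" "P ^ j"] by (simp add: mult.commute)
  qed
  have up: "P ^ w * a w \<preceq> P ^ j * a j" if "j > w" for j
  proof -
    have "P ^ w * a w \<preceq> P ^ B * (P ^ w * a w)"
      by (rule vle_mult_left[OF vle_refl]) (intro V_intros)
    thus ?thesis using upper[OF that] vle_trans by blast
  qed
  have le: "P ^ w * a w \<preceq> P ^ j * a j" for j
    using lower up by (cases j w rule: linorder_cases) auto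
  have PF: "P \<in> F" using F by (intro ring_set_intros)
  obtain h1 where "weierstrass_root n B F w h1 ((\<alpha> - c) / P)"
    using weierstrass_root_rescale[OF F hF cF PF P_nonzero c _ w0, of B] le upper aw B
    unfolding a_def by auto
  thus ?thesis using that cF c by blast
qed

lemma ex_stationary:
  fixes k :: "nat \<Rightarrow> nat"
  assumes "\<And>s. k (Suc s) \<le> k s"
  shows "\<exists>s\<le>k 0. k (Suc s) = k s"
proof (rule ccontr)
  assume "\<not> ?thesis"
  hence less: "k (Suc s) < k s" if "s \<le> k 0" for s using assms[of s] that by force
  have "k s + s \<le> k 0" if "s \<le> Suc (k 0)" for s
    using that
  proof (induction s)
    case (Suc s) thus ?case using less[of s] by simp
  qed simp
  from this[of "Suc (k 0)"] show False by simp
qed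

text \<open>
  The Newton polygon of \<open>h\<close> at \<open>\<alpha>\<close> is examined at the scales \<open>p\<^sup>L\<close> for \<open>L = B, 2B, \<dots>\<close>. An index \<open>k s\<close> at which
  the coefficients of \<open>h (\<alpha> + p\<^sup>L y)\<close> are minimal is below \<open>w\<close> because of the coefficient at \<open>i0\<close>, and it does not
  increase with the scale. After at most \<open>n\<close> scales it is the same twice in a row; at the
  second of these scales the higher coefficients have fallen behind by \<open>p\<^sup>B\<close>.
\<close>

lemma separated_roots_step:
  assumes h: "weierstrass_root n B F w h \<alpha>" and B: "B > 0"
    and F1: "ring_set F1" "\<rat> \<subseteq> F1" "F \<subseteq> F1"
    and i0: "i0 < w" "\<not> P ^ (B * (w - i0)) \<preceq> coeff (h \<circ>\<^sub>p [:\<alpha>, 1:]) i0"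
    and \<beta>: "\<beta> \<in> F1" "P ^ (B * (n + 2)) \<preceq> \<alpha> - \<beta>"
  obtains i h1 L where "i < w" "weierstrass_root n B F1 i h1 ((\<alpha> - \<beta>) / P ^ L)"
proof -
  define a where "a = (\<lambda>j. coeff (h \<circ>\<^sub>p [:\<alpha>, 1:]) j)"
  have W: "weierstrass B h w" and \<alpha>: "\<alpha> \<in> V" and hF: "poly_over F h" "degree h \<le> n" "poly h \<alpha> = 0"
    and w0: "w > 0" using h by (auto simp: weierstrass_root_def)
  have W': "weierstrass B (h \<circ>\<^sub>p [:\<alpha>, 1:]) w" using weierstrass_shift[OF W \<alpha> B] .
  have wn: "w \<le> n" by (rule weierstrass_root_le[OF h])
  have aV: "a j \<in> V" for j using W' by (auto simp: weierstrass_def poly_over_def a_def)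
  have a0: "a 0 = 0" using hF by (simp add: a_def)
  have ai0: "a i0 \<noteq> 0" using i0 by (auto simp: a_def)
  have adeg: "a j = 0" if "j > n" for j
    unfolding a_def using that hF(2)
    by (intro coeff_eq_0 le_less_trans[OF degree_pcompose_le]) simp
  define L where "L = (\<lambda>s. B * Suc s)"
  define k where "k = (\<lambda>s. SOME k. \<forall>j. P ^ (L s * k) * a k \<preceq> P ^ (L s * j) * a j)"
  have k: "P ^ (L s * k s) * a (k s) \<preceq> P ^ (L s * j) * a j" for s j
  proof -
    obtain m where m: "\<forall>j\<in>{..n}. P ^ (L s * m) * a m \<preceq> P ^ (L s * j) * a j"
      using ex_vle_min[of "{..n}" "\<lambda>j. P ^ (L s * j) * a j"] by auto
    have "\<forall>j. P ^ (L s * m) * a m \<preceq> P ^ (L s * j) * a j"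
    proof
      fix j show "P ^ (L s * m) * a m \<preceq> P ^ (L s * j) * a j"
        using m adeg[of j] by (cases "j \<le> n") auto
    qed
    from someI[of "\<lambda>k. \<forall>j. P ^ (L s * k) * a k \<preceq> P ^ (L s * j) * a j", OF this]
    show ?thesis by (simp add: k_def)
  qed
  have nz: "a (k s) \<noteq> 0" for s
  proof
    assume "a (k s) = 0"
    hence "P ^ (L s * i0) * a i0 = 0" using k[of s i0] by simp
    thus False using ai0 by simp
  qed
  have kw: "k s < w" for s
  proof (rule ccontr)
    assume "\<not> k s < w"
    hence "P ^ (L s * w) \<preceq> P ^ (L s * k s) * a (k s)"
      by (intro vle_mult_right aV P_power_vle) simp
    hence "P ^ (L s * w) \<preceq> P ^ (L s * i0) * a i0" using k vle_trans by blast
    moreover have "P ^ (L s * w) = P ^ (L s * i0) * P ^ (L s * (w - i0))"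
      using i0 by (simp flip: power_add add_mult_distrib2)
    ultimately have "P ^ (L s * (w - i0)) \<preceq> a i0" by simp
    moreover have "P ^ (B * (w - i0)) \<preceq> P ^ (L s * (w - i0))"
      by (intro P_power_vle) (simp add: L_def)
    ultimately show False using i0 vle_trans unfolding a_def by blast
  qed
  have step: "P ^ (L (Suc s) * j) * a j = P ^ (B * j) * (P ^ (L s * j) * a j)" for s j
    by (simp add: L_def algebra_simps flip: power_add)
  have gap: "P ^ (B * (j - k s)) * (P ^ (L (Suc s) * k s) * a (k s)) \<preceq> P ^ (L (Suc s) * j) * a j"
    if "j > k s" for s j
  proof -
    have "P ^ (B * (j - k s)) * (P ^ (L (Suc s) * k s) * a (k s)) =
        P ^ (B * j) * (P ^ (L s * k s) * a (k s))"
      using that unfolding step mult.assoc[symmetric]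
      by (simp flip: power_add add_mult_distrib2)
    also have "\<dots> \<preceq> P ^ (L (Suc s) * j) * a j"
      unfolding step by (intro vle_mult vle_refl k)
    finally show ?thesis .
  qed
  have mono: "k (Suc s) \<le> k s" for s
  proof (rule ccontr)
    assume "\<not> k (Suc s) \<le> k s"
    hence lt: "k (Suc s) > k s" by simp
    let ?y = "P ^ (L (Suc s) * k s) * a (k s)"
    have "P ^ (B * (k (Suc s) - k s)) * ?y \<preceq> ?y"
      using gap[OF lt] k[of "Suc s" "k s"] vle_trans by blast
    hence "?y * P ^ (B * (k (Suc s) - k s)) \<preceq> ?y * P ^ 0" by (simp add: mult.commute)
    hence "P ^ (B * (k (Suc s) - k s)) \<preceq> P ^ 0"
      using nz[of s] by (subst (asm) vle_cancel) auto
    thus False using lt B unfolding P_power_vle_iff by simp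
  qed
  obtain s where s: "s \<le> k 0" "k (Suc s) = k s" using ex_stationary[of k] mono by blast
  define i where "i = k s"
  define d where "d = P ^ L (Suc s)"
  have dp: "d ^ j = P ^ (L (Suc s) * j)" for j by (simp add: d_def power_mult)
  have i0': "i > 0" using nz[of s] a0 by (cases i) (auto simp: i_def)
  have "s < n" using s(1) kw[of 0] wn by simp
  hence Ls: "L (Suc s) \<le> B * (n + 2)" unfolding L_def by (intro mult_le_mono2) simp
  have d: "d \<preceq> \<alpha> - \<beta>" unfolding d_def using vle_trans[OF P_power_vle[OF Ls] \<beta>(2)] .
  have dF: "d \<in> F1" unfolding d_def using F1 by (intro ring_set_intros)
  have min: "d ^ i * a i \<preceq> d ^ j * a j" for j using k[of "Suc s" j] s by (simp add: dp i_def)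
  have gap': "P ^ B * (d ^ i * a i) \<preceq> d ^ j * a j" if "j > i" for j
  proof -
    have "B * 1 \<le> B * (j - i)" using that by (intro mult_le_mono2) simp
    hence "P ^ B * (d ^ i * a i) \<preceq> P ^ (B * (j - i)) * (d ^ i * a i)"
      by (intro vle_mult vle_refl P_power_vle) simp
    thus ?thesis using gap[of s j] that vle_trans unfolding i_def dp by blast
  qed
  obtain h1 where "weierstrass_root n B F1 i h1 ((\<alpha> - \<beta>) / d)"
    using weierstrass_root_rescale[OF F1(1,2) poly_over_mono[OF hF(1) F1(3)] hF(2,3) \<beta>(1) dF _ d B i0'] min gap' nz[of s]
    unfolding a_def i_def d_def by auto
  thus ?thesis using that[of i h1 "L (Suc s)"] kw[of s] by (simp add: i_def d_def)
qed

end

section \<open>Adjoining roots\<close>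

lemma dim_le_mono: "dim_le F C \<Longrightarrow> C \<le> C' \<Longrightarrow> dim_le F C'"
  unfolding dim_le_def by (meson order.trans)

lemma rat_span_mult_right:
  fixes c :: "'a::field_char_0"
  assumes "x \<in> rat_vs.span B" shows "x * c \<in> rat_vs.span ((\<lambda>b. b * c) ` B)"
  using assms
proof (induction rule: rat_vs.span_induct_alt)
  case base
  thus ?case by (simp add: rat_vs.span_zero)
next
  case (step q x y)
  have "of_rat q * (x * c) + y * c \<in> rat_vs.span ((\<lambda>b. b * c) ` B)"
    using step(1) by (intro rat_vs.span_add[OF rat_vs.span_scale[OF rat_vs.span_base] step(2)]) auto
  thus ?case by (simp add: algebra_simps)
qed

text \<open>
  This is division with remainder by \<open>g\<close>, carried out along the Horner scheme of a polynomial.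
\<close>

lemma adjoin_low_degree:
  fixes \<beta> :: "'a::field_char_0"
  assumes F: "ring_set F" "\<rat> \<subseteq> F" and alg: "\<And>x :: 'a. algebraic x"
    and g: "poly_over F g" "degree g > 0" "poly g \<beta> = 0" and x: "x \<in> adjoin F \<beta>"
  obtains f where "poly_over F f" "degree f < degree g" "x = poly f \<beta>"
proof -
  obtain h where h: "poly_over F h" "x = poly h \<beta>" using x by (auto simp: adjoin_def)
  have "\<exists>f. poly_over F f \<and> degree f < degree g \<and> poly h \<beta> = poly f \<beta>"
    using h(1)
  proof (induction h)
    case 0
    thus ?case using g F by (intro exI[of _ 0]) (auto simp: poly_over_0)
  next
    case (pCons a h)
    then obtain f where f: "poly_over F f" "degree f < degree g" "poly h \<beta> = poly f \<beta>"
      by (auto simp: poly_over_pCons)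
    have aF: "a \<in> F" using pCons by (simp add: poly_over_pCons)
    define c where "c = coeff (pCons a f) (degree g) * inverse (lead_coeff g)"
    \<comment> \<open>The leading coefficient of \<open>g\<close> is inverted in \<open>F\<close> to cancel the term of degree \<open>degree g\<close>.\<close>
    define f' where "f' = pCons a f - smult c g"
    have g0: "lead_coeff g \<noteq> 0" using g by auto
    have "inverse (lead_coeff g) \<in> F"
      using g by (intro rat_subring_inverse F alg) (auto simp: poly_over_def)
    moreover have pF: "poly_over F (pCons a f)" using f aF by (simp add: poly_over_pCons)
    ultimately have cF: "c \<in> F" unfolding c_def using F by (intro ring_set_mult) (auto simp: poly_over_def)
    have "coeff f' j = 0" if "j \<ge> degree g" for j
    proof (cases "j = degree g")
      case True thus ?thesis using g0 by (simp add: f'_def c_def)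
    next
      case False
      hence "j > degree g" using that by simp
      hence "coeff (pCons a f) j = 0" "coeff g j = 0"
        using f(2) by (auto intro!: coeff_eq_0 simp: degree_pCons_eq_if)
      thus ?thesis by (simp add: f'_def)
    qed
    hence "degree f' \<le> degree g - 1" using g(2) by (intro degree_le) auto
    hence "degree f' < degree g" using g(2) by linarith
    moreover have "poly_over F f'" unfolding f'_def using F g cF pF
      by (intro poly_over_diff poly_over_smult)
    moreover have "poly (pCons a h) \<beta> = poly f' \<beta>" using f g by (simp add: f'_def)
    ultimately show ?case by blast
  qed
  thus ?thesis using that h by metis
qed

lemma dim_le_adjoin:
  fixes \<beta> :: "'a::field_char_0"
  assumes F: "ring_set F" "\<rat> \<subseteq> F" "dim_le F C" and alg: "\<And>x :: 'a. algebraic x"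
    and g: "poly_over F g" "g \<noteq> 0" "degree g \<le> n" "poly g \<beta> = 0"
  shows "dim_le (adjoin F \<beta>) (C * n)"
proof -
  obtain B where B: "finite B" "card B \<le> C" "F \<subseteq> rat_vs.span B" using F by (auto simp: dim_le_def)
  have g0: "degree g > 0"
  proof (rule ccontr)
    assume "\<not> degree g > 0"
    then obtain c where "g = [:c:]" by (auto elim: degree_eq_zeroE)
    thus False using g by auto
  qed
  define B' where "B' = (\<lambda>(b, i). b * \<beta> ^ i) ` (B \<times> {..<degree g})"
  have "card B' \<le> card B * degree g"
    unfolding B'_def using B by (intro order.trans[OF card_image_le]) (auto simp: card_cartesian_product)
  also have "\<dots> \<le> C * n" using B g by (intro mult_le_mono)
  finally have "card B' \<le> C * n" .
  moreover have "finite B'" using B by (auto simp: B'_def)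
  moreover have "adjoin F \<beta> \<subseteq> rat_vs.span B'"
  proof
    fix x assume "x \<in> adjoin F \<beta>"
    then obtain f where f: "poly_over F f" "degree f < degree g" "x = poly f \<beta>"
      using adjoin_low_degree[OF F(1,2) alg g(1) g0 g(4)] by metis
    have "coeff f i * \<beta> ^ i \<in> rat_vs.span B'" if "i \<le> degree f" for i
    proof -
      have "coeff f i \<in> rat_vs.span B" using f B by (auto simp: poly_over_def)
      from rat_span_mult_right[OF this, of "\<beta> ^ i"]
      have "coeff f i * \<beta> ^ i \<in> rat_vs.span ((\<lambda>b. b * \<beta> ^ i) ` B)" .
      moreover have "(\<lambda>b. b * \<beta> ^ i) ` B \<subseteq> B'" using that f by (force simp: B'_def)
      ultimately show ?thesis using rat_vs.span_mono by blast
    qed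
    thus "x \<in> rat_vs.span B'" unfolding f(3) poly_altdef by (intro rat_vs.span_sum) auto
  qed
  ultimately show ?thesis unfolding dim_le_def by blast
qed

lemma adjoin_finite:
  fixes F :: "'a::field_char_0 set"
  assumes F: "ring_set F" "\<rat> \<subseteq> F" "dim_le F C" and alg: "\<And>x :: 'a. algebraic x"
    and T: "finite T" "\<And>\<beta>. \<beta> \<in> T \<Longrightarrow> \<exists>g. poly_over F g \<and> g \<noteq> 0 \<and> degree g \<le> n \<and> poly g \<beta> = 0"
  obtains F1 where "ring_set F1" "F \<subseteq> F1" "T \<subseteq> F1" "dim_le F1 (C * n ^ card T)"
proof -
  have "\<exists>F1. ring_set F1 \<and> F \<subseteq> F1 \<and> T \<subseteq> F1 \<and> dim_le F1 (C * n ^ card T)"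
    using T
  proof (induction T)
    case empty
    thus ?case using F by (intro exI[of _ F]) auto
  next
    case (insert \<beta> T)
    then obtain F1 where F1: "ring_set F1" "F \<subseteq> F1" "T \<subseteq> F1" "dim_le F1 (C * n ^ card T)" by auto
    obtain g where g: "poly_over F g" "g \<noteq> 0" "degree g \<le> n" "poly g \<beta> = 0" using insert.prems by auto
    have "dim_le (adjoin F1 \<beta>) (C * n ^ card T * n)"
      using F F1 g alg by (intro dim_le_adjoin[of F1 _ g]) (auto intro: poly_over_mono)
    moreover have "F1 \<subseteq> adjoin F1 \<beta>" "\<beta> \<in> adjoin F1 \<beta>" "ring_set (adjoin F1 \<beta>)"
      using F1 by (auto intro: adjoin_self ring_set_adjoin dest: adjoin_incl)
    ultimately show ?case using F1 insert.hyps
      by (intro exI[of _ "adjoin F1 \<beta>"]) (auto simp: mult_ac)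
  qed
  thus ?thesis using that by blast
qed

section \<open>Continuity of roots\<close>

lemma poly_sum_le:
  fixes x :: "'a::comm_ring_1"
  shows "degree q \<le> n \<Longrightarrow> poly q x = (\<Sum>i\<le>n. coeff q i * x ^ i)"
  unfolding poly_altdef by (rule sum.mono_neutral_left) (auto simp: coeff_eq_0)

locale p_valuation_closed = p_valuation V p
  for V :: "'a::{alg_closed_field, field_char_0} set" and p
begin

text \<open>
  If no root \<open>t\<^sub>i\<close> lies in \<open>V\<close>, then \<open>g = g(0) \<Prod> (1 - x / t\<^sub>i)\<close> where all \<open>1 / t\<^sub>i\<close> are non-units of \<open>V\<close>.
\<close>

lemma no_integral_root:
  assumes "g \<noteq> 0" "\<And>t. t \<in> V \<Longrightarrow> poly g t \<noteq> 0" "i > 0"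
  shows "coeff g 0 \<prec> coeff g i"
  using assms
proof (induction "degree g" arbitrary: g i)
  case 0
  then obtain c where "g = [:c:]" by (metis degree_eq_zeroE)
  thus ?case using 0 by (cases i) auto
next
  case (Suc d)
  obtain t where t: "poly g t = 0" using alg_closed_imp_poly_has_root[of g] Suc by auto
  hence tV: "t \<notin> V" using Suc by auto
  hence t0: "t \<noteq> 0" and t1: "t \<prec> 1" using ring_set_0[OF ring_V] by (auto simp: one_vle_iff)
  obtain q where q: "g = [:-t, 1:] * q" using t unfolding poly_eq_0_iff_dvd dvd_def by blast
  have q0: "q \<noteq> 0" using Suc.prems q by auto
  have dq: "degree q = d" using Suc.hyps(2) q0 unfolding q by (subst (asm) degree_mult_eq) auto
  have rq: "poly q s \<noteq> 0" if "s \<in> V" for s using Suc.prems(2)[OF that] q by auto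
  have IH: "coeff q 0 \<prec> coeff q j" if "j > 0" for j
    using Suc.hyps(1)[of q j] dq q0 rq that by auto
  have c0: "coeff q 0 \<noteq> 0" using rq[of 0] ring_set_0[OF ring_V] by (simp add: poly_0_coeff_0)
  obtain j where j: "i = Suc j" using Suc.prems by (cases i) auto
  have g0: "coeff g 0 = - (t * coeff q 0)" by (simp add: q)
  have gi: "coeff g i = coeff q j + - (t * coeff q i)" by (simp add: q j)
  have 1: "t * coeff q 0 \<prec> t * coeff q i" using IH[of i] t0 Suc.prems by simp
  have "t * coeff q 0 \<prec> coeff q 0"
    using t1 vle_cancel[OF c0, of 1 t] by (simp add: mult.commute)
  moreover have "coeff q 0 \<preceq> coeff q j" using IH[of j] vless_imp_vle by (cases j) auto
  ultimately have "t * coeff q 0 \<prec> coeff q j" using vless_vle_trans by blast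
  hence "t * coeff q 0 \<prec> coeff q j + - (t * coeff q i)" using 1 by (intro vless_add) auto
  thus ?case unfolding g0 gi by simp
qed

text \<open>
  The value of \<open>r\<close> at \<open>\<alpha>\<close> is small, whereas the coefficient of degree \<open>w\<close> of \<open>r (\<alpha> + y)\<close> is a unit. After
  the substitution \<open>y = p\<^sup>M t\<close> the latter has the value of \<open>p\<^sup>w\<^sup>M\<close>, which is at most that of the constant term, so
  that some root \<open>t\<close> is integral.
\<close>

lemma root_near:
  assumes h: "weierstrass_root n B F w h \<alpha>" and B: "B > 0"
    and r: "degree r \<le> n" "\<And>i. P ^ (n * M) \<preceq> coeff h i - coeff r i" and M: "B \<le> M"
  obtains \<beta> where "poly r \<beta> = 0" "P ^ M \<preceq> \<alpha> - \<beta>" "r \<noteq> 0"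
proof -
  have W: "weierstrass B h w" and \<alpha>: "\<alpha> \<in> V" "poly h \<alpha> = 0" and w0: "w > 0" "degree h \<le> n"
    using h by (auto simp: weierstrass_root_def)
  have wn: "w \<le> n" by (rule weierstrass_root_le[OF h])
  have "B * 1 \<le> M * n" using M wn w0 by (intro mult_le_mono) auto
  hence BN: "P ^ B \<preceq> P ^ (n * M)" by (intro P_power_vle) (simp add: mult.commute)
  have hV: "coeff h j \<in> V" for j using W by (auto simp: weierstrass_def poly_over_def)
  have Wr: "weierstrass B r w"
    unfolding weierstrass_def poly_over_def
  proof (intro conjI allI impI)
    have B1: "P ^ B \<preceq> coeff h j - coeff r j" for j using BN r(2) vle_trans by blast
    have 1: "1 \<prec> P ^ B" using P_power_vle_iff[of B 0] B by simp
    fix j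
    have "coeff h j - coeff r j \<in> V"
      using vle_trans[OF vless_imp_vle[OF 1] B1[of j]] by (simp only: one_vle_iff)
    from ring_set_diff[OF ring_V hV[of j] this] show "coeff r j \<in> V" by simp
    show "P ^ B \<preceq> coeff r j" if "w < j"
    proof -
      have "P ^ B \<preceq> coeff h j" using W that by (simp add: weierstrass_def)
      from vle_diff[OF this B1[of j]] show ?thesis by simp
    qed
    show "coeff r w \<preceq> 1"
    proof (rule ccontr)
      assume "1 \<prec> coeff r w"
      hence "1 \<prec> coeff r w + (coeff h w - coeff r w)"
        using 1 B1[of w] vle_trans by (intro vless_add) blast+
      thus False using W by (simp add: weierstrass_def)
    qed
  qed
  hence Wr': "weierstrass B (r \<circ>\<^sub>p [:\<alpha>, 1:]) w" using weierstrass_shift \<alpha> B by blast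
  define g where "g = r \<circ>\<^sub>p [:\<alpha>, 1:] \<circ>\<^sub>p [:0, P ^ M:]"
  have gc: "coeff g i = (P ^ M) ^ i * coeff (r \<circ>\<^sub>p [:\<alpha>, 1:]) i" for i
    unfolding g_def by (rule coeff_pcompose_linear)
  have "coeff g w \<noteq> 0" using weierstrass_coeff_neq_0[OF Wr'] by (simp add: gc)
  hence g0: "g \<noteq> 0" by auto
  have "coeff g w \<preceq> (P ^ M) ^ w * 1" unfolding gc using Wr' by (intro vle_mult vle_refl) (simp add: weierstrass_def)
  also have "(P ^ M) ^ w * 1 = P ^ (w * M)" by (simp add: power_mult mult.commute)
  finally have 1: "coeff g w \<preceq> P ^ (w * M)" .
  have 2: "P ^ (w * M) \<preceq> P ^ (n * M)" using wn by (intro P_power_vle mult_le_mono1)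
  have "P ^ (n * M) \<preceq> coeff g 0"
  proof -
    have "P ^ (n * M) \<preceq> (\<Sum>i\<le>n. (coeff h i - coeff r i) * \<alpha> ^ i)"
      using r \<alpha> by (intro vle_sum vle_mult_right V_intros)
    also have "(\<Sum>i\<le>n. (coeff h i - coeff r i) * \<alpha> ^ i) = poly h \<alpha> - poly r \<alpha>"
      by (simp add: poly_sum_le[OF w0(2)] poly_sum_le[OF r(1)] algebra_simps sum_subtractf)
    finally show ?thesis using \<alpha> by (simp add: gc)
  qed
  hence "coeff g w \<preceq> coeff g 0" using 1 2 vle_trans by blast
  then obtain t where t: "t \<in> V" "poly g t = 0" using no_integral_root[OF g0, of w] w0 by blast
  have "poly r (\<alpha> + P ^ M * t) = 0"
    using t by (simp add: g_def poly_pcompose mult.commute)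
  moreover have "P ^ M \<preceq> \<alpha> - (\<alpha> + P ^ M * t)"
    using vle_mult_right[OF vle_refl t(1), of "P ^ M"] by simp
  moreover have "r \<noteq> 0" using weierstrass_coeff_neq_0[OF Wr] by auto
  ultimately show ?thesis using that by blast
qed

end

section \<open>A field of bounded degree approximating all roots\<close>

text \<open>
  In the step, the exponent of \<open>n\<close> bounds the number of roots that have to be adjoined to a field of degree \<open>C\<close>, at
  precision \<open>M = (n + 1) (n + 2)\<close>. The value does not depend on the valuation ring, so the
  exponents obtained from it serve all places over \<open>p\<close> simultaneously.
\<close>

fun degree_bound :: "nat \<Rightarrow> nat \<Rightarrow> nat \<Rightarrow> nat \<Rightarrow> nat" where
  "degree_bound n p 0 C = C"
| "degree_bound n p (Suc w) C =
     degree_bound n p w (C * n ^ (n * (p ^ (C * (n * (Suc n * (n + 2))))) ^ Suc n))"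

context p_valuation_closed begin

text \<open>
  Rounding the coefficients of \<open>h\<close> to representatives modulo \<open>p\<^sup>n\<^sup>M\<close> leaves a finite number of polynomials, and each
  \<open>\<alpha>\<close> is close to a root of one of them. The bound on the number of these roots is uniform in \<open>V\<close>.
\<close>

lemma root_representatives:
  assumes F: "ring_set F" "\<rat> \<subseteq> F" "dim_le F C"
  obtains T where "finite T" "card T \<le> n * (p ^ (C * (n * M))) ^ Suc n"
    "\<And>\<beta>. \<beta> \<in> T \<Longrightarrow> \<exists>g. poly_over F g \<and> g \<noteq> 0 \<and> degree g \<le> n \<and> poly g \<beta> = 0"
    "\<And>B w h \<alpha>. weierstrass_root n B F w h \<alpha> \<Longrightarrow> 0 < B \<Longrightarrow> B \<le> M \<Longrightarrow> \<exists>\<beta>\<in>T. P ^ M \<preceq> \<alpha> - \<beta>"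
proof -
  obtain R where R: "R \<subseteq> F \<inter> V" "finite R" "card R \<le> p ^ (C * (n * M))"
    "\<And>x. x \<in> F \<inter> V \<Longrightarrow> \<exists>r\<in>R. P ^ (n * M) \<preceq> x - r"
    using residue_cover_power[OF F, of "n * M"] by metis
  define L where "L = {xs. set xs \<subseteq> R \<and> length xs = Suc n}"
  define Q where "Q = Poly ` L - {0}"
  define T where "T = (\<Union>q\<in>Q. {\<beta>. poly q \<beta> = 0})"
  have L: "finite L" "card L = card R ^ Suc n"
    unfolding L_def using R(2) by (simp_all add: finite_lists_length_eq card_lists_length_eq)
  have cP: "coeff (Poly xs) i = (if i < length xs then xs ! i else 0)" for xs :: "'a list" and i
    by (simp add: coeff_Poly_eq nth_default_def)
  have Q: "poly_over F q" "degree q \<le> n" "q \<noteq> 0" if "q \<in> Q" for q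
  proof -
    obtain xs where xs: "q = Poly xs" "set xs \<subseteq> R" "length xs = Suc n" "q \<noteq> 0"
      using \<open>q \<in> Q\<close> by (auto simp: Q_def L_def)
    show "q \<noteq> 0" by fact
    show "degree q \<le> n" using xs by (intro degree_le) (auto simp: nth_default_def)
    show "poly_over F q"
      using xs R(1) ring_set_0[OF F(1)] nth_mem unfolding poly_over_def xs(1) cP by fastforce
  qed
  have finQ: "finite Q" using L by (simp add: Q_def)
  have "finite T" unfolding T_def using finQ Q(3) by (intro finite_UN_I poly_roots_finite)
  moreover have "card T \<le> n * (p ^ (C * (n * M))) ^ Suc n"
  proof -
    have "card T \<le> (\<Sum>q\<in>Q. card {\<beta>. poly q \<beta> = 0})" unfolding T_def by (rule card_UN_le[OF finQ])
    also have "\<dots> \<le> (\<Sum>q\<in>Q. n)"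
      using Q order.trans[OF card_poly_roots_bound] by (intro sum_mono) blast
    also have "\<dots> = card Q * n" by simp
    also have "card Q \<le> card L"
      unfolding Q_def using L by (meson card_Diff1_le card_image_le finite_imageI order.trans)
    also have "card L \<le> (p ^ (C * (n * M))) ^ Suc n" unfolding L(2) using R(3) by (rule power_mono) simp
    finally show ?thesis by (simp add: mult.commute)
  qed
  moreover have "\<exists>g. poly_over F g \<and> g \<noteq> 0 \<and> degree g \<le> n \<and> poly g \<beta> = 0" if "\<beta> \<in> T" for \<beta>
    using that Q unfolding T_def by blast
  moreover have "\<exists>\<beta>\<in>T. P ^ M \<preceq> \<alpha> - \<beta>" if h: "weierstrass_root n B F w h \<alpha>" and B: "0 < B" "B \<le> M" for B w h \<alpha>
  proof -
    have "\<exists>r\<in>R. P ^ (n * M) \<preceq> coeff h i - r" for i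
      using h R(4)[of "coeff h i"] by (auto simp: weierstrass_root_def weierstrass_def poly_over_def)
    then obtain f where f: "\<And>i. f i \<in> R" "\<And>i. P ^ (n * M) \<preceq> coeff h i - f i" by metis
    define q where "q = Poly (map f [0..<Suc n])"
    have qc: "coeff q i = (if i \<le> n then f i else 0)" for i
      unfolding q_def cP by (simp add: less_Suc_eq_le del: upt_Suc)
    have "degree q \<le> n" by (rule degree_le) (simp add: qc)
    moreover have "P ^ (n * M) \<preceq> coeff h i - coeff q i" for i
      using f(2)[of i] h by (auto simp: qc weierstrass_root_def coeff_eq_0)
    ultimately obtain \<beta> where \<beta>: "poly q \<beta> = 0" "P ^ M \<preceq> \<alpha> - \<beta>" "q \<noteq> 0"
      using root_near[OF h B(1) _ _ B(2)] by metis
    have "map f [0..<Suc n] \<in> L" using f(1) by (auto simp: L_def simp del: upt_Suc)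
    hence "q \<in> Q" using \<beta>(3) unfolding Q_def q_def by blast
    thus ?thesis using \<beta> by (auto simp: T_def)
  qed
  ultimately show ?thesis by (rule that)
qed

lemma weierstrass_root_mono: "weierstrass_root n B F w h \<alpha> \<Longrightarrow> F \<subseteq> F1 \<Longrightarrow> weierstrass_root n B F1 w h \<alpha>"
  by (auto simp: weierstrass_root_def intro: poly_over_mono)

text \<open>
  Let \<open>F1\<close> arise from \<open>F\<close> by adjoining the representatives of roots, and let \<open>F'\<close> be obtained from \<open>F1\<close> by the
  induction hypothesis. As long as the roots are clustered, each step yields one more \<open>p\<close>-adic
  digit of \<open>\<alpha>\<close> in \<open>F\<close>; as soon as they separate, the rest of \<open>\<alpha>\<close> is a root of smaller Weierstrass degree
  over \<open>F1\<close>.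
\<close>

lemma weierstrass_root_approx:
  assumes n: "n > 0" and F: "ring_set F" "\<rat> \<subseteq> F" "dim_le F C"
  shows "\<exists>F'. ring_set F' \<and> F \<subseteq> F' \<and> dim_le F' (degree_bound n p w C) \<and>
     (\<forall>v h \<alpha>. v \<le> w \<longrightarrow> weierstrass_root n (Suc n) F v h \<alpha> \<longrightarrow> \<alpha> \<in> approx F')"
  using F
proof (induction w arbitrary: F C)
  case 0
  thus ?case by (intro exI[of _ F]) (auto simp: weierstrass_root_def)
next
  case (Suc w)
  note F = Suc.prems
  define M where "M = Suc n * (n + 2)"
  define K where "K = n * (p ^ (C * (n * M))) ^ Suc n"
  obtain T where T: "finite T" "card T \<le> K"
    "\<And>\<beta>. \<beta> \<in> T \<Longrightarrow> \<exists>g. poly_over F g \<and> g \<noteq> 0 \<and> degree g \<le> n \<and> poly g \<beta> = 0"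
    "\<And>B w h \<alpha>. weierstrass_root n B F w h \<alpha> \<Longrightarrow> 0 < B \<Longrightarrow> B \<le> M \<Longrightarrow> \<exists>\<beta>\<in>T. P ^ M \<preceq> \<alpha> - \<beta>"
    by (rule root_representatives[OF F, of n M, folded K_def]) (rule that)
  obtain F1 where F1: "ring_set F1" "F \<subseteq> F1" "T \<subseteq> F1" "dim_le F1 (C * n ^ card T)"
    using adjoin_finite[OF F algebraic T(1,3)] by metis
  have "C * n ^ card T \<le> C * n ^ K" using T(2) n by (intro mult_le_mono2 power_increasing) auto
  hence F1': "dim_le F1 (C * n ^ K)" using F1(4) dim_le_mono by blast
  have QF1: "\<rat> \<subseteq> F1" using F F1 by auto
  obtain F' where F': "ring_set F'" "F1 \<subseteq> F'" "dim_le F' (degree_bound n p w (C * n ^ K))"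
    "\<And>v h \<alpha>. v \<le> w \<Longrightarrow> weierstrass_root n (Suc n) F1 v h \<alpha> \<Longrightarrow> \<alpha> \<in> approx F'"
    using Suc.IH[OF F1(1) QF1 F1'] by blast
  have top: "\<exists>y\<in>F'. P ^ m \<preceq> \<alpha> - y" if "weierstrass_root n (Suc n) F (Suc w) h \<alpha>" for m h \<alpha>
    using that
  proof (induction m arbitrary: h \<alpha>)
    case 0
    thus ?case using ring_set_0[OF F'(1)] by (intro bexI[of _ 0]) (auto simp: one_vle_iff weierstrass_root_def)
  next
    case (Suc m)
    show ?case
    proof (cases "\<forall>i<Suc w. P ^ (Suc n * (Suc w - i)) \<preceq> coeff (h \<circ>\<^sub>p [:\<alpha>, 1:]) i")
      case True
      obtain c h1 where c: "c \<in> F" "weierstrass_root n (Suc n) F (Suc w) h1 ((\<alpha> - c) / P)"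
        using clustered_roots_step[OF F(1,2) Suc.prems refl] True by metis
      obtain y where y: "y \<in> F'" "P ^ m \<preceq> (\<alpha> - c) / P - y" using Suc.IH[OF c(2)] by blast
      have "P * P ^ m \<preceq> P * ((\<alpha> - c) / P - y)" using y by simp
      also have "P * ((\<alpha> - c) / P - y) = \<alpha> - (c + P * y)" by (simp add: field_simps)
      finally have "P ^ Suc m \<preceq> \<alpha> - (c + P * y)" by simp
      moreover have "c + P * y \<in> F'"
        using y c F1 F' by (intro ring_set_add ring_set_mult ring_set_of_nat) auto
      ultimately show ?thesis by blast
    next
      case False
      then obtain i0 where i0: "i0 < Suc w" "\<not> P ^ (Suc n * (Suc w - i0)) \<preceq> coeff (h \<circ>\<^sub>p [:\<alpha>, 1:]) i0"
        by blast
      have "Suc n \<le> M" by (simp add: M_def)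
      then obtain \<beta> where \<beta>: "\<beta> \<in> T" "P ^ M \<preceq> \<alpha> - \<beta>" using T(4)[OF Suc.prems] by auto
      obtain i h1 L where i: "i < Suc w" "weierstrass_root n (Suc n) F1 i h1 ((\<alpha> - \<beta>) / P ^ L)"
        using separated_roots_step[OF Suc.prems zero_less_Suc F1(1) QF1 F1(2) i0 subsetD[OF F1(3) \<beta>(1)]]
          \<beta>(2) unfolding M_def by blast
      have "(\<alpha> - \<beta>) / P ^ L \<in> approx F'" using F'(4)[OF _ i(2)] i(1) by simp
      moreover have "\<beta> \<in> approx F'" "P ^ L \<in> approx F'"
        using approx_incl[of F'] \<beta> F1 F' ring_set_power[OF ring_set_approx ring_set_of_nat[OF ring_set_approx]]
        by auto
      ultimately have "\<beta> + P ^ L * ((\<alpha> - \<beta>) / P ^ L) \<in> approx F'"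
        using ring_set_approx[OF F'(1)] by (intro ring_set_add ring_set_mult)
      hence "\<alpha> \<in> approx F'" by simp
      thus ?thesis unfolding approx_def by blast
    qed
  qed
  have "\<alpha> \<in> approx F'" if "v \<le> Suc w" "weierstrass_root n (Suc n) F v h \<alpha>" for v h \<alpha>
  proof (cases "v = Suc w")
    case True
    thus ?thesis using top that by (auto simp: approx_def)
  next
    case False
    thus ?thesis using F'(4)[of v h \<alpha>] that weierstrass_root_mono F1(2) by auto
  qed
  moreover have "F \<subseteq> F'" using F1 F' by blast
  moreover have "degree_bound n p w (C * n ^ K) = degree_bound n p (Suc w) C"
    by (simp only: degree_bound.simps K_def M_def)
  ultimately show ?case using F' by metis
qed

lemma dim_le_Rats: "dim_le (\<rat> :: 'a set) 1"
proof -
  have "x \<in> rat_vs.span {1}" if "x \<in> \<rat>" for x :: 'a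
  proof -
    from that obtain q where "x = of_rat q" by (rule Rats_cases)
    thus ?thesis using rat_vs.span_scale[OF rat_vs.span_base[of 1 "{1::'a}"], of q] by simp
  qed
  thus ?thesis unfolding dim_le_def by (intro exI[of _ "{1}"]) auto
qed

lemma ring_set_Rats: "ring_set (\<rat> :: 'a set)"
  by (auto simp: ring_set_def)

text \<open>
  If \<open>c\<close> is the leading coefficient of an integral equation of degree \<open>k\<close> for \<open>x\<close>, then \<open>c x\<close> is a root of a monic one, which has
  Weierstrass degree \<open>k\<close>.
\<close>

lemma bounded_degree_approx:
  assumes n: "n > 0"
  obtains F where "ring_set F" "\<rat> \<subseteq> F" "dim_le F (degree_bound n p n 1)"
    "\<And>x g. g \<noteq> 0 \<Longrightarrow> degree g \<le> n \<Longrightarrow> poly (map_poly of_int g) x = 0 \<Longrightarrow> x \<in> approx F"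
proof -
  obtain F where F: "ring_set F" "\<rat> \<subseteq> F" "dim_le F (degree_bound n p n 1)"
    "\<And>v h \<alpha>. v \<le> n \<Longrightarrow> weierstrass_root n (Suc n) \<rat> v h \<alpha> \<Longrightarrow> \<alpha> \<in> approx F"
    using weierstrass_root_approx[OF n ring_set_Rats order.refl dim_le_Rats, of n] by blast
  have "x \<in> approx F" if g: "g \<noteq> 0" "degree g \<le> n" "poly (map_poly of_int g) x = 0" for x g
  proof -
    define k where "k = degree g"
    define c where "c = lead_coeff g"
    have c0: "c \<noteq> 0" using g by (simp add: c_def)
    have k0: "k > 0"
    proof (rule ccontr)
      assume "\<not> k > 0"
      then obtain d where "g = [:d:]" unfolding k_def by (auto elim: degree_eq_zeroE)
      thus False using g by (auto simp: map_poly_pCons)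
    qed
    define f :: "nat \<Rightarrow> int" where "f = (\<lambda>i. if i < k then coeff g i * c ^ (k - 1 - i) else if i = k then 1 else 0)"
    define h :: "'a poly" where "h = Poly (map (\<lambda>i. of_int (f i)) [0..<Suc k])"
    have hc: "coeff h i = of_int (f i)" for i
      by (auto simp: h_def coeff_Poly_eq nth_default_def f_def simp del: upt_Suc)
    have dh: "degree h = k" by (intro antisym degree_le le_degree) (auto simp: hc f_def)
    define \<alpha> where "\<alpha> = of_int c * x"
    have "poly h \<alpha> = (\<Sum>i\<le>k. of_int (f i) * \<alpha> ^ i)" by (simp add: poly_altdef dh hc)
    also have "\<dots> = (\<Sum>i\<le>k. of_int (c ^ (k - 1)) * (of_int (coeff g i) * x ^ i))"
    proof (intro sum.cong refl)
      fix i assume "i \<in> {..k}"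
      show "of_int (f i) * \<alpha> ^ i = of_int (c ^ (k - 1)) * (of_int (coeff g i) * x ^ i)"
      proof (cases "i < k")
        case True
        hence "c ^ (k - 1 - i) * c ^ i = c ^ (k - 1)" by (simp flip: power_add)
        hence "(of_int (c ^ (k - 1)) :: 'a) = of_int (c ^ (k - 1 - i)) * of_int c ^ i"
          by (metis of_int_mult of_int_power)
        thus ?thesis using True by (simp add: f_def \<alpha>_def power_mult_distrib)
      next
        case False
        hence "i = k" using \<open>i \<in> {..k}\<close> by simp
        moreover have "c ^ k = c ^ (k - 1) * c" using k0 by (metis power_minus_mult)
        hence "(of_int c :: 'a) ^ k = of_int (c ^ (k - 1)) * of_int c" by (metis of_int_mult of_int_power)
        ultimately show ?thesis by (simp add: f_def \<alpha>_def power_mult_distrib c_def k_def)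
      qed
    qed
    also have "\<dots> = of_int (c ^ (k - 1)) * poly (map_poly of_int g) x"
      by (simp add: poly_altdef sum_distrib_left degree_map_poly coeff_map_poly k_def)
    also have "\<dots> = 0" using g by simp
    finally have root: "poly h \<alpha> = 0" .
    have "algebraic_int \<alpha>"
      by (rule algebraic_int.intros[of h]) (auto simp: root dh hc f_def)
    hence "\<alpha> \<in> V" by (rule algebraic_int_in_valuation_ring[OF valuation])
    moreover have "weierstrass (Suc n) h k"
      unfolding weierstrass_def poly_over_def hc
      by (auto simp: f_def intro: V_intros)
    moreover have "poly_over \<rat> h" by (auto simp: poly_over_def hc)
    ultimately have "weierstrass_root n (Suc n) \<rat> k h \<alpha>"
      using root dh g k0 by (simp add: weierstrass_root_def k_def)
    hence "\<alpha> \<in> approx F" using F(4) g(2) by (simp add: k_def)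
    moreover have "inverse (of_int c) \<in> (\<rat> :: 'a set)" by simp
    hence "inverse (of_int c) \<in> approx F" using F(2) approx_incl[of F] by blast
    ultimately have "\<alpha> * inverse (of_int c) \<in> approx F" by (rule ring_set_mult[OF ring_set_approx[OF F(1)]])
    also have "\<alpha> * inverse (of_int c) = x" using c0 by (simp add: \<alpha>_def field_simps)
    finally show ?thesis .
  qed
  thus ?thesis using that F(1-3) by blast
qed

section \<open>Value group and residues of fields of bounded degree\<close>

text \<open>
  In a rational relation between \<open>1, y, \<dots>, y\<^sup>C\<close> two different terms have the same value, since a
  single minimal term could not cancel. Their quotient is a power of \<open>y\<close> times a rational number.
\<close>

lemma value_of_power:
  assumes F: "ring_set F" "dim_le F C" and y: "y \<in> F" "y \<noteq> 0"
  obtains i s t where "0 < i" "i \<le> C" "P ^ s * y ^ i \<preceq> P ^ t" "P ^ t \<preceq> P ^ s * y ^ i"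
proof -
  obtain c where c: "\<exists>i\<in>{0..C}. c i \<noteq> 0" "(\<Sum>i\<in>{0..C}. of_int (c i) * y ^ i) = 0"
    using dim_le_dependent[OF F(2), of "{0..C}" "\<lambda>i. y ^ i"] ring_set_power[OF F(1) y(1)] by auto
  define f where "f = (\<lambda>i. of_int (c i) * y ^ i)"
  obtain i where "i \<in> {0..C}" "f i \<noteq> 0" using c y by (auto simp: f_def)
  then obtain k l where kl: "k \<in> {0..C}" "l \<in> {0..C}" "k \<noteq> l" "f k \<noteq> 0" "f l \<noteq> 0"
      "f k \<preceq> f l" "f l \<preceq> f k"
    using vanishing_sum_two_minimal_terms[of "{0..C}" f i] c by (auto simp: f_def)
  have main: "\<exists>i s t. 0 < i \<and> i \<le> C \<and> P ^ s * y ^ i \<preceq> P ^ t \<and> P ^ t \<preceq> P ^ s * y ^ i"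
    if kl: "k < l" "l \<le> C" "f k \<noteq> 0" "f l \<noteq> 0" "f k \<preceq> f l" "f l \<preceq> f k" for k l
  proof -
    obtain a where a: "of_int (c k) \<preceq> P ^ a" "P ^ a \<preceq> of_int (c k)"
      using of_int_valuation[of "c k"] kl by (auto simp: f_def)
    obtain b where b: "of_int (c l) \<preceq> P ^ b" "P ^ b \<preceq> of_int (c l)"
      using of_int_valuation[of "c l"] kl by (auto simp: f_def)
    have yl: "y ^ l = y ^ k * y ^ (l - k)" using kl by (simp flip: power_add)
    have yk: "y ^ k \<noteq> 0" using y by simp
    have "y ^ k * (P ^ b * y ^ (l - k)) \<preceq> f l"
      using vle_mult[OF b(2) vle_refl, of "y ^ l"] by (simp add: f_def yl mult_ac)
    also have "f l \<preceq> f k" by fact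
    finally (vle_trans) have "y ^ k * (P ^ b * y ^ (l - k)) \<preceq> f k" .
    moreover have "f k \<preceq> y ^ k * P ^ a"
      using vle_mult[OF a(1) vle_refl, of "y ^ k"] by (simp add: f_def mult_ac)
    ultimately have "y ^ k * (P ^ b * y ^ (l - k)) \<preceq> y ^ k * P ^ a" by (rule vle_trans)
    hence 1: "P ^ b * y ^ (l - k) \<preceq> P ^ a" using vle_cancel[OF yk] by blast
    have "y ^ k * P ^ a \<preceq> f k"
      using vle_mult[OF a(2) vle_refl, of "y ^ k"] by (simp add: f_def mult_ac)
    also have "f k \<preceq> f l" by fact
    finally (vle_trans) have "y ^ k * P ^ a \<preceq> f l" .
    moreover have "f l \<preceq> y ^ k * (P ^ b * y ^ (l - k))"
      using vle_mult[OF b(1) vle_refl, of "y ^ l"] by (simp add: f_def yl mult_ac)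
    ultimately have "y ^ k * P ^ a \<preceq> y ^ k * (P ^ b * y ^ (l - k))" by (rule vle_trans)
    hence 2: "P ^ a \<preceq> P ^ b * y ^ (l - k)" using vle_cancel[OF yk] by blast
    have "0 < l - k" "l - k \<le> C" using kl by simp_all
    thus ?thesis using 1 2 by blast
  qed
  have "\<exists>i s t. 0 < i \<and> i \<le> C \<and> P ^ s * y ^ i \<preceq> P ^ t \<and> P ^ t \<preceq> P ^ s * y ^ i"
    using main[of k l] main[of l k] kl by (cases k l rule: linorder_cases) auto
  thus ?thesis using that by blast
qed

text \<open>
  A close approximation of \<open>x \<noteq> 0\<close> has the same value as \<open>x\<close>, and all possible denominators \<open>i \<le> C\<close>
  divide \<open>C!\<close>.
\<close>

lemma value_of_fact_power:
  assumes F: "ring_set F" "dim_le F C" and x: "x \<in> approx F" "x \<noteq> 0"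
  obtains s t where "P ^ s * x ^ fact C \<preceq> P ^ t" "P ^ t \<preceq> P ^ s * x ^ fact C"
proof -
  obtain k where k: "x \<preceq> P ^ k" using bounded_by_P_power[OF x(2)] .
  obtain y where y: "y \<in> F" "P ^ Suc k \<preceq> x - y" using x(1) approxE by metis
  have less: "x \<prec> x - y"
  proof
    assume "x - y \<preceq> x"
    hence "P ^ Suc k \<preceq> P ^ k" using y k vle_trans by blast
    thus False unfolding P_power_vle_iff by simp
  qed
  have xy: "x \<preceq> y" using vle_diff[OF vle_refl vless_imp_vle[OF less]] by simp
  have yx: "y \<preceq> x"
  proof (rule ccontr)
    assume "x \<prec> y"
    hence "x \<prec> (x - y) + y" using less by (intro vless_add)
    thus False by simp
  qed
  have "y \<noteq> 0" using yx x(2) by auto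
  then obtain i s t where i: "0 < i" "i \<le> C" "P ^ s * y ^ i \<preceq> P ^ t" "P ^ t \<preceq> P ^ s * y ^ i"
    using value_of_power[OF F y(1)] by metis
  have "i dvd fact C" using i by (simp add: dvd_fact)
  then obtain q where q: "fact C = i * q" by (auto elim: dvdE)
  have e: "(P ^ s * y ^ i) ^ q = P ^ (s * q) * y ^ fact C"
    by (simp add: q power_mult_distrib flip: power_mult)
  have "P ^ (s * q) * x ^ fact C \<preceq> P ^ (s * q) * y ^ fact C"
    using xy by (intro vle_mult vle_refl vle_power)
  moreover have "P ^ (s * q) * y ^ fact C \<preceq> P ^ (t * q)"
    using vle_power[OF i(3), of q] unfolding e by (simp flip: power_mult)
  moreover have "P ^ (s * q) * y ^ fact C \<preceq> P ^ (s * q) * x ^ fact C"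
    using yx by (intro vle_mult vle_refl vle_power)
  moreover have "P ^ (t * q) \<preceq> P ^ (s * q) * y ^ fact C"
    using vle_power[OF i(4), of q] unfolding e by (simp flip: power_mult)
  ultimately show ?thesis using that[of "s * q" "t * q"] vle_trans by blast
qed

lemma vle_power_diff:
  assumes "z \<preceq> a - b" "a \<in> V" "b \<in> V" shows "z \<preceq> a ^ m - b ^ m"
proof (cases m)
  case (Suc k)
  have "a ^ m - b ^ m = (a - b) * (\<Sum>i<m. b ^ (m - Suc i) * a ^ i)" by (rule power_diff_sumr2)
  thus ?thesis using assms by (auto intro!: vle_mult_right V_intros)
qed auto

text \<open>
  Among the powers \<open>y\<^sup>0, \<dots>, y\<^sup>N\<close> with \<open>N = p\<^sup>C\<close> of an approximating unit \<open>y\<close> two are congruent modulo \<open>p\<close>, so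
  \<open>y\<close> has an order modulo \<open>p\<close> that is at most \<open>N\<close> and divides \<open>N!\<close>.
\<close>

lemma unit_power_congruent_1:
  assumes F: "ring_set F" "dim_le F C" and b: "b \<in> approx F" "b \<in> V" "b \<preceq> 1"
  shows "P \<preceq> b ^ fact (p ^ C) - 1"
proof -
  obtain y where y: "y \<in> F" "P ^ 1 \<preceq> b - y" using b(1) approxE by metis
  hence by': "P \<preceq> b - y" by simp
  have "b - y \<in> V" using vle_trans[OF vless_imp_vle[OF P_vless] by'] by (simp only: one_vle_iff)
  from ring_set_diff[OF ring_V b(2) this] have yV: "y \<in> V" by simp
  have y1: "y \<preceq> 1"
  proof (rule ccontr)
    assume "1 \<prec> y"
    hence "1 \<prec> (b - y) + y" using vless_vle_trans[OF P_vless by'] by (intro vless_add)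
    thus False using b by simp
  qed
  have y0: "y \<noteq> 0" using y1 by auto
  obtain R where R: "R \<subseteq> F \<inter> V" "finite R" "card R \<le> p ^ C" "\<And>x. x \<in> F \<inter> V \<Longrightarrow> \<exists>r\<in>R. P \<preceq> x - r"
    using residue_cover[OF F] by metis
  have "\<exists>r\<in>R. P \<preceq> y ^ i - r" for i
    using R(4)[of "y ^ i"] ring_set_power[OF F(1) y(1)] ring_set_power[OF ring_V yV] by simp
  then obtain r where r: "\<And>i. r i \<in> R" "\<And>i. P \<preceq> y ^ i - r i" by metis
  have "\<not> inj_on r {0..p ^ C}"
  proof
    assume "inj_on r {0..p ^ C}"
    hence "card {0..p ^ C} \<le> card R" using r R by (intro card_inj_on_le) auto
    thus False using R(3) by simp
  qed
  then obtain k l where kl: "k \<le> p ^ C" "l \<le> p ^ C" "k \<noteq> l" "r k = r l"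
    unfolding inj_on_def by auto
  obtain i j where ij: "i < j" "j \<le> p ^ C" "r i = r j"
    using kl that[of k l] that[of l k] by (cases k l rule: linorder_cases) simp_all
  define d where "d = j - i"
  have yj: "y ^ j = y ^ i * y ^ d" using ij by (simp add: d_def flip: power_add)
  have "P \<preceq> (y ^ j - r j) - (y ^ i - r i)" by (rule vle_diff[OF r(2) r(2)])
  also have "(y ^ j - r j) - (y ^ i - r i) = y ^ i * (y ^ d - 1)"
    using ij by (simp add: yj algebra_simps)
  finally have "P \<preceq> y ^ i * (y ^ d - 1)" .
  moreover have "y ^ i * P \<preceq> P" using vle_mult[OF vle_power[OF y1, of i] vle_refl, of P] by simp
  ultimately have "y ^ i * P \<preceq> y ^ i * (y ^ d - 1)" using vle_trans by blast
  hence yd: "P \<preceq> y ^ d - 1" using y0 by simp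
  have "d dvd fact (p ^ C)" using ij by (intro dvd_fact) (auto simp: d_def)
  then obtain q where q: "fact (p ^ C) = d * q" by (auto elim: dvdE)
  have "P \<preceq> (y ^ d) ^ q - 1 ^ q"
    using yd yV by (intro vle_power_diff) (auto intro: V_intros)
  hence "P \<preceq> y ^ fact (p ^ C) - 1" by (simp add: q power_mult)
  moreover have "P \<preceq> b ^ fact (p ^ C) - y ^ fact (p ^ C)"
    using by' b yV by (intro vle_power_diff)
  ultimately have "P \<preceq> (b ^ fact (p ^ C) - y ^ fact (p ^ C)) + (y ^ fact (p ^ C) - 1)" by (intro vle_add)
  thus ?thesis by simp
qed

text \<open>
  The value of \<open>b\<close> is a natural multiple of the value of \<open>p\<close>. Either it is positive, and then \<open>p\<close>
  divides \<open>b\<close>, or \<open>b\<close> is a unit.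
\<close>

lemma normalised_power_congruence:
  assumes F: "ring_set F" "\<rat> \<subseteq> F" "dim_le F C" and a: "a \<in> approx F"
    and b: "b \<in> V" "b * P ^ j = a ^ fact C"
  shows "P \<preceq> b * (b ^ fact (p ^ C) - 1)"
proof (cases "a = 0")
  case True
  hence "b = 0" using b by (simp add: power_0_left)
  thus ?thesis by simp
next
  case False
  obtain s t where st: "P ^ s * a ^ fact C \<preceq> P ^ t" "P ^ t \<preceq> P ^ s * a ^ fact C"
    using value_of_fact_power[OF F(1,3) a False] .
  have e: "P ^ s * a ^ fact C = P ^ (s + j) * b"
    unfolding b(2)[symmetric] power_add by (simp only: mult_ac)
  have "P ^ (s + j) \<preceq> P ^ (s + j) * b" using b(1) by (intro vle_mult_right vle_refl)
  hence "P ^ (s + j) \<preceq> P ^ t" using st(1) vle_trans unfolding e by blast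
  hence le: "s + j \<le> t" unfolding P_power_vle_iff .
  define d where "d = t - (s + j)"
  have t: "P ^ t = P ^ (s + j) * P ^ d" using le by (simp add: d_def flip: power_add)
  have nz: "P ^ (s + j) \<noteq> 0" by simp
  have bd: "b \<preceq> P ^ d" "P ^ d \<preceq> b"
    using st unfolding e t vle_cancel[OF nz] by blast+
  show ?thesis
  proof (cases "d = 0")
    case True
    have "inverse (P ^ j) \<in> (\<rat> :: 'a set)" by simp
    hence "inverse (P ^ j) \<in> approx F" using F(2) approx_incl[of F] by blast
    hence "a ^ fact C * inverse (P ^ j) \<in> approx F"
      using a ring_set_approx[OF F(1)] by (intro ring_set_mult ring_set_power)
    also have "a ^ fact C * inverse (P ^ j) = b"
      unfolding b(2)[symmetric] by simp
    finally have "b \<in> approx F" .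
    from unit_power_congruent_1[OF F(1,3) this b(1)] show ?thesis
      using True bd(1) b(1) by (intro vle_mult_left) simp_all
  next
    case False
    hence "P ^ 1 \<preceq> P ^ d" by (intro P_power_vle) simp
    from vle_trans[OF this bd(2)] have "P \<preceq> b" by simp
    thus ?thesis using b(1) by (intro vle_mult_right V_intros)
  qed
qed

end

section \<open>The compositum of fields of bounded degree\<close>

lemma type_algebra_simps [simp]:
  "carrier ring_of_type_algebra = UNIV"
  "x \<otimes>\<^bsub>ring_of_type_algebra\<^esub> y = x * y"
  "x \<oplus>\<^bsub>ring_of_type_algebra\<^esub> y = x + y"
  "\<one>\<^bsub>ring_of_type_algebra\<^esub> = 1"
  "\<zero>\<^bsub>ring_of_type_algebra\<^esub> = 0"
  by (simp_all add: ring_of_type_algebra_def)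

lemma type_algebra_a_inv [simp]: "\<ominus>\<^bsub>ring_of_type_algebra\<^esub> (x :: 'a::comm_ring_1) = - x"
proof -
  interpret R: ring "ring_of_type_algebra :: 'a ring" by rule
  show ?thesis by (rule R.minus_equality) auto
qed

lemma type_algebra_m_inv [simp]:
  "x \<noteq> 0 \<Longrightarrow> inv\<^bsub>ring_of_type_algebra\<^esub> (x :: 'a::field) = inverse x"
proof -
  assume x: "x \<noteq> 0"
  interpret R: field "ring_of_type_algebra :: 'a ring" by rule
  show ?thesis by (rule R.inv_unique'[symmetric]) (use x in auto)
qed

lemma ring_set_compositum_upto: "ring_set (compositum_upto n :: 'a::field_char_0 set)"
  unfolding ring_set_def
proof (intro conjI ballI)
  let ?K = "compositum_upto n :: 'a set"
  show "1 \<in> ?K"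
    using generate_field.one[of "ring_of_type_algebra :: 'a ring"] by (auto simp: compositum_upto_def)
  fix x y assume xy: "x \<in> ?K" "y \<in> ?K"
  have "x + - y \<in> ?K"
    using generate_field.eng_add[OF xy(1)[unfolded compositum_upto_def]
        generate_field.a_inv[OF xy(2)[unfolded compositum_upto_def]]]
    by (simp add: compositum_upto_def)
  thus "x - y \<in> ?K" by simp
  show "x * y \<in> ?K"
    using generate_field.eng_mult[OF xy[unfolded compositum_upto_def]] by (simp add: compositum_upto_def)
qed

lemma Rats_subset_compositum_upto: "\<rat> \<subseteq> (compositum_upto n :: 'a::field_char_0 set)"
proof
  let ?K = "compositum_upto n :: 'a set"
  fix x :: 'a assume "x \<in> \<rat>"
  then obtain q where q: "x = of_rat q" by (rule Rats_cases)
  obtain a b where ab: "quotient_of q = (a, b)" by (cases "quotient_of q")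
  have b: "b > 0" "q = of_int a / of_int b"
    by (rule quotient_of_denom_pos[OF ab], rule quotient_of_div[OF ab])
  have x: "x = of_int a * inverse (of_int b)" unfolding q b(2) of_rat_divide by (simp add: divide_inverse)
  have int: "of_int k \<in> ?K" for k by (rule ring_set_of_int[OF ring_set_compositum_upto])
  have "of_int b \<noteq> (0 :: 'a)" using b by simp
  hence "inverse (of_int b) \<in> ?K"
    using generate_field.m_inv[OF int[of b, unfolded compositum_upto_def]]
    by (simp add: compositum_upto_def)
  thus "x \<in> ?K" unfolding x by (intro ring_set_mult[OF ring_set_compositum_upto] int)
qed

text \<open>
  Translates the inductive notion of dimension into spans over the rational scalar multiplication.
\<close>

lemma dim_le_of_dimension:
  fixes K :: "'a::field_char_0 set"
  assumes "ring.dimension ring_of_type_algebra d \<rat> K"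
  shows "dim_le K d"
proof -
  interpret R: ring "ring_of_type_algebra :: 'a ring" by rule
  show ?thesis
    using assms
  proof (induction d "\<rat> :: 'a set" K rule: R.dimension.induct)
    case zero_dim
    show ?case unfolding dim_le_def by (intro exI[of _ "{}"]) auto
  next
    case (Suc_dim v E d)
    then obtain B where B: "finite B" "card B \<le> d" "E \<subseteq> rat_vs.span B" by (auto simp: dim_le_def)
    have "R.line_extension \<rat> v E \<subseteq> rat_vs.span (insert v B)"
    proof
      fix x assume "x \<in> R.line_extension \<rat> v E"
      then obtain k e where "x = k * v + e" "k \<in> \<rat>" "e \<in> E"
        by (auto simp: R.line_extension_def set_add_def' r_coset_def)
      then obtain q where "x = of_rat q * v + e" by (auto elim!: Rats_cases)
      moreover have "e \<in> rat_vs.span (insert v B)"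
        using B(3) \<open>e \<in> E\<close> rat_vs.span_mono[of B "insert v B"] by blast
      ultimately show "x \<in> rat_vs.span (insert v B)"
        using rat_vs.span_add[OF rat_vs.span_scale[OF rat_vs.span_base[of v "insert v B"]]] by simp
    qed
    moreover have "card (insert v B) \<le> Suc d" using B by (simp add: card_insert_if)
    ultimately show ?case unfolding dim_le_def using B(1) by (intro exI[of _ "insert v B"]) auto
  qed
qed

lemma subfield_bounded_degree:
  fixes K :: "'a::field_char_0 set"
  assumes K: "subfield K ring_of_type_algebra" "ring.dimension ring_of_type_algebra d \<rat> K" "d \<le> n"
    and x: "x \<in> K"
  obtains g :: "int poly" where "g \<noteq> 0" "degree g \<le> n" "poly (map_poly of_int g) x = 0"
proof -
  have "subring K ring_of_type_algebra" using K(1) by (rule subfieldE(1))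
  hence pow: "x ^ i \<in> K" for i
    using subringE(3)[of K ring_of_type_algebra] subringE(6)[of K ring_of_type_algebra] x
    by (induction i) auto
  have "dim_le K n" using dim_le_of_dimension[OF K(2)] K(3) by (rule dim_le_mono)
  from dim_le_dependent[OF this, of "{..n}" "\<lambda>i. x ^ i"] pow
  obtain c where c: "\<exists>i\<in>{..n}. c i \<noteq> 0" "(\<Sum>i\<le>n. of_int (c i) * x ^ i) = 0" by auto
  define g where "g = Poly (map c [0..<Suc n])"
  have gc: "coeff g i = (if i \<le> n then c i else 0)" for i
    unfolding g_def by (simp add: coeff_Poly_eq nth_default_def less_Suc_eq_le del: upt_Suc)
  have dg: "degree g \<le> n" by (rule degree_le) (simp add: gc)
  have "g \<noteq> 0" using c(1) gc by (metis atMost_iff coeff_0)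
  moreover have "poly (map_poly of_int g) x = 0"
    using c(2) dg by (subst poly_sum_le[of _ n]) (auto simp: degree_map_poly coeff_map_poly gc)
  ultimately show ?thesis using that dg by blast
qed

context p_valuation_closed begin

text \<open>
  The closure of \<open>F\<close> is a field, so it contains the compositum as soon as it contains the fields of which the
  latter is composed.
\<close>

lemma compositum_approx:
  assumes n: "n > 0"
  obtains F where "ring_set F" "\<rat> \<subseteq> F" "dim_le F (degree_bound n p n 1)" "compositum_upto n \<subseteq> approx F"
proof -
  obtain F where F: "ring_set F" "\<rat> \<subseteq> F" "dim_le F (degree_bound n p n 1)"
    "\<And>x g. g \<noteq> 0 \<Longrightarrow> degree g \<le> n \<Longrightarrow> poly (map_poly of_int g) x = 0 \<Longrightarrow> x \<in> approx F"
    by (rule bounded_degree_approx[OF n]) (rule that)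
  note R = ring_set_approx[OF F(1)]
  have "x \<in> approx F" if "x \<in> compositum_upto n" for x
    using that unfolding compositum_upto_def
  proof (induction rule: generate_field.induct)
    case one
    show ?case using ring_set_1[OF R] by simp
  next
    case (incl x)
    then obtain K d where "subfield K ring_of_type_algebra" "ring.dimension ring_of_type_algebra d \<rat> K"
      "d \<le> n" "x \<in> K" by auto
    then obtain g :: "int poly" where "g \<noteq> 0" "degree g \<le> n" "poly (map_poly of_int g) x = 0"
      by (rule subfield_bounded_degree)
    thus ?case by (rule F(4))
  next
    case (a_inv x)
    thus ?case using ring_set_uminus[OF R] by simp
  next
    case (m_inv x)
    have "\<rat> \<subseteq> approx F" using F(2) approx_incl by blast
    thus ?case using m_inv rat_subring_inverse[OF R _ m_inv.IH algebraic] by simp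
  next
    case (eng_add x y)
    thus ?case using ring_set_add[OF R] by simp
  next
    case (eng_mult x y)
    thus ?case using ring_set_mult[OF R] by simp
  qed
  thus ?thesis using that F(1-3) by blast
qed

lemma compositum_normalised_power:
  assumes n: "n > 0" and a: "a \<in> compositum_upto n" and b: "b \<in> V"
    and ab: "b * P ^ j = a ^ fact (degree_bound n p n 1)"
  shows "b * (b ^ fact (p ^ degree_bound n p n 1) - 1) / P \<in> V"
proof -
  define C where "C = degree_bound n p n 1"
  obtain F where F: "ring_set F" "\<rat> \<subseteq> F" "dim_le F C" "compositum_upto n \<subseteq> approx F"
    by (rule compositum_approx[OF n, folded C_def]) (rule that)
  have "P \<preceq> b * (b ^ fact (p ^ C) - 1)"
    using normalised_power_congruence[OF F(1-3) subsetD[OF F(4) a] b ab[folded C_def]] .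
  thus ?thesis unfolding C_def[symmetric] by (auto simp: vle_def)
qed

end

text \<open>
  Integrality of the quotient is tested at each valuation ring separately. Where \<open>p\<close> is a unit it is clear, and for
  the other valuation rings the exponents are the same.
\<close>

theorem compositum_power_congruence:
  fixes n p :: nat
  assumes alg: "\<And>x :: 'a::{alg_closed_field, field_char_0}. algebraic x" and n: "n > 0" and p: "prime p"
  obtains E r :: nat where "E > 0" "r > 0"
    "\<And>a b j. (a :: 'a) \<in> compositum_upto n \<Longrightarrow> algebraic_int b \<Longrightarrow> b * of_nat p ^ j = a ^ E \<Longrightarrow>
       algebraic_int (b * (b ^ r - 1) / of_nat p)"
proof -
  define C where "C = degree_bound n p n 1"
  have "algebraic_int (b * (b ^ fact (p ^ C) - 1) / of_nat p)"
    if a: "a \<in> compositum_upto n" and b: "algebraic_int b" "b * of_nat p ^ j = a ^ fact C" for a b :: 'a and j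
  proof (rule ccontr)
    define x where "x = b * (b ^ fact (p ^ C) - 1)"
    assume "\<not> algebraic_int (b * (b ^ fact (p ^ C) - 1) / of_nat p)"
    then obtain V where V: "valuation_ring V" "x / of_nat p \<notin> V"
      unfolding x_def by (rule ex_valuation_ring_excluding)
    have RV: "ring_set V" using V(1) by (simp add: valuation_ring_def)
    have bV: "b \<in> V" using algebraic_int_in_valuation_ring[OF V(1) b(1)] .
    hence xV: "x \<in> V" unfolding x_def using RV by (intro ring_set_intros)
    have "inverse (of_nat p) \<notin> V"
      using V(2) ring_set_mult[OF RV xV, of "inverse (of_nat p)"] by (auto simp: divide_inverse)
    then interpret p_valuation_closed V p
      using V(1) p alg by unfold_locales
    show False
      using V(2) compositum_normalised_power[OF n a bV b(2)[unfolded C_def]] by (simp add: x_def C_def)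
  qed
  thus ?thesis using that[of "fact C" "fact (p ^ C)"] by simp
qed

section \<open>Comparable elements of a domain\<close>

text \<open>
  After localisation at a prime ideal either \<open>e\<close> or \<open>1 - e\<close> is a unit, so one of \<open>a\<close>, \<open>b\<close> divides the other.
  The global form of this condition avoids localisations.
\<close>

definition comparable :: "'a::idom set \<Rightarrow> 'a \<Rightarrow> 'a \<Rightarrow> bool" where
  "comparable D a b \<longleftrightarrow> (\<exists>e\<in>D. \<exists>u\<in>D. \<exists>v\<in>D. e * b = u * a \<and> (1 - e) * a = v * b)"

text \<open>
  The sum of the ideals \<open>(a : b)\<close> and \<open>(b : a)\<close>. To show that it contains \<open>1\<close>, one multiplies out
  factors \<open>1 = c + (1 - c)\<close>, each of which stands for a local case distinction.
\<close>

definition comparison_ideal :: "'a::idom set \<Rightarrow> 'a \<Rightarrow> 'a \<Rightarrow> 'a set" where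
  "comparison_ideal D a b =
     {c + d | c d. c \<in> D \<and> d \<in> D \<and> (\<exists>u\<in>D. c * b = u * a) \<and> (\<exists>v\<in>D. d * a = v * b)}"

lemma comparisonI1:
  assumes "ring_set D" "c \<in> D" "u \<in> D" "c * b = u * a" shows "c \<in> comparison_ideal D a b"
proof -
  have "c = c + 0" "0 * a = 0 * b" by simp_all
  thus ?thesis unfolding comparison_ideal_def using assms ring_set_0[OF assms(1)] by blast
qed

lemma comparisonI2:
  assumes "ring_set D" "c \<in> D" "u \<in> D" "c * a = u * b" shows "c \<in> comparison_ideal D a b"
proof -
  have "c = 0 + c" "0 * b = 0 * a" by simp_all
  thus ?thesis unfolding comparison_ideal_def using assms ring_set_0[OF assms(1)] by blast
qed

lemma comparison_add:
  assumes D: "ring_set D" and xy: "x \<in> comparison_ideal D a b" "y \<in> comparison_ideal D a b"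
  shows "x + y \<in> comparison_ideal D a b"
proof -
  obtain c d u v where x: "x = c + d" "c \<in> D" "d \<in> D" "u \<in> D" "c * b = u * a" "v \<in> D" "d * a = v * b"
    using xy by (auto simp: comparison_ideal_def)
  obtain c' d' u' v' where y: "y = c' + d'" "c' \<in> D" "d' \<in> D" "u' \<in> D" "c' * b = u' * a" "v' \<in> D" "d' * a = v' * b"
    using xy by (auto simp: comparison_ideal_def)
  have "x + y = (c + c') + (d + d')" using x y by simp
  moreover have "c + c' \<in> D" "d + d' \<in> D" "u + u' \<in> D" "v + v' \<in> D"
    using x y ring_set_add[OF D] by auto
  moreover have "(c + c') * b = (u + u') * a" "(d + d') * a = (v + v') * b"
    using x y by (simp_all add: distrib_right)
  ultimately show ?thesis unfolding comparison_ideal_def by blast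
qed

lemma comparison_mult:
  assumes D: "ring_set D" and x: "x \<in> comparison_ideal D a b" "z \<in> D"
  shows "z * x \<in> comparison_ideal D a b"
proof -
  obtain c d u v where *: "x = c + d" "c \<in> D" "d \<in> D" "u \<in> D" "c * b = u * a" "v \<in> D" "d * a = v * b"
    using x by (auto simp: comparison_ideal_def)
  have "z * x = z * c + z * d" using * by (simp add: distrib_left)
  moreover have "z * c \<in> D" "z * d \<in> D" "z * u \<in> D" "z * v \<in> D"
    using * x(2) ring_set_mult[OF D] by auto
  moreover have "(z * c) * b = (z * u) * a" "(z * d) * a = (z * v) * b"
    using * by (simp_all add: mult.assoc)
  ultimately show ?thesis unfolding comparison_ideal_def by blast
qed

lemma comparable_iff: 
  assumes D: "ring_set D" shows "comparable D a b \<longleftrightarrow> 1 \<in> comparison_ideal D a b"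
proof
  assume "comparable D a b"
  then obtain e u v where e: "e \<in> D" "u \<in> D" "v \<in> D" "e * b = u * a" "(1 - e) * a = v * b"
    by (auto simp: comparable_def)
  have "1 - e \<in> D" using ring_set_diff[OF D ring_set_1[OF D] e(1)] .
  moreover have "1 = e + (1 - e)" by simp
  ultimately show "1 \<in> comparison_ideal D a b" unfolding comparison_ideal_def using e by blast
next
  assume "1 \<in> comparison_ideal D a b"
  then obtain c d u v where *: "1 = c + d" "c \<in> D" "u \<in> D" "c * b = u * a" "v \<in> D" "d * a = v * b"
    by (auto simp: comparison_ideal_def)
  hence "1 - c = d" by (simp add: algebra_simps)
  thus "comparable D a b" unfolding comparable_def using * by blast
qed

text \<open>
  Locally, \<open>f\<close> divides \<open>M\<close> and hence \<open>M N\<close>, or else \<open>f = v M\<close>, and then \<open>v\<close> is compared with \<open>N\<close>.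
\<close>

lemma comparable_mult:
  assumes D: "ring_set D" "M \<in> D" "N \<in> D"
    and M: "\<And>f. f \<in> D \<Longrightarrow> comparable D f M" and N: "\<And>f. f \<in> D \<Longrightarrow> comparable D f N" and f: "f \<in> D"
  shows "comparable D f (M * N)"
proof -
  obtain c u v where c: "c \<in> D" "u \<in> D" "v \<in> D" "c * M = u * f" "(1 - c) * f = v * M"
    using M[OF f] by (auto simp: comparable_def)
  obtain c' u' v' where c': "c' \<in> D" "u' \<in> D" "v' \<in> D" "c' * N = u' * v" "(1 - c') * v = v' * N"
    using N[OF c(3)] by (auto simp: comparable_def)
  let ?J = "comparison_ideal D f (M * N)"
  have d: "1 - c \<in> D" "1 - c' \<in> D" using ring_set_diff[OF D(1) ring_set_1[OF D(1)]] c c' by auto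
  have 1: "c \<in> ?J"
    by (rule comparisonI1[OF D(1) c(1), of "u * N"])
       (use c(4) D c(2) in \<open>auto intro: ring_set_mult simp: mult_ac\<close>)
  have 2: "(1 - c) * c' \<in> ?J"
  proof (rule comparisonI1[OF D(1), of _ "u' * (1 - c) * (1 - c)"])
    have "(1 - c) * c' * (M * N) = (1 - c) * M * (c' * N)" by (simp add: mult_ac)
    also have "\<dots> = (1 - c) * u' * (v * M)" unfolding c'(4) by (simp add: mult_ac)
    also have "\<dots> = u' * (1 - c) * (1 - c) * f" unfolding c(5)[symmetric] by (simp add: mult_ac)
    finally show "(1 - c) * c' * (M * N) = u' * (1 - c) * (1 - c) * f" .
  qed (use D d c' in \<open>auto intro!: ring_set_mult\<close>)
  have 3: "(1 - c) * (1 - c) * (1 - c') \<in> ?J"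
  proof (rule comparisonI2[OF D(1), of _ "(1 - c) * v'"])
    have "(1 - c) * (1 - c) * (1 - c') * f = (1 - c) * (1 - c') * ((1 - c) * f)" by (simp add: mult_ac)
    also have "\<dots> = (1 - c) * ((1 - c') * v) * M" unfolding c(5) by (simp add: mult_ac)
    also have "\<dots> = (1 - c) * v' * (M * N)" unfolding c'(5) by (simp add: mult_ac)
    finally show "(1 - c) * (1 - c) * (1 - c') * f = (1 - c) * v' * (M * N)" .
  qed (use D d c' in \<open>auto intro!: ring_set_mult\<close>)
  have 4: "(1 - c) * (1 - c') * c \<in> ?J" using D d 1 by (intro comparison_mult ring_set_mult)
  have "c + (1 - c) * c' + (1 - c) * (1 - c) * (1 - c') + (1 - c) * (1 - c') * c \<in> ?J"
    by (intro comparison_add D 1 2 3 4)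
  also have "c + (1 - c) * c' + (1 - c) * (1 - c) * (1 - c') + (1 - c) * (1 - c') * c = 1"
    by (simp add: algebra_simps)
  finally show ?thesis by (simp add: comparable_iff[OF D(1)])
qed

text \<open>
  Locally, if \<open>b\<close> divides \<open>d = b b\<^sub>1\<close>, then comparing \<open>a\<close> with \<open>b\<close> amounts to comparing \<open>a b\<^sub>1\<close> with \<open>d\<close>, and likewise if \<open>a\<close>
  divides \<open>d\<close>. Otherwise \<open>a = d a'\<close> and \<open>b = d b'\<close>, so \<open>1 = r a' + s b'\<close>, one of \<open>a'\<close>, \<open>b'\<close> is a unit, and
  \<open>a\<close> or \<open>b\<close> is associated to \<open>d\<close>. The elements \<open>c1\<close>, \<open>c2\<close> below indicate where \<open>a\<close> and \<open>b\<close>, respectively, divide \<open>d\<close>.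
\<close>

lemma comparable_of_combination:
  assumes D: "ring_set D" and ab: "a \<in> D" "b \<in> D" "r \<in> D" "s \<in> D"
    and d: "d = r * a + s * b" "d \<noteq> 0" and cmp: "\<And>f. f \<in> D \<Longrightarrow> comparable D f d"
  shows "comparable D a b"
proof -
  let ?J = "comparison_ideal D a b"
  obtain c1 a1 a' where c1: "c1 \<in> D" "a1 \<in> D" "a' \<in> D" "c1 * d = a1 * a" "(1 - c1) * a = a' * d"
    using cmp[OF ab(1)] by (auto simp: comparable_def)
  obtain c2 b1 b' where c2: "c2 \<in> D" "b1 \<in> D" "b' \<in> D" "c2 * d = b1 * b" "(1 - c2) * b = b' * d"
    using cmp[OF ab(2)] by (auto simp: comparable_def)
  have e: "1 - c1 \<in> D" "1 - c2 \<in> D" using ring_set_diff[OF D ring_set_1[OF D]] c1 c2 by auto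
  have dD: "d \<in> D" unfolding d by (intro ring_set_add ring_set_mult D ab)
  have 1: "c2 \<in> ?J"
  proof -
    obtain c3 u v where c3: "c3 \<in> D" "u \<in> D" "v \<in> D" "c3 * d = u * (a * b1)" "(1 - c3) * (a * b1) = v * d"
      using cmp[OF ring_set_mult[OF D ab(1) c2(2)]] by (auto simp: comparable_def)
    have d3: "1 - c3 \<in> D" using ring_set_diff[OF D ring_set_1[OF D] c3(1)] .
    have "c3 * c2 \<in> ?J"
    proof (rule comparisonI1[OF D, of _ "u * c2 * c2"])
      have "d * (c3 * c2 * b) = (c3 * d) * c2 * b" by (simp add: mult_ac)
      also have "\<dots> = u * a * c2 * (b1 * b)" unfolding c3(4) by (simp add: mult_ac)
      also have "\<dots> = d * (u * c2 * c2 * a)" unfolding c2(4)[symmetric] by (simp add: mult_ac)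
      finally show "c3 * c2 * b = u * c2 * c2 * a" using d(2) by simp
    qed (use D c2 c3 in \<open>auto intro!: ring_set_mult\<close>)
    moreover have "(1 - c3) * c2 \<in> ?J"
    proof (rule comparisonI2[OF D, of _ v])
      have "d * ((1 - c3) * c2 * a) = (1 - c3) * a * (c2 * d)" by (simp add: mult_ac)
      also have "\<dots> = (1 - c3) * (a * b1) * b" unfolding c2(4) by (simp add: mult_ac)
      also have "\<dots> = d * (v * b)" unfolding c3(5) by (simp add: mult_ac)
      finally show "(1 - c3) * c2 * a = v * b" using d(2) by simp
    qed (use D c2 c3 d3 in \<open>auto intro!: ring_set_mult\<close>)
    ultimately have "c3 * c2 + (1 - c3) * c2 \<in> ?J" by (rule comparison_add[OF D])
    thus ?thesis by (simp add: algebra_simps)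
  qed
  have 2: "c1 \<in> ?J"
  proof -
    obtain c3 u v where c3: "c3 \<in> D" "u \<in> D" "v \<in> D" "c3 * d = u * (b * a1)" "(1 - c3) * (b * a1) = v * d"
      using cmp[OF ring_set_mult[OF D ab(2) c1(2)]] by (auto simp: comparable_def)
    have d3: "1 - c3 \<in> D" using ring_set_diff[OF D ring_set_1[OF D] c3(1)] .
    have "c3 * c1 \<in> ?J"
    proof (rule comparisonI2[OF D, of _ "u * c1 * c1"])
      have "d * (c3 * c1 * a) = (c3 * d) * c1 * a" by (simp add: mult_ac)
      also have "\<dots> = u * b * c1 * (a1 * a)" unfolding c3(4) by (simp add: mult_ac)
      also have "\<dots> = d * (u * c1 * c1 * b)" unfolding c1(4)[symmetric] by (simp add: mult_ac)
      finally show "c3 * c1 * a = u * c1 * c1 * b" using d(2) by simp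
    qed (use D c1 c3 in \<open>auto intro!: ring_set_mult\<close>)
    moreover have "(1 - c3) * c1 \<in> ?J"
    proof (rule comparisonI1[OF D, of _ v])
      have "d * ((1 - c3) * c1 * b) = (1 - c3) * b * (c1 * d)" by (simp add: mult_ac)
      also have "\<dots> = (1 - c3) * (b * a1) * a" unfolding c1(4) by (simp add: mult_ac)
      also have "\<dots> = d * (v * a)" unfolding c3(5) by (simp add: mult_ac)
      finally show "(1 - c3) * c1 * b = v * a" using d(2) by simp
    qed (use D c1 c3 d3 in \<open>auto intro!: ring_set_mult\<close>)
    ultimately have "c3 * c1 + (1 - c3) * c1 \<in> ?J" by (rule comparison_add[OF D])
    thus ?thesis by (simp add: algebra_simps)
  qed
  have 3: "r * (1 - c2) * a' \<in> ?J"
  proof (rule comparisonI1[OF D, of _ "r * b' * (1 - c1)"])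
    have "r * (1 - c2) * a' * b = r * a' * ((1 - c2) * b)" by (simp add: mult_ac)
    also have "\<dots> = r * b' * (a' * d)" unfolding c2(5) by (simp add: mult_ac)
    also have "\<dots> = r * b' * (1 - c1) * a" unfolding c1(5)[symmetric] by (simp add: mult_ac)
    finally show "r * (1 - c2) * a' * b = r * b' * (1 - c1) * a" .
  qed (use D ab c1 c2 e in \<open>auto intro!: ring_set_mult\<close>)
  have 4: "s * (1 - c1) * b' \<in> ?J"
  proof (rule comparisonI2[OF D, of _ "s * a' * (1 - c2)"])
    have "s * (1 - c1) * b' * a = s * b' * ((1 - c1) * a)" by (simp add: mult_ac)
    also have "\<dots> = s * a' * (b' * d)" unfolding c1(5) by (simp add: mult_ac)
    also have "\<dots> = s * a' * (1 - c2) * b" unfolding c2(5)[symmetric] by (simp add: mult_ac)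
    finally show "s * (1 - c1) * b' * a = s * a' * (1 - c2) * b" .
  qed (use D ab c1 c2 e in \<open>auto intro!: ring_set_mult\<close>)
  have "d * ((1 - c1) * (1 - c2)) = r * (1 - c2) * ((1 - c1) * a) + s * (1 - c1) * ((1 - c2) * b)"
    unfolding d by (simp add: algebra_simps)
  also have "\<dots> = d * (r * (1 - c2) * a' + s * (1 - c1) * b')"
    unfolding c1(5) c2(5) by (simp add: algebra_simps)
  finally have "(1 - c1) * (1 - c2) = r * (1 - c2) * a' + s * (1 - c1) * b'" using d(2) by simp
  hence 5: "(1 - c1) * (1 - c2) \<in> ?J" using comparison_add[OF D 3 4] by simp
  have "(1 - c1) * (1 - c2) + (c1 + (1 - c1) * c2) \<in> ?J"
    by (intro comparison_add D 5 1 2 comparison_mult e)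
  also have "(1 - c1) * (1 - c2) + (c1 + (1 - c1) * c2) = 1" by (simp add: algebra_simps)
  finally show ?thesis by (simp add: comparable_iff[OF D])
qed

text \<open>
  Locally, \<open>v\<close> is a unit and divides everything, or \<open>w\<close> is a unit, \<open>v\<close> is associated to \<open>q v'\<close>, and the question
  becomes the comparison of \<open>v'\<close> with a smaller power of \<open>q\<close>.
\<close>

lemma comparable_prime_power:
  fixes G :: "'a::idom set"
  assumes D: "ring_set D" "q \<in> D" and G: "G \<subseteq> D"
    and step: "\<And>v. v \<in> G \<Longrightarrow> \<exists>w\<in>D. \<exists>z\<in>D. \<exists>v'\<in>G. w = 1 - v * z \<and> v * w = q * v'"
    and v: "v \<in> G"
  shows "comparable D v (q ^ k)"
  using v
proof (induction k arbitrary: v)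
  case 0
  have "(1 - 0) * v = v * 1" by simp
  thus ?case
    unfolding comparable_def using ring_set_0[OF D(1)] 0 G by (intro bexI[of _ 0] bexI[of _ v]) auto
next
  case (Suc k)
  obtain w z v' where w: "w \<in> D" "z \<in> D" "v' \<in> G" "w = 1 - v * z" "v * w = q * v'"
    using step[OF Suc.prems] by blast
  obtain c u u' where c: "c \<in> D" "u \<in> D" "u' \<in> D" "c * q ^ k = u * v'" "(1 - c) * v' = u' * q ^ k"
    using Suc.IH[OF w(3)] by (auto simp: comparable_def)
  let ?J = "comparison_ideal D v (q ^ Suc k)"
  have vD: "v \<in> D" using Suc.prems G by blast
  have cD: "1 - c \<in> D" using ring_set_diff[OF D(1) ring_set_1[OF D(1)] c(1)] .
  have 1: "c \<in> ?J"
  proof (rule comparisonI1[OF D(1) c(1), of "u * w"])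
    have "c * q ^ Suc k = q * (c * q ^ k)" by (simp add: mult_ac)
    also have "\<dots> = u * (q * v')" unfolding c(4) by (simp add: mult_ac)
    also have "\<dots> = u * w * v" unfolding w(5)[symmetric] by (simp add: mult_ac)
    finally show "c * q ^ Suc k = u * w * v" .
  qed (use D c w in \<open>auto intro!: ring_set_mult\<close>)
  have 2: "(1 - c) * w \<in> ?J"
  proof (rule comparisonI2[OF D(1) _ c(3)])
    have "(1 - c) * w * v = (1 - c) * (v * w)" by (simp add: mult_ac)
    also have "\<dots> = q * ((1 - c) * v')" unfolding w(5) by (simp add: mult_ac)
    also have "\<dots> = u' * q ^ Suc k" unfolding c(5) by (simp add: mult_ac)
    finally show "(1 - c) * w * v = u' * q ^ Suc k" .
  qed (use D cD w in \<open>auto intro!: ring_set_mult\<close>)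
  have "v \<in> ?J"
    by (rule comparisonI1[OF D(1) vD, of "q ^ Suc k"]) (use D in \<open>auto intro: ring_set_power simp: mult_ac simp del: power_Suc\<close>)
  hence 3: "(1 - c) * z * v \<in> ?J" using D cD w by (intro comparison_mult ring_set_mult)
  have "c + (1 - c) * w + (1 - c) * z * v \<in> ?J" by (intro comparison_add D 1 2 3)
  also have "c + (1 - c) * w + (1 - c) * z * v = 1" unfolding w(4) by (simp add: algebra_simps)
  finally show ?case by (simp add: comparable_iff[OF D(1)])
qed

text \<open>
  If \<open>c (b/a)\<^sup>E\<close> is in \<open>D\<close>, so is \<open>(c b/a)\<^sup>E\<close>, hence \<open>c b/a\<close> by closure under roots. The unique
  factorisation in the ambient ring guarantees that \<open>c b/a\<close> belongs to that ring.
\<close>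

lemma comparable_of_powers:
  fixes D :: "'a::{idom, semiring_gcd_mult_normalize} set"
  assumes D: "ring_set D" and root: "\<And>y. y ^ E \<in> D \<Longrightarrow> y \<in> D" and E: "E > 0"
    and cmp: "comparable D (a ^ E) (b ^ E)"
  shows "comparable D a b"
proof -
  have divide: "\<exists>y\<in>D. c * b = y * a"
    if c: "c \<in> D" "u \<in> D" "c * b ^ E = u * a ^ E" "a \<noteq> 0" for a b c u
  proof -
    have e: "(c * b) ^ E = c ^ (E - 1) * u * a ^ E"
    proof -
      have "(c * b) ^ E = c ^ (E - 1) * (c * b ^ E)"
        using E by (simp add: power_mult_distrib mult.assoc[symmetric] flip: power_Suc2)
      thus ?thesis unfolding c(3) by (simp add: mult_ac)
    qed
    hence "a ^ E dvd (c * b) ^ E" by simp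
    hence "a dvd c * b" using E by (simp add: pow_divides_pow_iff)
    then obtain y where y: "c * b = a * y" by (auto elim: dvdE)
    have "a ^ E * y ^ E = a ^ E * (c ^ (E - 1) * u)"
      using e unfolding y by (simp add: power_mult_distrib mult_ac)
    hence "y ^ E = c ^ (E - 1) * u" using c(4) by simp
    hence "y ^ E \<in> D" using D c by (auto intro!: ring_set_intros)
    from root[OF this] show ?thesis using y by (auto simp: mult.commute)
  qed
  show ?thesis
  proof (cases "a = 0 \<or> b = 0")
    case True
    thus ?thesis
    proof
      assume "a = 0" thus ?thesis unfolding comparable_def
        using ring_set_0[OF D] by (intro bexI[of _ 0]) auto
    next
      assume "b = 0" thus ?thesis unfolding comparable_def
        using ring_set_0[OF D] ring_set_1[OF D] by (intro bexI[of _ 1] bexI[of _ 0]) auto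
    qed
  next
    case False
    obtain c u v where c: "c \<in> D" "u \<in> D" "v \<in> D" "c * b ^ E = u * a ^ E" "(1 - c) * a ^ E = v * b ^ E"
      using cmp by (auto simp: comparable_def)
    have "1 - c \<in> D" using ring_set_diff[OF D ring_set_1[OF D] c(1)] .
    thus ?thesis unfolding comparable_def
      using divide[OF c(1,2,4)] divide[OF _ c(3,5)] c(1) False by blast
  qed
qed

text \<open>
  To include a new element \<open>x\<close>, each \<open>e a\<close> is split into \<open>e a * c a\<close>, where \<open>a\<close> divides \<open>x\<close>, and \<open>e a * (1 - c a)\<close>,
  where \<open>x\<close> divides \<open>a\<close> and therefore all the elements that \<open>a\<close> divides. The second parts are collected at \<open>x\<close>.
\<close>

lemma comparable_partition:
  assumes D: "ring_set D" and A: "finite A" "A \<noteq> {}" "A \<subseteq> D"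
    and cmp: "\<And>a b. a \<in> D \<Longrightarrow> b \<in> D \<Longrightarrow> comparable D a b"
  shows "\<exists>e. (\<Sum>a\<in>A. e a) = 1 \<and> (\<forall>a\<in>A. e a \<in> D \<and> (\<forall>b\<in>A. \<exists>u\<in>D. e a * b = u * a))"
  using A
proof (induction A rule: finite_ne_induct)
  case (singleton x)
  thus ?case using ring_set_1[OF D] by (intro exI[of _ "\<lambda>_. 1"]) auto
next
  case (insert x A)
  then obtain e where e1: "(\<Sum>a\<in>A. e a) = 1"
    and e': "\<forall>a\<in>A. e a \<in> D \<and> (\<forall>b\<in>A. \<exists>u\<in>D. e a * b = u * a)" by blast
  have e: "(\<Sum>a\<in>A. e a) = 1" "\<And>a. a \<in> A \<Longrightarrow> e a \<in> D"
    "\<And>a b. a \<in> A \<Longrightarrow> b \<in> A \<Longrightarrow> \<exists>u\<in>D. e a * b = u * a" using e1 e' by simp_all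
  have "\<forall>a\<in>A. \<exists>c. c \<in> D \<and> (\<exists>u\<in>D. c * x = u * a) \<and> (\<exists>v\<in>D. (1 - c) * a = v * x)"
    using cmp insert.prems unfolding comparable_def by blast
  from bchoice[OF this] obtain c
    where "\<forall>a\<in>A. c a \<in> D \<and> (\<exists>u\<in>D. c a * x = u * a) \<and> (\<exists>v\<in>D. (1 - c a) * a = v * x)" ..
  hence c: "c a \<in> D" "\<exists>u\<in>D. c a * x = u * a" "\<exists>v\<in>D. (1 - c a) * a = v * x" if "a \<in> A" for a
    using that by simp_all
  define e' where "e' = (\<lambda>a. if a = x then (\<Sum>a\<in>A. e a * (1 - c a)) else e a * c a)"
  have d: "1 - c a \<in> D" if "a \<in> A" for a using ring_set_diff[OF D ring_set_1[OF D] c(1)[OF that]] .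
  have xA: "x \<notin> A" using insert.hyps by blast
  have sumA: "(\<Sum>a\<in>A. e' a) = (\<Sum>a\<in>A. e a * c a)"
    using xA by (intro sum.cong) (auto simp: e'_def)
  have "(\<Sum>a\<in>insert x A. e' a) = (\<Sum>a\<in>A. e a * (1 - c a)) + (\<Sum>a\<in>A. e a * c a)"
    using insert.hyps sumA by (simp add: e'_def)
  also have "\<dots> = (\<Sum>a\<in>A. e a)"
    unfolding sum.distrib[symmetric] by (intro sum.cong) (auto simp: algebra_simps)
  finally have 1: "(\<Sum>a\<in>insert x A. e' a) = 1" using e by simp
  have 2: "e' a \<in> D" if "a \<in> insert x A" for a
    using that e(2) c(1) d unfolding e'_def by (auto intro!: ring_set_sum ring_set_mult D)
  have 3: "\<exists>u\<in>D. e' a * b = u * a" if ab: "a \<in> insert x A" "b \<in> insert x A" for a b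
  proof (cases "a = x")
    case False
    hence a: "a \<in> A" "e' a = e a * c a" using ab by (auto simp: e'_def)
    show ?thesis
    proof (cases "b = x")
      case True
      obtain u where u: "u \<in> D" "c a * x = u * a" using c(2)[OF a(1)] by blast
      have "e' a * b = e a * (c a * x)" by (simp add: a True mult_ac)
      hence "e' a * b = (e a * u) * a" unfolding u(2) by (simp add: mult_ac)
      thus ?thesis using ring_set_mult[OF D e(2)[OF a(1)] u(1)] by blast
    next
      case False
      then obtain u where u: "u \<in> D" "e a * b = u * a" using e(3) a(1) ab(2) by blast
      have "e' a * b = c a * (e a * b)" by (simp add: a mult_ac)
      hence "e' a * b = (c a * u) * a" unfolding u(2) by (simp add: mult_ac)
      thus ?thesis using ring_set_mult[OF D c(1)[OF a(1)] u(1)] by blast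
    qed
  next
    case True
    show ?thesis
    proof (cases "b = x")
      case True
      thus ?thesis using 2[OF ab(1)] \<open>a = x\<close> by blast
    next
      case False
      hence bA: "b \<in> A" using ab by simp
      have "\<exists>u\<in>D. e y * (1 - c y) * b = u * x" if y: "y \<in> A" for y
      proof -
        obtain u where u: "u \<in> D" "e y * b = u * y" using e(3)[OF y bA] by blast
        obtain v where v: "v \<in> D" "(1 - c y) * y = v * x" using c(3)[OF y] by blast
        have "e y * (1 - c y) * b = (1 - c y) * (e y * b)" by (simp add: mult_ac)
        also have "\<dots> = u * ((1 - c y) * y)" unfolding u(2) by (simp add: mult_ac)
        also have "\<dots> = (u * v) * x" unfolding v(2) by (simp add: mult_ac)
        finally show ?thesis using ring_set_mult[OF D u(1) v(1)] by blast
      qed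
      hence "\<forall>y\<in>A. \<exists>u. u \<in> D \<and> e y * (1 - c y) * b = u * x" by blast
      from bchoice[OF this] obtain f
        where f': "\<forall>y\<in>A. f y \<in> D \<and> e y * (1 - c y) * b = f y * x" ..
      hence f: "f y \<in> D" "e y * (1 - c y) * b = f y * x" if "y \<in> A" for y
        using that by simp_all
      have "e' a * b = (\<Sum>y\<in>A. e y * (1 - c y) * b)"
        using \<open>a = x\<close> by (simp add: e'_def sum_distrib_right)
      also have "\<dots> = (\<Sum>y\<in>A. f y) * a"
        unfolding sum_distrib_right \<open>a = x\<close> by (intro sum.cong refl f(2))
      finally show ?thesis by (rule bexI) (rule ring_set_sum[OF D f(1)])
    qed
  qed
  show ?case by (rule exI[of _ e'], intro conjI ballI 1 2 3)
qed

section \<open>Integer-valued rational polynomials\<close>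

definition rat_eval :: "'a::field_char_0 \<Rightarrow> rat poly \<Rightarrow> 'a" where
  "rat_eval s f = poly (map_poly of_rat f) s"

lemma rat_eval_0 [simp]: "rat_eval s 0 = 0"
  by (simp add: rat_eval_def)

lemma rat_eval_pCons [simp]: "rat_eval s (pCons c f) = of_rat c + s * rat_eval s f"
  by (simp add: rat_eval_def map_poly_pCons)

lemma rat_eval_1 [simp]: "rat_eval s 1 = 1"
  by (simp add: one_pCons)

lemma rat_eval_add [simp]: "rat_eval s (f + g) = rat_eval s f + rat_eval s g"
proof (induction f arbitrary: g)
  case (pCons c f)
  obtain d h where g: "g = pCons d h" by (cases g)
  show ?case
    unfolding g add_pCons rat_eval_pCons pCons.IH of_rat_add by (simp add: algebra_simps)
qed simp

lemma rat_eval_smult [simp]: "rat_eval s (smult c f) = of_rat c * rat_eval s f"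
  by (induction f) (simp_all add: of_rat_mult algebra_simps)

lemma rat_eval_mult [simp]: "rat_eval s (f * g) = rat_eval s f * rat_eval s g"
  by (induction f) (simp_all add: mult_pCons_left algebra_simps)

lemma rat_eval_uminus [simp]: "rat_eval s (- f) = - rat_eval s f"
  using rat_eval_smult[of s "-1" f] by (simp add: of_rat_minus)

lemma rat_eval_diff [simp]: "rat_eval s (f - g) = rat_eval s f - rat_eval s g"
  using rat_eval_add[of s f "- g"] by simp

lemma rat_eval_power [simp]: "rat_eval s (f ^ k) = rat_eval s f ^ k"
  by (induction k) simp_all

lemma rat_eval_of_nat [simp]: "rat_eval s (of_nat k) = of_nat k"
  by (induction k) simp_all

lemma int_valued_polys_iff: "f \<in> int_valued_polys S \<longleftrightarrow> (\<forall>s\<in>S. algebraic_int (rat_eval s f))"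
  by (simp add: int_valued_polys_def rat_eval_def)

lemma ring_set_int_valued_polys: "ring_set (int_valued_polys S)"
proof -
  note A = ring_set_diff[OF ring_set_algebraic_int, simplified]
    ring_set_mult[OF ring_set_algebraic_int, simplified]
  show ?thesis unfolding ring_set_def by (auto simp: int_valued_polys_iff intro: A)
qed

lemma int_valued_polys_root:
  assumes "f ^ E \<in> int_valued_polys S" "E > 0" shows "f \<in> int_valued_polys S"
  unfolding int_valued_polys_iff
proof
  fix s assume "s \<in> S"
  hence "algebraic_int (rat_eval s f ^ E)" using assms by (simp add: int_valued_polys_iff)
  thus "algebraic_int (rat_eval s f)"
    by (rule algebraic_int_root[where p = "monom 1 E"])
       (use assms in \<open>auto simp: poly_monom degree_monom_eq\<close>)
qed

lemma int_poly_int_valued: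
  assumes "\<And>s. s \<in> S \<Longrightarrow> algebraic_int s" "\<And>i. coeff f i \<in> \<int>"
  shows "f \<in> int_valued_polys S"
  unfolding int_valued_polys_def
proof safe
  fix s assume "s \<in> S"
  have "poly_over {x. algebraic_int x} (map_poly of_rat f :: 'a poly)"
    unfolding poly_over_def using assms(2) by (auto simp: coeff_map_poly elim!: Ints_cases) (metis Ints_cases algebraic_int_of_int of_rat_of_int_eq)
  from poly_over_poly[OF ring_set_algebraic_int this, of s] assms(1)[OF \<open>s \<in> S\<close>]
  show "algebraic_int (poly (map_poly of_rat f) s)" by simp
qed

lemma int_multiple:
  fixes f :: "rat poly"
  obtains m :: int where "m > 0" "\<And>i. coeff (smult (of_int m) f) i \<in> \<int>"
proof -
  obtain d :: int where d: "d > 0" "\<forall>i\<in>{..degree f}. \<exists>k::int. of_int d * coeff f i = of_int k"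
    using common_denominator[of "{..degree f}" "coeff f"] by auto
  have "coeff (smult (of_int d) f) i \<in> \<int>" for i
  proof (cases "i \<le> degree f")
    case True
    then obtain k :: int where "of_int d * coeff f i = of_int k" using d by auto
    thus ?thesis by simp
  next
    case False
    thus ?thesis by (simp add: coeff_eq_0)
  qed
  thus ?thesis using that d by blast
qed

text \<open>
  The set \<open>G\<close> below consists of the quotients \<open>g\<^sup>E / q\<^sup>j\<close> in \<open>D\<close>, where \<open>q\<close> is the constant \<open>p\<close>. It contains \<open>f\<^sup>E\<close>
  and permits the division by \<open>q\<close> that \<open>comparable_prime_power\<close> asks for.
\<close>

lemma comparable_prime:
  fixes S :: "'a::{alg_closed_field, field_char_0} set" and n p :: nat
  assumes alg: "\<And>x :: 'a. algebraic x" and n: "n > 0" and p: "prime p" and S: "S \<subseteq> integers_upto n"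
    and f: "f \<in> int_valued_polys S"
  shows "comparable (int_valued_polys S) f (of_nat p)"
proof -
  define D where "D = int_valued_polys S"
  have D: "ring_set D" unfolding D_def by (rule ring_set_int_valued_polys)
  obtain E r :: nat where Er: "E > 0" "r > 0"
    "\<And>a b j. (a :: 'a) \<in> compositum_upto n \<Longrightarrow> algebraic_int b \<Longrightarrow> b * of_nat p ^ j = a ^ E \<Longrightarrow>
       algebraic_int (b * (b ^ r - 1) / of_nat p)"
    by (rule compositum_power_congruence[OF alg n p]) (rule that)
  have p0: "p > 0" using p by (rule prime_gt_0_nat)
  define q where "q = (of_nat p :: rat poly)"
  have q0: "q \<noteq> 0" using p0 by (simp add: q_def)
  have qD: "q \<in> D" unfolding q_def by (rule ring_set_of_nat[OF D])
  have val: "rat_eval s g \<in> compositum_upto n" if "s \<in> S" for s g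
  proof -
    have "poly_over (compositum_upto n) (map_poly of_rat g :: 'a poly)"
      using Rats_subset_compositum_upto[of n] by (auto simp: poly_over_def coeff_map_poly)
    moreover have "s \<in> compositum_upto n" using S that by (auto simp: integers_upto_def)
    ultimately show ?thesis
      unfolding rat_eval_def by (intro poly_over_poly ring_set_compositum_upto)
  qed
  define G where "G = {v \<in> D. \<exists>g\<in>D. \<exists>j. v * q ^ j = g ^ E}"
  have step: "\<exists>w\<in>D. \<exists>z\<in>D. \<exists>v'\<in>G. w = 1 - v * z \<and> v * w = q * v'" if v: "v \<in> G" for v
  proof -
    obtain g j where g: "v \<in> D" "g \<in> D" "v * q ^ j = g ^ E" using v by (auto simp: G_def)
    define x where "x = 1 - v ^ r"
    have xD: "x \<in> D" unfolding x_def using D g by (intro ring_set_intros)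
    define y where "y = smult (inverse (of_nat p)) (v * x)"
    have vx: "v * x = q * y"
      using p0 by (simp add: y_def q_def of_nat_poly)
    have yD: "y \<in> D"
      unfolding D_def int_valued_polys_iff
    proof
      fix s assume s: "s \<in> S"
      have "algebraic_int (rat_eval s v)" using g s by (simp add: D_def int_valued_polys_iff)
      moreover have "rat_eval s v * of_nat p ^ j = rat_eval s g ^ E"
        using arg_cong[OF g(3), of "rat_eval s"] by (simp add: q_def)
      ultimately have "algebraic_int (rat_eval s v * (rat_eval s v ^ r - 1) / of_nat p)"
        using Er(3)[OF val[OF s]] by blast
      hence "algebraic_int (- (rat_eval s v * (rat_eval s v ^ r - 1) / of_nat p))" by simp
      also have "- (rat_eval s v * (rat_eval s v ^ r - 1) / of_nat p) = rat_eval s y"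
        by (simp add: y_def x_def of_rat_inverse divide_inverse algebra_simps)
      finally show "algebraic_int (rat_eval s y)" .
    qed
    define w where "w = x ^ E"
    have wD: "w \<in> D" unfolding w_def using D xD by (intro ring_set_intros)
    obtain e where e: "E = Suc e" using Er(1) gr0_implies_Suc by blast
    define v' where "v' = y * x ^ e"
    have vw: "v * w = q * v'"
      using vx by (simp add: w_def e v'_def mult.assoc[symmetric])
    have "v' * q ^ Suc j = (v * w) * q ^ j" unfolding vw by (simp add: mult_ac)
    also have "\<dots> = (g * x) ^ E"
      using g(3) by (simp add: w_def power_mult_distrib mult_ac)
    finally have "v' * q ^ Suc j = (g * x) ^ E" .
    moreover have "v' \<in> D" "g * x \<in> D" unfolding v'_def using D yD xD g by (auto intro!: ring_set_intros)
    ultimately have v'G: "v' \<in> G" unfolding G_def by blast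
    define z where "z = v ^ (r - 1) * (\<Sum>i<E. x ^ i)"
    have zD: "z \<in> D" unfolding z_def using D xD g by (auto intro!: ring_set_intros)
    have "1 - w = (1 - x) * (\<Sum>i<E. x ^ i)" unfolding w_def by (rule one_diff_power_eq)
    also have "1 - x = v * v ^ (r - 1)" using Er(2) by (simp add: x_def flip: power_Suc)
    finally have "w = 1 - v * z" by (simp add: z_def algebra_simps)
    thus ?thesis using wD zD v'G vw by blast
  qed
  have "f ^ E \<in> D" "f \<in> D" using f D unfolding D_def[symmetric] by (auto intro: ring_set_power)
  moreover have "f ^ E * q ^ 0 = f ^ E" by simp
  ultimately have fG: "f ^ E \<in> G" unfolding G_def by blast
  have "comparable D (f ^ E) (q ^ E)"
    by (rule comparable_prime_power[OF D qD _ step fG]) (auto simp: G_def)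
  hence "comparable D f q"
    using comparable_of_powers[OF D _ Er(1)] int_valued_polys_root[OF _ Er(1)] unfolding D_def by blast
  thus ?thesis by (simp add: D_def q_def)
qed

lemma comparable_of_nat:
  fixes S :: "'a::{alg_closed_field, field_char_0} set" and n N :: nat
  assumes alg: "\<And>x :: 'a. algebraic x" and n: "n > 0" and S: "S \<subseteq> integers_upto n"
    and N: "N > 0" and f: "f \<in> int_valued_polys S"
  shows "comparable (int_valued_polys S) f (of_nat N)"
  using N f
proof (induction N arbitrary: f rule: less_induct)
  case (less N)
  let ?D = "int_valued_polys S"
  note D = ring_set_int_valued_polys[of S]
  show ?case
  proof (cases "N = 1")
    case True
    have "(1 - 0) * f = f * of_nat N" using True by simp
    thus ?thesis unfolding comparable_def
      using ring_set_0[OF D] less.prems by (intro bexI[of _ 0] bexI[of _ f]) auto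
  next
    case False
    then obtain p where p: "prime p" "p dvd N" using prime_factor_nat by blast
    then obtain M where M: "N = p * M" by (auto elim: dvdE)
    have M0: "M > 0" "M < N" using M less.prems prime_gt_1_nat[OF p(1)] by auto
    have "comparable ?D f (of_nat p * of_nat M)"
      using D comparable_prime[OF alg n p(1) S] less.IH[OF M0(2,1)] less.prems(2)
      by (intro comparable_mult ring_set_of_nat) auto
    thus ?thesis by (simp add: M)
  qed
qed

text \<open>
  Multiplying \<open>a\<close> and \<open>b\<close> by the same nonzero rational function does not affect comparability. The cofactors of
  their greatest common divisor satisfy a Bezout identity over \<open>\<rat>[X]\<close>; the common denominator \<open>m\<close> turns it into a
  representation of \<open>m\<^sup>2\<close> by elements of \<open>D\<close>.
\<close>

lemma comparable_int_valued_polys: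
  fixes S :: "'a::{alg_closed_field, field_char_0} set" and n :: nat
  assumes alg: "\<And>x :: 'a. algebraic x" and n: "n > 0" and S: "S \<subseteq> integers_upto n"
    and ab: "a \<in> int_valued_polys S" "b \<in> int_valued_polys S"
  shows "comparable (int_valued_polys S) a b"
proof (cases "a = 0")
  case True
  thus ?thesis unfolding comparable_def
    using ring_set_0[OF ring_set_int_valued_polys] by (intro bexI[of _ 0]) auto
next
  case False
  let ?D = "int_valued_polys S"
  note D = ring_set_int_valued_polys[of S]
  define g where "g = gcd a b"
  have g0: "g \<noteq> 0" using False by (simp add: g_def)
  obtain a0 where a0: "a = g * a0" unfolding g_def by (metis dvdE gcd_dvd1)
  obtain b0 where b0: "b = g * b0" unfolding g_def by (metis dvdE gcd_dvd2)
  obtain r s where "r * a + s * b = g" unfolding g_def by (metis bezout_coefficients_fst_snd)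
  hence "g * (r * a0 + s * b0) = g * 1" unfolding a0 b0 by (simp add: algebra_simps)
  hence rs: "r * a0 + s * b0 = 1" using g0 by (subst (asm) mult_cancel_left) simp
  obtain ma mb mr ms :: int where m: "ma > 0" "mb > 0" "mr > 0" "ms > 0"
    "\<And>i. coeff (smult (of_int ma) a0) i \<in> \<int>" "\<And>i. coeff (smult (of_int mb) b0) i \<in> \<int>"
    "\<And>i. coeff (smult (of_int mr) r) i \<in> \<int>" "\<And>i. coeff (smult (of_int ms) s) i \<in> \<int>"
    using int_multiple[of a0] int_multiple[of b0] int_multiple[of r] int_multiple[of s] by metis
  define m where "m = nat (ma * mb * mr * ms)"
  have m0: "m > 0" using m(1-4) by (simp add: m_def)
  have mm: "of_nat m = (of_int (ma * mb * mr * ms) :: rat)" using m(1-4) by (simp add: m_def)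
  have intS: "algebraic_int x" if "x \<in> S" for x using that S by (auto simp: integers_upto_def)
  have scale: "smult (of_nat m) h \<in> ?D" if "of_nat m = of_int k * (of_int l :: rat)"
    "\<And>i. coeff (smult (of_int l) h) i \<in> \<int>" for h k l
  proof (rule int_poly_int_valued[OF intS])
    fix i
    have "coeff (smult (of_nat m) h) i = of_int k * coeff (smult (of_int l) h) i"
      unfolding that(1) by simp
    thus "coeff (smult (of_nat m) h) i \<in> \<int>" using Ints_mult[OF Ints_of_int that(2)] by metis
  qed
  have D4: "smult (of_nat m) a0 \<in> ?D" "smult (of_nat m) b0 \<in> ?D" "smult (of_nat m) r \<in> ?D" "smult (of_nat m) s \<in> ?D"
    using scale[of "mb * mr * ms" ma] scale[of "ma * mr * ms" mb] scale[of "ma * mb * ms" mr]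
      scale[of "ma * mb * mr" ms] m(5-8) by (simp_all add: mm mult_ac)
  have d: "of_nat (m * m) = smult (of_nat m) r * smult (of_nat m) a0 + smult (of_nat m) s * smult (of_nat m) b0"
  proof -
    have "smult (of_nat m) r * smult (of_nat m) a0 + smult (of_nat m) s * smult (of_nat m) b0 =
        smult (of_nat (m * m)) (r * a0 + s * b0)" by (simp add: smult_add_right)
    thus ?thesis unfolding rs by (simp add: of_nat_poly one_pCons)
  qed
  have "comparable ?D (smult (of_nat m) a0) (smult (of_nat m) b0)"
  proof (rule comparable_of_combination[OF D D4 d])
    show "of_nat (m * m) \<noteq> (0 :: rat poly)" using m0 by simp
    show "comparable ?D f (of_nat (m * m))" if "f \<in> ?D" for f
      using m0 by (intro comparable_of_nat[OF alg n S _ that]) simp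
  qed
  then obtain e u v where e: "e \<in> ?D" "u \<in> ?D" "v \<in> ?D"
    "e * smult (of_nat m) b0 = u * smult (of_nat m) a0" "(1 - e) * smult (of_nat m) a0 = v * smult (of_nat m) b0"
    by (auto simp: comparable_def)
  have cancel: "x * b' = y * a'" if "x * smult (of_nat m) b' = y * smult (of_nat m) a'" for x y a' b' :: "rat poly"
  proof -
    have "smult (of_nat m) (x * b' - y * a') = 0" using that by (simp add: smult_diff_right)
    thus ?thesis using m0 by simp
  qed
  have "e * b = u * a" "(1 - e) * a = v * b"
    using cancel[OF e(4)] cancel[OF e(5)] unfolding a0 b0 by (simp_all add: mult.left_commute)
  thus ?thesis unfolding comparable_def using e(1-3) by blast
qed

section \<open>Pruefer domains inside a field\<close>

lemma sum_in_ideal_prod: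
  fixes I J :: "'b::field set"
  assumes "0 \<in> I" "0 \<in> J" "\<And>a. a \<in> A \<Longrightarrow> f a \<in> ideal_prod ring_of_type_algebra I J"
  shows "sum f A \<in> ideal_prod ring_of_type_algebra I J"
  using assms(3)
proof (induction A rule: infinite_finite_induct)
  case (insert x A)
  thus ?case using ideal_prod.sum[of "f x" ring_of_type_algebra I J "sum f A"] by simp
qed (use ideal_prod.prod[OF assms(1,2), of ring_of_type_algebra] in simp_all)

text \<open>
  If \<open>e\<close> is a partition of unity for the generators, the quotients \<open>e a / a\<close> multiply the ideal into \<open>D\<close>
  and \<open>\<Sum> a (e a / a) = 1\<close>. A generator \<open>0\<close> contributes \<open>e 0 = 0\<close>, since another generator is nonzero.
\<close>

lemma prufer_domain_if_comparable:
  fixes D :: "'b::field set"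
  assumes D: "ring_set D" and cmp: "\<And>a b. a \<in> D \<Longrightarrow> b \<in> D \<Longrightarrow> comparable D a b"
  shows "prufer_domain ring_of_type_algebra D"
proof -
  define R where "R = (ring_of_type_algebra :: 'b ring)"
  interpret R: field R unfolding R_def by rule
  have R: "carrier R = UNIV" "\<And>x y. x \<otimes>\<^bsub>R\<^esub> y = x * y" "\<And>x y. x \<oplus>\<^bsub>R\<^esub> y = x + y" "\<one>\<^bsub>R\<^esub> = 1" "\<zero>\<^bsub>R\<^esub> = 0"
    "\<And>x. \<ominus>\<^bsub>R\<^esub> x = - x" "\<And>x. x \<noteq> 0 \<Longrightarrow> inv\<^bsub>R\<^esub> x = inverse x"
    by (simp_all add: R_def)
  have sub: "subring D R"
    by (rule R.subringI) (use D in \<open>auto simp: R intro: ring_set_intros\<close>)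
  interpret DR: ring "R\<lparr>carrier := D\<rparr>" by (rule R.subring_is_ring[OF sub])
  have inv: "invertible_ideal R D (genideal (R\<lparr>carrier := D\<rparr>) A)"
    if A: "finite A" "A \<subseteq> D" "genideal (R\<lparr>carrier := D\<rparr>) A \<noteq> {\<zero>\<^bsub>R\<^esub>}" for A
  proof -
    define I where "I = genideal (R\<lparr>carrier := D\<rparr>) A"
    have AI: "A \<subseteq> I" unfolding I_def using DR.genideal_self A by simp
    have idI: "ideal I (R\<lparr>carrier := D\<rparr>)" unfolding I_def using DR.genideal_ideal A by simp
    have I0: "0 \<in> I" using additive_subgroup.zero_closed[OF ideal.axioms(1)[OF idI]] by (simp add: R)
    have minimal: "I \<subseteq> {y \<in> D. x * y \<in> D}" if x: "\<And>a. a \<in> A \<Longrightarrow> x * a \<in> D" for x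
      unfolding I_def
    proof (rule DR.genideal_minimal)
      show "A \<subseteq> {y \<in> D. x * y \<in> D}" using A x by auto
      show "ideal {y \<in> D. x * y \<in> D} (R\<lparr>carrier := D\<rparr>)"
      proof (rule idealI[OF DR.ring_axioms])
        show "subgroup {y \<in> D. x * y \<in> D} (add_monoid (R\<lparr>carrier := D\<rparr>))"
        proof (rule DR.add.subgroupI)
          show "{y \<in> D. x * y \<in> D} \<noteq> {}" using ring_set_0[OF D] by auto
          fix a assume a: "a \<in> {y \<in> D. x * y \<in> D}"
          have "\<ominus>\<^bsub>R\<lparr>carrier := D\<rparr>\<^esub> a = - a"
            by (rule DR.minus_equality) (use a D in \<open>auto simp: R intro: ring_set_uminus\<close>)
          thus "\<ominus>\<^bsub>R\<lparr>carrier := D\<rparr>\<^esub> a \<in> {y \<in> D. x * y \<in> D}"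
            using a D by (auto intro: ring_set_uminus)
          fix b assume "b \<in> {y \<in> D. x * y \<in> D}"
          thus "a \<oplus>\<^bsub>R\<lparr>carrier := D\<rparr>\<^esub> b \<in> {y \<in> D. x * y \<in> D}"
            using a D by (auto simp: R distrib_left intro: ring_set_add)
        qed auto
      next
        fix a y assume "a \<in> {y \<in> D. x * y \<in> D}" "y \<in> carrier (R\<lparr>carrier := D\<rparr>)"
        hence a: "a \<in> D" "x * a \<in> D" "y \<in> D" by auto
        have "y * a \<in> D" "a * y \<in> D" using a ring_set_mult[OF D] by auto
        moreover have "x * (y * a) \<in> D" "x * (a * y) \<in> D"
          using ring_set_mult[OF D a(3,2)] by (simp_all add: mult_ac)
        ultimately show "y \<otimes>\<^bsub>R\<lparr>carrier := D\<rparr>\<^esub> a \<in> {y \<in> D. x * y \<in> D}"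
          "a \<otimes>\<^bsub>R\<lparr>carrier := D\<rparr>\<^esub> y \<in> {y \<in> D. x * y \<in> D}"
          by (auto simp: R)
      qed
    qed
    have "\<exists>a\<in>A. a \<noteq> 0"
    proof (rule ccontr)
      assume "\<not> ?thesis"
      hence "A \<subseteq> {\<zero>\<^bsub>R\<lparr>carrier := D\<rparr>\<^esub>}" by (auto simp: R)
      hence "I \<subseteq> {\<zero>\<^bsub>R\<lparr>carrier := D\<rparr>\<^esub>}"
        unfolding I_def by (rule DR.genideal_minimal[OF DR.zeroideal])
      hence "I = {\<zero>\<^bsub>R\<^esub>}" using I0 by (auto simp: R)
      thus False using A(3) by (simp add: I_def)
    qed
    then obtain a0 where a0: "a0 \<in> A" "a0 \<noteq> 0" by blast
    obtain e where e: "(\<Sum>a\<in>A. e a) = 1" "\<forall>a\<in>A. e a \<in> D \<and> (\<forall>b\<in>A. \<exists>u\<in>D. e a * b = u * a)"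
      using comparable_partition[OF D A(1) _ A(2) cmp] a0 by blast
    define J where "J = inverse_ideal R D I"
    have quot: "c * inverse d \<in> quotient_field R D" if "c \<in> D" "d \<in> D" "d \<noteq> 0" for c d
    proof -
      have "c * inverse d = c \<otimes>\<^bsub>R\<^esub> inv\<^bsub>R\<^esub> d" "d \<noteq> \<zero>\<^bsub>R\<^esub>" using that by (simp_all add: R)
      thus ?thesis unfolding quotient_field_def using that by blast
    qed
    have J0: "0 \<in> J"
    proof -
      have "0 \<in> quotient_field R D" using quot[OF ring_set_0[OF D] ring_set_1[OF D]] by simp
      thus ?thesis unfolding J_def inverse_ideal_def using ring_set_0[OF D] by (simp add: R)
    qed
    have J: "e a / a \<in> J \<and> a * (e a / a) = e a" if a: "a \<in> A" for a
    proof (cases "a = 0")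
      case True
      obtain u where "e a * a0 = u * a" using e(2) a a0 by blast
      hence "e a = 0" using True a0 by simp
      thus ?thesis using True J0 by simp
    next
      case False
      have 1: "e a / a \<in> quotient_field R D"
        using quot[of "e a" a] e(2) a A(2) False by (auto simp: divide_inverse)
      have "e a / a * b \<in> D" if b: "b \<in> A" for b
      proof -
        obtain u where "u \<in> D" "e a * b = u * a" using e(2) a b by blast
        thus ?thesis using False by (simp add: field_simps)
      qed
      from minimal[OF this] have "\<forall>y\<in>I. e a / a * y \<in> D" by blast
      hence "e a / a \<in> J" using 1 by (auto simp: J_def inverse_ideal_def R)
      thus ?thesis using False by simp
    qed
    have Jmult: "x * y \<in> J" if "x \<in> D" "y \<in> J" for x y
    proof -
      have "y \<in> quotient_field R D" using that(2) by (simp add: J_def inverse_ideal_def)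
      then obtain c d where cd: "y = c \<otimes>\<^bsub>R\<^esub> inv\<^bsub>R\<^esub> d" "c \<in> D" "d \<in> D" "d \<noteq> \<zero>\<^bsub>R\<^esub>"
        unfolding quotient_field_def by blast
      have d: "d \<noteq> 0" and y: "y = c * inverse d" using cd(1,4) by (simp_all add: R)
      have "x * y \<in> quotient_field R D"
        using quot[OF ring_set_mult[OF D that(1) cd(2)] cd(3) d] by (simp add: y mult.assoc)
      moreover have "x * y * z \<in> D" if "z \<in> I" for z
        using that \<open>y \<in> J\<close> ring_set_mult[OF D \<open>x \<in> D\<close>] by (auto simp: J_def inverse_ideal_def R mult.assoc)
      ultimately show ?thesis by (auto simp: J_def inverse_ideal_def R)
    qed
    have "ideal_prod R I J \<subseteq> D"
    proof
      fix x assume "x \<in> ideal_prod R I J"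
      thus "x \<in> D"
      proof (induction rule: ideal_prod.induct)
        case (prod i j)
        thus ?case by (auto simp: J_def inverse_ideal_def R mult.commute)
      next
        case (sum s1 s2)
        thus ?case using ring_set_add[OF D] by (simp add: R)
      qed
    qed
    moreover have "D \<subseteq> ideal_prod R I J"
    proof
      fix x assume x: "x \<in> D"
      have "a \<otimes>\<^bsub>R\<^esub> (x * (e a / a)) \<in> ideal_prod R I J" if "a \<in> A" for a
        using that AI J[OF that] by (intro ideal_prod.prod Jmult[OF x]) blast+
      hence "a * (x * (e a / a)) \<in> ideal_prod R I J" if "a \<in> A" for a using that by (simp add: R)
      hence "(\<Sum>a\<in>A. a * (x * (e a / a))) \<in> ideal_prod R I J"
        unfolding R_def using I0 J0 by (intro sum_in_ideal_prod) auto
      also have "(\<Sum>a\<in>A. a * (x * (e a / a))) = (\<Sum>a\<in>A. x * e a)"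
        using J by (intro sum.cong refl) (metis mult.left_commute)
      also have "\<dots> = x" using e(1) by (simp flip: sum_distrib_left)
      finally show "x \<in> ideal_prod R I J" .
    qed
    ultimately show ?thesis unfolding invertible_ideal_def I_def[symmetric] J_def by blast
  qed
  show ?thesis
    unfolding prufer_domain_def R_def[symmetric] using R.field_axioms sub inv by blast
qed

theorem proposition5p3:
  fixes S :: "'a :: {alg_closed_field, field_char_0} set" and n :: nat
  assumes "\<forall>x :: 'a. algebraic x"
    and "n \<ge> 1"
    and "S \<subseteq> integers_upto n"
  shows "prufer_domain (ring_of_type_algebra :: rat poly fract ring) (to_fract ` int_valued_polys S)"
proof (rule prufer_domain_if_comparable)
  let ?D = "int_valued_polys S"
  note D = ring_set_int_valued_polys[of S]
  show "ring_set (to_fract ` ?D)"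
    unfolding ring_set_def
  proof (intro conjI ballI)
    show "1 \<in> to_fract ` ?D" using ring_set_1[OF D] by (auto simp: image_iff intro!: bexI[of _ 1])
    fix x y assume "x \<in> to_fract ` ?D" "y \<in> to_fract ` ?D"
    then obtain f g where fg: "x = to_fract f" "y = to_fract g" "f \<in> ?D" "g \<in> ?D" by auto
    show "x - y \<in> to_fract ` ?D" "x * y \<in> to_fract ` ?D"
      unfolding fg(1,2) to_fract_diff[symmetric] to_fract_mult[symmetric]
      using ring_set_diff[OF D fg(3,4)] ring_set_mult[OF D fg(3,4)] by blast+
  qed
  fix x y assume "x \<in> to_fract ` ?D" "y \<in> to_fract ` ?D"
  then obtain f g where fg: "x = to_fract f" "y = to_fract g" "f \<in> ?D" "g \<in> ?D" by auto
  have "comparable ?D f g"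
    using comparable_int_valued_polys[of n S f g] assms fg by simp
  then obtain e u v where e: "e \<in> ?D" "u \<in> ?D" "v \<in> ?D" "e * g = u * f" "(1 - e) * f = v * g"
    by (auto simp: comparable_def)
  have "to_fract e * y = to_fract u * x" "(1 - to_fract e) * x = to_fract v * y"
    using arg_cong[OF e(4), of to_fract] arg_cong[OF e(5), of to_fract]
    by (simp_all add: fg to_fract_mult to_fract_diff)
  thus "comparable (to_fract ` ?D) x y" unfolding comparable_def using e(1-3) by blast
qed

end
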